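(* For any $\epsilon>0$, there is an algorithm which, given the number of customers $T\ge1$ and a universe $\mathcal{N}=\{1,\dots,n\}$ of products with preference weights $v_1,\dots,v_n>0$, computes an adaptive policy $A$ for the dynamic maximum load assortment problem whose expected maximum load $\mathcal{E}^A$ satisfies $$\mathcal{E}^A\ \ge\ (1-\epsilon)\cdot\mathrm{OPT}^{\mathrm{DP}}(\mathcal{N}).$$ This policy can be implemented in $O\big(n^{O_\epsilon(\log^3 n)}\big)$ time.
   Context: Multinomial Logit (MNL) model: each product $i\in\mathcal{N}$ has preference weight $v_i>0$ and the no-purchase option $0$ has weight $1$. For an assortment $S\subseteq\mathcal{N}$ let $v(S)=\sum_{i\in S}v_i$, $\phi_i(S)=\frac{v_i}{1+v(S)}$ for $i\in S$, and $\phi_0(S)=\frac{1}{1+v(S)}$. Dynamic setting: $T$ customers arrive one by one. An adaptive policy is a function that maps the current system state (the number of remaining customers and the current load vector $\boldsymbol\ell\in\mathbb{Z}_{\ge0}^n$, where $\ell_i$ is the number of previous customers who chose product $i$) to an assortment offered to the next customer; a customer offered $S$ chooses $i\in S\cup\{0\}$ with probability $\phi_i(S)$. The expected maximum load $\mathcal{E}^A$ of a policy $A$ is the expectation of the maximum entry of the load vector after all $T$ customers, starting from the zero vector. $\mathrm{OPT}^{\mathrm{DP}}(\mathcal{N})$ is the maximum of $\mathcal{E}^A$ over all adaptive policies $A$. "Implementation" of a policy encompasses both any preprocessing steps undertaken before the beginning of the customer arrival process and the additional procedures required to compute the personalized assortment offered to each arriving customer. The notation $O_\epsilon(\cdot)$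 hides polynomial dependencies on $1/\epsilon$. *)

theory Defs
  imports "HOL-Probability.Probability" "HOL-Computational_Algebra.Polynomial"
begin

section \<open>Multinomial logit choice\<close>

text \<open>Products are the numbers 1, ..., n and 0 is the no-purchase option; only the values
  \<open>v i\<close> with \<open>i \<in> {1..n}\<close> matter.\<close>

definition total_weight :: "(nat \<Rightarrow> real) \<Rightarrow> nat set \<Rightarrow> real" where
  "total_weight v S = (\<Sum>i\<in>S. v i)"

definition choice_prob :: "(nat \<Rightarrow> real) \<Rightarrow> nat set \<Rightarrow> nat \<Rightarrow> real" where
  "choice_prob v S i =
     (if i = 0 then 1 / (1 + total_weight v S)
      else if i \<in> S then v i / (1 + total_weight v S)
      else 0)"

definition choice :: "(nat \<Rightarrow> real) \<Rightarrow> nat set \<Rightarrow> nat pmf" where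
  "choice v S = embed_pmf (choice_prob v S)"

lemma pmf_choice:
  assumes S: "S \<subseteq> {1..n}" and v: "\<forall>i\<in>{1..n}. v i > 0"
  shows "pmf (choice v S) i = choice_prob v S i"
proof -
  have fin: "finite S" using S finite_subset by blast
  have S0: "0 \<notin> S" using S by auto
  have vS: "\<And>i. i \<in> S \<Longrightarrow> v i > 0" using S v by auto
  have w: "total_weight v S \<ge> 0"
    unfolding total_weight_def by (rule sum_nonneg) (use vS in force)
  have nn: "choice_prob v S i \<ge> 0" for i
    using w vS[of i] by (auto simp: choice_prob_def)
  have "(\<integral>\<^sup>+ i. ennreal (choice_prob v S i) \<partial>count_space UNIV)
      = (\<integral>\<^sup>+ i. ennreal (choice_prob v S i) \<partial>count_space (insert 0 S))"
    by (subst (2) nn_integral_count_space_indicator)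
       (auto intro!: nn_integral_cong simp: choice_prob_def indicator_def fin)
  also have "\<dots> = (\<Sum>i\<in>insert 0 S. ennreal (choice_prob v S i))"
    using fin by (intro nn_integral_count_space_finite) auto
  also have "\<dots> = ennreal (\<Sum>i\<in>insert 0 S. choice_prob v S i)"
    using nn by (intro sum_ennreal) auto
  also have "(\<Sum>i\<in>insert 0 S. choice_prob v S i)
      = 1 / (1 + total_weight v S) + (\<Sum>i\<in>S. v i / (1 + total_weight v S))"
    using fin S0 by (auto simp: choice_prob_def intro!: sum.cong)
  also have "\<dots> = 1"
    using w by (simp add: sum_divide_distrib[symmetric] total_weight_def[symmetric]
        add_divide_distrib[symmetric])
  finally show ?thesis
    unfolding choice_def using nn by (subst pmf_embed_pmf) auto
qed

lemma set_pmf_choice: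
  assumes "S \<subseteq> {1..n}" and "\<forall>i\<in>{1..n}. v i > 0"
  shows "set_pmf (choice v S) \<subseteq> insert 0 S"
  using pmf_choice[OF assms] by (auto simp: set_pmf_iff choice_prob_def split: if_splits)


section \<open>Adaptive policies\<close>

text \<open>A policy is applied to the number of remaining customers (the one about to be served
  included) and to the current load vector.\<close>

type_synonym policy = "nat \<Rightarrow> (nat \<Rightarrow> nat) \<Rightarrow> nat set"

definition policies :: "nat \<Rightarrow> policy set" where
  "policies n = {A. \<forall>r l. A r l \<subseteq> {1..n}}"

definition add_choice :: "nat \<Rightarrow> (nat \<Rightarrow> nat) \<Rightarrow> (nat \<Rightarrow> nat)" where
  "add_choice i l = (if i = 0 then l else l(i := l i + 1))"

text \<open>The distribution of the final load vector when \<open>r\<close> customers remain and the current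
  load vector is \<open>l\<close>.\<close>

primrec final_load ::
    "(nat \<Rightarrow> real) \<Rightarrow> policy \<Rightarrow> nat \<Rightarrow> (nat \<Rightarrow> nat) \<Rightarrow> (nat \<Rightarrow> nat) pmf" where
  "final_load v A 0 l = return_pmf l"
| "final_load v A (Suc r) l =
     bind_pmf (choice v (A (Suc r) l)) (\<lambda>i. final_load v A r (add_choice i l))"

definition max_load :: "nat \<Rightarrow> (nat \<Rightarrow> nat) \<Rightarrow> nat" where
  "max_load n l = Max (l ` {1..n})"

definition expected_max_load :: "nat \<Rightarrow> nat \<Rightarrow> (nat \<Rightarrow> real) \<Rightarrow> policy \<Rightarrow> real" where
  "expected_max_load n T v A =
     measure_pmf.expectation (final_load v A T (\<lambda>_. 0)) (\<lambda>l. real (max_load n l))"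

definition opt_dp :: "nat \<Rightarrow> nat \<Rightarrow> (nat \<Rightarrow> real) \<Rightarrow> real" where
  "opt_dp n T v = Max (expected_max_load n T v ` policies n)"

lemma finite_set_final_load:
  assumes "A \<in> policies n" and "\<forall>i\<in>{1..n}. v i > 0"
  shows "finite (set_pmf (final_load v A r l))"
proof (induction r arbitrary: l)
  case (Suc r)
  have S: "A (Suc r) l \<subseteq> {1..n}" using assms(1) by (auto simp: policies_def)
  have "finite (set_pmf (choice v (A (Suc r) l)))"
    using set_pmf_choice[OF S assms(2)] finite_subset[OF S] finite_subset by blast
  then show ?case using Suc.IH by simp
qed simp

lemma finite_final_loads:
  assumes v: "\<forall>i\<in>{1..n}. v i > 0"
  shows "finite ((\<lambda>A. final_load v A r l) ` policies n)"
proof (induction r arbitrary: l)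
  case 0
  then show ?case by (auto intro: finite_subset[of _ "{return_pmf l}"])
next
  case (Suc r)
  let ?X = "\<lambda>i. (\<lambda>A. final_load v A r (add_choice i l)) ` policies n"
  let ?U = "\<Union>S\<in>Pow {1..n}. (\<lambda>D. bind_pmf (choice v S) D) ` (PiE {0..n} ?X)"
  have "finite ?U"
    by (intro finite_UN_I finite_imageI[where F = "PiE _ _"] finite_PiE Suc.IH) simp_all
  moreover have "(\<lambda>A. final_load v A (Suc r) l) ` policies n \<subseteq> ?U"
  proof
    fix q assume "q \<in> (\<lambda>A. final_load v A (Suc r) l) ` policies n"
    then obtain A where A: "A \<in> policies n" and q: "q = final_load v A (Suc r) l" by auto
    let ?D = "restrict (\<lambda>i. final_load v A r (add_choice i l)) {0..n}"
    have S: "A (Suc r) l \<subseteq> {1..n}" using A by (auto simp: policies_def)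
    have "set_pmf (choice v (A (Suc r) l)) \<subseteq> {0..n}"
      using set_pmf_choice[OF S v] S by fastforce
    then have "q = bind_pmf (choice v (A (Suc r) l)) ?D"
      unfolding q by (auto intro!: bind_pmf_cong simp: subset_iff)
    moreover have "?D \<in> PiE {0..n} ?X" using A by auto
    ultimately show "q \<in> ?U" using S by blast
  qed
  ultimately show ?case by (rule rev_finite_subset)
qed

lemma opt_dp_attained:
  assumes v: "\<forall>i\<in>{1..n}. v i > 0"
  shows "\<exists>A\<in>policies n. expected_max_load n T v A = opt_dp n T v"
    and "A \<in> policies n \<Longrightarrow> expected_max_load n T v A \<le> opt_dp n T v"
proof -
  have fin: "finite (expected_max_load n T v ` policies n)"
    using finite_imageI[OF finite_final_loads[OF v, of T "\<lambda>_. 0"],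
        of "\<lambda>D. measure_pmf.expectation D (\<lambda>l. real (max_load n l))"]
    by (simp add: image_image expected_max_load_def[abs_def])
  have "(\<lambda>_ _. {}) \<in> policies n" by (simp add: policies_def)
  then have "opt_dp n T v \<in> expected_max_load n T v ` policies n"
    unfolding opt_dp_def using fin by (intro Max_in) auto
  then show "\<exists>A\<in>policies n. expected_max_load n T v A = opt_dp n T v" by force
  show "expected_max_load n T v A \<le> opt_dp n T v" if "A \<in> policies n"
    unfolding opt_dp_def using fin that by (intro Max_ge) auto
qed


section \<open>Real RAM programs and their running time\<close>

text \<open>Structured programs for a real RAM: a finite program works on integer and real
  variables and on unbounded integer and real arrays. Elementary instructions and tests cost 1.
  Reals are exact, with arithmetic and comparison but without rounding or any other conversion
  to integers; integer instructions are additive only, integers serving as counters and array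
  indices. Integer subtraction is truncated, and real division by 0 gives 0. Program
  constants are natural numbers, so that no information can be hidden in a real constant.\<close>

type_synonym vname = string

record mem =
  ivar :: "vname \<Rightarrow> nat"
  rvar :: "vname \<Rightarrow> real"
  iarr :: "vname \<Rightarrow> nat \<Rightarrow> nat"
  rarr :: "vname \<Rightarrow> nat \<Rightarrow> real"

datatype instr =
    IConst vname nat
  | IAdd vname vname vname
  | ISub vname vname vname
  | ILoad vname vname vname
  | IStore vname vname vname
  | ROfInt vname vname
  | RAdd vname vname vname
  | RSub vname vname vname
  | RMul vname vname vname
  | RDiv vname vname vname
  | RLoad vname vname vname
  | RStore vname vname vname

primrec effect :: "instr \<Rightarrow> mem \<Rightarrow> mem" where
  "effect (IConst x k) s = s\<lparr>ivar := (ivar s)(x := k)\<rparr>"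
| "effect (IAdd x y z) s = s\<lparr>ivar := (ivar s)(x := ivar s y + ivar s z)\<rparr>"
| "effect (ISub x y z) s = s\<lparr>ivar := (ivar s)(x := ivar s y - ivar s z)\<rparr>"
| "effect (ILoad x a y) s = s\<lparr>ivar := (ivar s)(x := iarr s a (ivar s y))\<rparr>"
| "effect (IStore a y x) s =
     s\<lparr>iarr := (iarr s)(a := (iarr s a)(ivar s y := ivar s x))\<rparr>"
| "effect (ROfInt x y) s = s\<lparr>rvar := (rvar s)(x := real (ivar s y))\<rparr>"
| "effect (RAdd x y z) s = s\<lparr>rvar := (rvar s)(x := rvar s y + rvar s z)\<rparr>"
| "effect (RSub x y z) s = s\<lparr>rvar := (rvar s)(x := rvar s y - rvar s z)\<rparr>"
| "effect (RMul x y z) s = s\<lparr>rvar := (rvar s)(x := rvar s y * rvar s z)\<rparr>"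
| "effect (RDiv x y z) s = s\<lparr>rvar := (rvar s)(x := rvar s y / rvar s z)\<rparr>"
| "effect (RLoad x a y) s = s\<lparr>rvar := (rvar s)(x := rarr s a (ivar s y))\<rparr>"
| "effect (RStore a y x) s =
     s\<lparr>rarr := (rarr s)(a := (rarr s a)(ivar s y := rvar s x))\<rparr>"

datatype test = ILess vname vname | RLess vname vname

primrec holds :: "test \<Rightarrow> mem \<Rightarrow> bool" where
  "holds (ILess x y) s = (ivar s x < ivar s y)"
| "holds (RLess x y) s = (rvar s x < rvar s y)"

datatype prog =
    Do instr
  | Seq prog prog
  | Branch test prog prog
  | Loop test prog

text \<open>\<open>runs c s t s'\<close>: started in \<open>s\<close>, program \<open>c\<close> halts in \<open>s'\<close> after exactly \<open>t\<close> steps.\<close>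

inductive runs :: "prog \<Rightarrow> mem \<Rightarrow> nat \<Rightarrow> mem \<Rightarrow> bool" where
  Do: "runs (Do i) s 1 (effect i s)"
| Seq: "runs c s t s' \<Longrightarrow> runs d s' t' s'' \<Longrightarrow> runs (Seq c d) s (t + t') s''"
| BranchTrue: "holds b s \<Longrightarrow> runs c s t s' \<Longrightarrow> runs (Branch b c d) s (t + 1) s'"
| BranchFalse: "\<not> holds b s \<Longrightarrow> runs d s t s' \<Longrightarrow> runs (Branch b c d) s (t + 1) s'"
| LoopFalse: "\<not> holds b s \<Longrightarrow> runs (Loop b c) s 1 s"
| LoopTrue: "holds b s \<Longrightarrow> runs c s t s' \<Longrightarrow> runs (Loop b c) s' t' s''
    \<Longrightarrow> runs (Loop b c) s (t + t' + 1) s''"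

inductive_cases DoE: "runs (Do i) s t s'"
inductive_cases SeqE: "runs (Seq c d) s t s'"
inductive_cases BranchE: "runs (Branch b c d) s t s'"
inductive_cases LoopE: "runs (Loop b c) s t s'"

lemma runs_deterministic:
  "runs c s t s' \<Longrightarrow> runs c s u q \<Longrightarrow> u = t \<and> q = s'"
proof (induction arbitrary: u q rule: runs.induct)
  case (Do i s)
  from Do.prems show ?case by (rule DoE) simp
next
  case (Seq c s t s' d t' s'')
  from Seq.prems obtain t1 m t2
    where 1: "runs c s t1 m" and 2: "runs d m t2 q" and u: "u = t1 + t2"
    by (rule SeqE)
  have m: "t1 = t \<and> m = s'" by (rule Seq.IH(1)[OF 1])
  then have "t2 = t' \<and> q = s''" using 2 by (intro Seq.IH(2)) simp
  with m u show ?case by simp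
next
  case (BranchTrue b s c t s' d)
  from BranchTrue.prems obtain t1 where 1: "runs c s t1 q" and u: "u = t1 + 1"
    by (rule BranchE) (use BranchTrue.hyps in simp_all)
  show ?case using BranchTrue.IH[OF 1] u by simp
next
  case (BranchFalse b s d t s' c)
  from BranchFalse.prems obtain t1 where 1: "runs d s t1 q" and u: "u = t1 + 1"
    by (rule BranchE) (use BranchFalse.hyps in simp_all)
  show ?case using BranchFalse.IH[OF 1] u by simp
next
  case (LoopFalse b s c)
  from LoopFalse.prems show ?case
    by (rule LoopE) (use LoopFalse.hyps in simp_all)
next
  case (LoopTrue b s c t s' t' s'')
  from LoopTrue.prems obtain t1 m t2
    where 1: "runs c s t1 m" and 2: "runs (Loop b c) m t2 q" and u: "u = t1 + t2 + 1"
    by (rule LoopE) (use LoopTrue.hyps in simp_all)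
  have m: "t1 = t \<and> m = s'" by (rule LoopTrue.IH(1)[OF 1])
  then have "t2 = t' \<and> q = s''" using 2 by (intro LoopTrue.IH(2)) simp
  with m u show ?case by simp
qed


section \<open>Implementing a policy\<close>

text \<open>An implementation consists of a preprocessing program, run once on the instance, and an
  assortment program, run for each arriving customer on the memory left by the preprocessing
  together with the current state. No other information is passed between
  customers, in accordance with a policy being a function of the state.\<close>

datatype policy_algorithm = Policy_Algorithm (preprocess: prog) (assort: prog)

definition instance_mem :: "nat \<Rightarrow> nat \<Rightarrow> (nat \<Rightarrow> real) \<Rightarrow> mem" where
  "instance_mem n T v =
     \<lparr>ivar = (\<lambda>_. 0)(''n'' := n, ''T'' := T),
      rvar = (\<lambda>_. 0),
      iarr = (\<lambda>_ _. 0),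
      rarr = (\<lambda>_ _. 0)(''v'' := (\<lambda>i. if i \<in> {1..n} then v i else 0))\<rparr>"

definition enter_state :: "nat \<Rightarrow> (nat \<Rightarrow> nat) \<Rightarrow> mem \<Rightarrow> mem" where
  "enter_state r l s =
     s\<lparr>ivar := (ivar s)(''r'' := r), iarr := (iarr s)(''load'' := l)\<rparr>"

definition offered :: "nat \<Rightarrow> mem \<Rightarrow> nat set" where
  "offered n s = {i \<in> {1..n}. iarr s ''offer'' i \<noteq> 0}"

text \<open>The states in which a customer may arrive when \<open>T\<close> customers are served from the zero
  load vector.\<close>

definition customer_states :: "nat \<Rightarrow> nat \<Rightarrow> (nat \<times> (nat \<Rightarrow> nat)) set" where
  "customer_states n T =
     {(r, l). 1 \<le> r \<and> r \<le> T \<and> (\<forall>i. i \<notin> {1..n} \<longrightarrow> l i = 0) \<and> (\<Sum>i\<in>{1..n}. l i) \<le> T - r}"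

text \<open>The bound \<open>B\<close> applies to the preprocessing and to the computation of each single
  assortment.\<close>

definition implements_within ::
    "policy_algorithm \<Rightarrow> nat \<Rightarrow> nat \<Rightarrow> (nat \<Rightarrow> real) \<Rightarrow> policy \<Rightarrow> real \<Rightarrow> bool" where
  "implements_within alg n T v A B \<longleftrightarrow>
     (\<exists>t s. runs (preprocess alg) (instance_mem n T v) t s \<and> real t \<le> B \<and>
        (\<forall>(r, l) \<in> customer_states n T.
           \<exists>t' s'. runs (assort alg) (enter_state r l s) t' s' \<and> real t' \<le> B \<and>
             offered n s' = A r l))"

end

theory Submission
  imports Defs
begin

text \<open>
  With \<open>m\<close> a whole number at least \<open>3 / \<epsilon>\<close> and \<open>v\<^sub>h\<close> the largest weight, three regimes are
  distinguished; in the first two a fixed offer is good enough, in the third a dynamic program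
  is solved.

  \<^item> \<^emph>\<open>The heaviest product alone\<close> (\<open>offer_heaviest\<close>). Whatever is offered, a product is chosen with
    probability at most \<open>p = v\<^sub>h / (1 + v\<^sub>h)\<close>, so an exponential moment bounds the expected maximum load
    by \<open>T p\<close> up to a factor close to 1 as soon as \<open>T p\<close> exceeds a multiple of \<open>m\<^sup>2 ln n\<close>. The product
    \<open>h\<close> offered alone earns \<open>T p\<close>. If \<open>v\<^sub>h \<ge> m\<close>, then \<open>p\<close> is close to 1 and \<open>T\<close> is an upper bound.
  \<^item> \<^emph>\<open>All products\<close> (\<open>offer_everything\<close>). If the total weight is at most \<open>1 / m\<close>, the denominators
    hardly matter: offering everything gives each product almost its largest possible
    probability \<open>v\<^sub>i\<close>, so up to a thinning by \<open>1 - 1 / m\<close> it buys at least what any policy buys.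
  \<^item> \<^emph>\<open>The dynamic program\<close> (\<open>rounded_greedy_policy\<close>). Otherwise \<open>1 / (m n) < v\<^sub>h < m\<close>, hence \<open>T\<close> is
    polynomial in \<open>n\<close> and \<open>m\<close>, loads beyond \<open>L = O(m\<^sup>2 log n)\<close> have negligible expected contribution,
    and the optimum is at least \<open>1 / (2 m)\<close>, so that additive errors of order \<open>1 / m\<^sup>2\<close> are harmless.
    Loads are capped at \<open>L\<close>, weights up to a tiny threshold \<open>\<eta>\<close> are replaced by 0 and the others are
    rounded down to numbers \<open>\<eta> (1 + \<delta>)\<^sup>c\<close> with \<open>\<delta> = 1 / (m L)\<close>. A load vector now matters
    only through the number of products of each of \<open>K = O(m L\<^sup>3)\<close> types (weight class, capped load), which leaves at most \<open>(2 n)\<^sup>K\<close> states.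

  The delicate point is that the policy optimal for rounded weights is executed with the true
  ones, and that the error of a single step is relative to the gain \<open>V (r + 1) - V r\<close>
  of that step, while up to \<open>T\<close> steps are made. The key estimate is \<open>best_increment_le\<close>: a fixed state satisfies
  \<open>V r - V (r - 1) \<le> V r / r\<close>, because skipping a customer chosen uniformly among \<open>r\<close> costs
  only the chance that this customer bought the product that ends up with the maximum load. The losses
  therefore add up to a factor \<open>1 - \<delta> (1 + 1/2 + ... + 1/T)\<close> (\<open>policy_value_robust\<close>), which is at least
  \<open>1 - 1 / m\<close> because the harmonic sum is at most \<open>L\<close>. This estimate is used twice, for the passage from the true to the rounded weights
  and for the way back.

  Since an optimal assortment consists of all products whose purchase leads to a value above
  the current optimum, one entry of the table is found by trying the \<open>K\<close> thresholds.
  The types are encoded in one number in base \<open>B = 2\<^sup>g > n\<close>, a purchase adds a nonnegative increment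
  to it, and the table can therefore be updated in place, in ascending order
  (\<open>table_eq_best\<close>, \<open>wp_update_table\<close>). The program recomputes the table
  for every customer; its cost is dominated by \<open>T B\<^bsup>3 K\<^esup>\<close>, and \<open>K = O(m\<^sup>7 log\<^sup>3 n)\<close>.
\<close>


section \<open>Values of policies as averages over choices\<close>

text \<open>The expectation of \<open>h\<close> at the choice of a customer who is offered \<open>S\<close>. The closed form is
  linear in \<open>h\<close>, and it is also used for weights 0, which rounding produces.\<close>
definition mean :: "(nat \<Rightarrow> real) \<Rightarrow> nat set \<Rightarrow> (nat \<Rightarrow> real) \<Rightarrow> real" where
  "mean u S h = (h 0 + (\<Sum>i\<in>S. u i * h i)) / (1 + total_weight u S)"

definition nonneg_weights :: "nat \<Rightarrow> (nat \<Rightarrow> real) \<Rightarrow> bool" where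
  "nonneg_weights n u \<longleftrightarrow> (\<forall>i\<in>{1..n}. 0 \<le> u i)"

lemma total_weight_nonneg:
  assumes "nonneg_weights n u" "S \<subseteq> {1..n}"
  shows "0 \<le> total_weight u S"
  using assms unfolding total_weight_def nonneg_weights_def by (auto intro!: sum_nonneg)

lemma mean_minus:
  assumes u: "nonneg_weights n u" "S \<subseteq> {1..n}"
  shows "mean u S h - c = ((h 0 - c) + (\<Sum>i\<in>S. u i * (h i - c))) / (1 + total_weight u S)"
proof -
  have "1 + total_weight u S > 0" using total_weight_nonneg[OF u] by simp
  then show ?thesis
    unfolding mean_def
    by (simp add: field_simps sum_subtractf sum_distrib_left total_weight_def)
qed

text \<open>Written relative to the no-purchase outcome, an average is a sum of nonnegative gains whenever
  purchases are profitable. All comparisons of weights below are comparisons of such sums.\<close>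
lemma mean_gain:
  assumes "nonneg_weights n u" "S \<subseteq> {1..n}"
  shows "mean u S h = h 0 + (\<Sum>i\<in>S. u i * (h i - h 0)) / (1 + total_weight u S)"
  using mean_minus[OF assms, of h "h 0"] by simp

lemma mean_mono:
  assumes u: "nonneg_weights n u" "S \<subseteq> {1..n}"
    and "h 0 \<le> k 0" and "\<And>i. i \<in> S \<Longrightarrow> h i \<le> k i"
  shows "mean u S h \<le> mean u S k"
  unfolding mean_def using total_weight_nonneg[OF u] assms
  by (intro divide_right_mono add_mono sum_mono mult_left_mono) (auto simp: nonneg_weights_def)

lemma mean_add: "mean u S (\<lambda>j. h j + k j) = mean u S h + mean u S k"
  by (simp add: mean_def sum.distrib distrib_left add_divide_distrib)

lemma mean_cmult: "mean u S (\<lambda>j. c * h j) = c * mean u S h"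
proof -
  have "(\<Sum>i\<in>S. u i * (c * h i)) = c * (\<Sum>i\<in>S. u i * h i)"
    by (simp add: sum_distrib_left mult_ac)
  then show ?thesis by (simp add: mean_def distrib_left)
qed

lemma mean_diff: "mean u S (\<lambda>j. h j - k j) = mean u S h - mean u S k"
  using mean_add[of u S h "\<lambda>j. (-1) * k j"] mean_cmult[of u S "-1" k] by simp

lemma mean_sum:
  "finite I \<Longrightarrow> mean u S (\<lambda>j. \<Sum>i\<in>I. h i j) = (\<Sum>i\<in>I. mean u S (h i))"
proof (induction I rule: finite_induct)
  case empty
  then show ?case by (simp add: mean_def)
next
  case (insert i I)
  then show ?case by (simp add: mean_add)
qed

lemma mean_const:
  assumes "nonneg_weights n u" "S \<subseteq> {1..n}"
  shows "mean u S (\<lambda>_. c) = c"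
  by (simp add: mean_gain[OF assms])

lemma expectation_choice:
  assumes S: "S \<subseteq> {1..n}" and v: "\<forall>i\<in>{1..n}. v i > 0"
  shows "measure_pmf.expectation (choice v S) h = mean v S h"
proof -
  have fin: "finite S" and S0: "0 \<notin> S" using S finite_subset by auto
  have "measure_pmf.expectation (choice v S) h
      = (\<Sum>i\<in>insert 0 S. pmf (choice v S) i *\<^sub>R h i)"
    using set_pmf_choice[OF S v] fin by (intro integral_measure_pmf) auto
  also have "\<dots> = (\<Sum>i\<in>insert 0 S. choice_prob v S i * h i)"
    by (simp add: pmf_choice[OF S v])
  also have "\<dots> = mean v S h"
    using fin S0 by (auto simp: choice_prob_def mean_def sum_divide_distrib add_divide_distrib
        intro!: sum.cong)
  finally show ?thesis .
qed

primrec policy_value ::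
    "(nat \<Rightarrow> real) \<Rightarrow> policy \<Rightarrow> ((nat \<Rightarrow> nat) \<Rightarrow> real) \<Rightarrow> nat \<Rightarrow> (nat \<Rightarrow> nat) \<Rightarrow> real" where
  "policy_value u A f 0 l = f l"
| "policy_value u A f (Suc r) l =
     mean u (A (Suc r) l) (\<lambda>j. policy_value u A f r (add_choice j l))"

lemma expectation_final_load:
  assumes A: "A \<in> policies n" and v: "\<forall>i\<in>{1..n}. v i > 0"
  shows "measure_pmf.expectation (final_load v A r l) f = policy_value v A f r l"
proof (induction r arbitrary: l)
  case (Suc r)
  have S: "A (Suc r) l \<subseteq> {1..n}" using A by (auto simp: policies_def)
  have finS: "finite (set_pmf (choice v (A (Suc r) l)))"
    using set_pmf_choice[OF S v] finite_subset[OF S] finite_subset by blast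
  have "measure_pmf.expectation (final_load v A (Suc r) l) f
     = measure_pmf.expectation (choice v (A (Suc r) l))
         (\<lambda>i. measure_pmf.expectation (final_load v A r (add_choice i l)) f)"
    using finS finite_set_final_load[OF A v]
    by (simp add: pmf_expectation_bind[where A = "set_pmf (choice v (A (Suc r) l))"]
        integral_measure_pmf[where A = "set_pmf (choice v (A (Suc r) l))"])
  then show ?case by (simp add: Suc expectation_choice[OF S v])
qed simp

lemma expected_max_load_eq:
  assumes "A \<in> policies n" and "\<forall>i\<in>{1..n}. v i > 0"
  shows "expected_max_load n T v A = policy_value v A (\<lambda>l. real (max_load n l)) T (\<lambda>_. 0)"
  unfolding expected_max_load_def by (rule expectation_final_load[OF assms])

lemma policy_value_mono:
  assumes u: "nonneg_weights n u" and A: "A \<in> policies n" and "\<And>l. f l \<le> g l"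
  shows "policy_value u A f r l \<le> policy_value u A g r l"
proof (induction r arbitrary: l)
  case 0
  then show ?case using assms(3) by simp
next
  case (Suc r)
  have S: "A (Suc r) l \<subseteq> {1..n}" using A by (auto simp: policies_def)
  then show ?case using mean_mono[OF u S] Suc.IH by simp
qed

lemma policy_value_linear:
  "policy_value u A (\<lambda>l. a * f l + b * g l) r l
     = a * policy_value u A f r l + b * policy_value u A g r l"
proof (induction r arbitrary: l)
  case (Suc r)
  then show ?case by (simp add: mean_add mean_cmult)
qed simp

lemma policy_value_const:
  assumes u: "nonneg_weights n u" and A: "A \<in> policies n"
  shows "policy_value u A (\<lambda>_. c) r l = c"
proof (induction r arbitrary: l)
  case (Suc r)
  have S: "A (Suc r) l \<subseteq> {1..n}" using A by (auto simp: policies_def)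
  show ?case by (simp add: Suc mean_const[OF u S])
qed simp

lemma add_choice_commute: "add_choice i (add_choice j l) = add_choice j (add_choice i l)"
  by (auto simp: add_choice_def)

lemma add_choice_0 [simp]: "add_choice 0 l = l"
  by (simp add: add_choice_def)

lemma add_choice_apply: "i \<noteq> 0 \<Longrightarrow> add_choice j l i = l i + (if i = j then 1 else 0)"
  by (auto simp: add_choice_def)

text \<open>The exponential moment used for the tails of the maximum load; it dominates \<open>a\<close> to the power
  of the maximum load.\<close>
definition exp_sum :: "real \<Rightarrow> nat \<Rightarrow> (nat \<Rightarrow> nat) \<Rightarrow> real" where
  "exp_sum a n l = (\<Sum>i\<in>{1..n}. a ^ l i)"

text \<open>One customer multiplies the moment by at most \<open>1 + (a - 1) p\<close> on average, because every product is
  chosen with probability at most \<open>p = w / (1 + w)\<close> under every offer.\<close>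
lemma policy_value_exp_sum:
  assumes u: "nonneg_weights n u" and A: "A \<in> policies n" and a: "a \<ge> 1"
    and w: "\<And>i. i \<in> {1..n} \<Longrightarrow> u i \<le> w" and w0: "0 \<le> w"
  shows "policy_value u A (exp_sum a n) r l \<le> (1 + (a - 1) * (w / (1 + w))) ^ r * exp_sum a n l"
proof (induction r arbitrary: l)
  case (Suc r)
  let ?S = "A (Suc r) l" and ?p = "w / (1 + w)"
  let ?c = "1 + (a - 1) * (w / (1 + w))"
  have S: "?S \<subseteq> {1..n}" using A by (auto simp: policies_def)
  have fin: "finite ?S" using S finite_subset by blast
  have ex: "exp_sum a n (add_choice i l) - exp_sum a n l = (a - 1) * a ^ l i" if "i \<in> ?S" for i
  proof -
    have i: "i \<in> {1..n}" using that S by auto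
    have "exp_sum a n (add_choice i l) - exp_sum a n l
       = (\<Sum>k\<in>{1..n}. if k = i then (a - 1) * a ^ l i else 0)"
      unfolding exp_sum_def sum_subtractf[symmetric]
      by (rule sum.cong) (use i in \<open>auto simp: add_choice_apply algebra_simps\<close>)
    then show ?thesis using i by simp
  qed
  have pi: "u i / (1 + total_weight u ?S) \<le> ?p" if "i \<in> ?S" for i
  proof -
    have i: "i \<in> {1..n}" using that S by auto
    have ui: "0 \<le> u i" "u i \<le> w" using u i w by (auto simp: nonneg_weights_def)
    have "u i \<le> total_weight u ?S" unfolding total_weight_def
      using that fin S u by (intro member_le_sum) (auto simp: nonneg_weights_def)
    then have "u i / (1 + total_weight u ?S) \<le> u i / (1 + u i)"
      using ui by (intro divide_left_mono) auto
    also have "\<dots> \<le> ?p" using ui by (simp add: field_simps)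
    finally show "u i / (1 + total_weight u ?S) \<le> ?p" .
  qed
  have p0: "0 \<le> ?p" using w0 by auto
  have nn: "0 \<le> ?p * ((a - 1) * a ^ l i)" for i
    by (rule mult_nonneg_nonneg[OF p0]) (use a in auto)
  have "mean u ?S (\<lambda>j. exp_sum a n (add_choice j l))
    = exp_sum a n l + (\<Sum>i\<in>?S. u i * ((a - 1) * a ^ l i)) / (1 + total_weight u ?S)"
    using ex by (simp add: mean_gain[OF u S])
  also have "\<dots> = exp_sum a n l + (\<Sum>i\<in>?S. u i / (1 + total_weight u ?S) * ((a - 1) * a ^ l i))"
    by (simp add: sum_divide_distrib)
  also have "\<dots> \<le> exp_sum a n l + (\<Sum>i\<in>?S. ?p * ((a - 1) * a ^ l i))"
    using pi a by (intro add_left_mono sum_mono mult_right_mono) auto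
  also have "\<dots> \<le> exp_sum a n l + (\<Sum>i\<in>{1..n}. ?p * ((a - 1) * a ^ l i))"
    using S nn by (intro add_left_mono sum_mono2) auto
  also have "\<dots> = ?c * exp_sum a n l"
    unfolding exp_sum_def sum_distrib_left[symmetric] by (simp only: distrib_right distrib_left mult_1 mult_1_right mult_ac)
  finally have 1: "mean u ?S (\<lambda>j. exp_sum a n (add_choice j l)) \<le> ?c * exp_sum a n l" .
  have c: "0 \<le> ?c ^ r" using mult_nonneg_nonneg[of "a - 1", OF _ p0] a
    by (intro zero_le_power) linarith
  have "policy_value u A (exp_sum a n) (Suc r) l
     \<le> mean u ?S (\<lambda>j. ?c ^ r * exp_sum a n (add_choice j l))"
    using mean_mono[OF u S] Suc.IH by simp
  also have "\<dots> \<le> ?c ^ r * (?c * exp_sum a n l)"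
    unfolding mean_cmult using 1 c by (rule mult_left_mono)
  finally show ?case by (simp add: mult_ac)
qed simp

section \<open>Optimal values\<close>

primrec best ::
    "nat \<Rightarrow> (nat \<Rightarrow> real) \<Rightarrow> ((nat \<Rightarrow> nat) \<Rightarrow> real) \<Rightarrow> nat \<Rightarrow> (nat \<Rightarrow> nat) \<Rightarrow> real" where
  "best n u f 0 l = f l"
| "best n u f (Suc r) l =
     Max ((\<lambda>S. mean u S (\<lambda>j. best n u f r (add_choice j l))) ` Pow {1..n})"

lemma mean_le_best:
  "S \<subseteq> {1..n} \<Longrightarrow> mean u S (\<lambda>j. best n u f r (add_choice j l)) \<le> best n u f (Suc r) l"
  by (auto intro!: Max_ge)

lemma best_attained:
  "\<exists>S\<subseteq>{1..n}. best n u f (Suc r) l = mean u S (\<lambda>j. best n u f r (add_choice j l))"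
proof -
  have "best n u f (Suc r) l
      \<in> (\<lambda>S. mean u S (\<lambda>j. best n u f r (add_choice j l))) ` Pow {1..n}"
    unfolding best.simps by (intro Max_in) auto
  then show ?thesis by auto
qed

lemma best_le_iff:
  "best n u f (Suc r) l \<le> c
     \<longleftrightarrow> (\<forall>S\<subseteq>{1..n}. mean u S (\<lambda>j. best n u f r (add_choice j l)) \<le> c)"
  unfolding best.simps by (subst Max_le_iff) auto

lemma best_Suc_mono: "best n u f r l \<le> best n u f (Suc r) l"
  using mean_le_best[of "{}" n u f r l] by (simp add: mean_def total_weight_def)

lemma policy_value_le_best:
  assumes u: "nonneg_weights n u" and A: "A \<in> policies n"
  shows "policy_value u A f r l \<le> best n u f r l"
proof (induction r arbitrary: l)
  case (Suc r)
  have S: "A (Suc r) l \<subseteq> {1..n}" using A by (auto simp: policies_def)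
  have "policy_value u A f (Suc r) l
      \<le> mean u (A (Suc r) l) (\<lambda>j. best n u f r (add_choice j l))"
    using mean_mono[OF u S] Suc.IH by simp
  also have "\<dots> \<le> best n u f (Suc r) l" by (rule mean_le_best[OF S])
  finally show ?case .
qed simp

lemma best_add_choice_mono:
  assumes u: "nonneg_weights n u"
    and f: "\<And>j l. j \<in> {1..n} \<Longrightarrow> f l \<le> f (add_choice j l)"
    and j: "j \<in> {1..n}"
  shows "best n u f r l \<le> best n u f r (add_choice j l)"
proof (induction r arbitrary: l)
  case 0
  then show ?case using f j by simp
next
  case (Suc r)
  show ?case unfolding best_le_iff
  proof (intro allI impI)
    fix S assume S: "S \<subseteq> {1..n}"
    have "mean u S (\<lambda>i. best n u f r (add_choice i l))
        \<le> mean u S (\<lambda>i. best n u f r (add_choice i (add_choice j l)))"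
      using Suc.IH by (intro mean_mono[OF u S]) (simp_all add: add_choice_commute[of _ j])
    also have "\<dots> \<le> best n u f (Suc r) (add_choice j l)" by (rule mean_le_best[OF S])
    finally show "mean u S (\<lambda>i. best n u f r (add_choice i l))
        \<le> best n u f (Suc r) (add_choice j l)" .
  qed
qed

lemma best_add_choice_le:
  assumes u: "nonneg_weights n u"
    and f: "\<And>j l. j \<in> {1..n} \<Longrightarrow> f (add_choice j l) \<le> f l + 1"
    and j: "j \<in> {1..n}"
  shows "best n u f r (add_choice j l) \<le> best n u f r l + 1"
proof (induction r arbitrary: l)
  case 0
  then show ?case using f j by simp
next
  case (Suc r)
  show ?case unfolding best_le_iff
  proof (intro allI impI)
    fix S assume S: "S \<subseteq> {1..n}"
    have "mean u S (\<lambda>i. best n u f r (add_choice i (add_choice j l)))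
        \<le> mean u S (\<lambda>i. best n u f r (add_choice i l) + 1)"
      using Suc.IH by (intro mean_mono[OF u S]) (simp_all add: add_choice_commute[of _ j])
    also have "\<dots> = mean u S (\<lambda>i. best n u f r (add_choice i l)) + 1"
      by (simp add: mean_add mean_const[OF u S])
    also have "\<dots> \<le> best n u f (Suc r) l + 1" using mean_le_best[OF S] by simp
    finally show "mean u S (\<lambda>i. best n u f r (add_choice i (add_choice j l)))
        \<le> best n u f (Suc r) l + 1" .
  qed
qed

text \<open>An offer achieving \<open>x\<close> can only improve when products with values at most \<open>x\<close> are removed and
  all products with values above \<open>x\<close> are added: the sign of the average minus \<open>x\<close> is the sign of a sum
  over the offer of weight times value minus \<open>x\<close>.\<close>
lemma mean_superlevel_ge:
  assumes u: "nonneg_weights n u" and S: "S \<subseteq> {1..n}" and x: "x \<le> mean u S h"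
  shows "x \<le> mean u {i\<in>{1..n}. x < h i} h"
proof -
  let ?R = "{i\<in>{1..n}. x < h i}"
  have R: "?R \<subseteq> {1..n}" by auto
  have fin: "finite S" using S finite_subset by blast
  have u0: "0 \<le> u i" if "i \<in> {1..n}" for i using u that by (auto simp: nonneg_weights_def)
  have "0 \<le> mean u S h - x" using x by simp
  then have "0 \<le> (h 0 - x) + (\<Sum>i\<in>S. u i * (h i - x))"
    using total_weight_nonneg[OF u S] by (simp add: mean_minus[OF u S] zero_le_divide_iff)
  also have "(\<Sum>i\<in>S. u i * (h i - x)) \<le> (\<Sum>i\<in>S \<inter> ?R. u i * (h i - x))"
  proof -
    have "(\<Sum>i\<in>S. u i * (h i - x))
        = (\<Sum>i\<in>S \<inter> ?R. u i * (h i - x)) + (\<Sum>i\<in>S - ?R. u i * (h i - x))"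
      using fin by (subst sum.union_disjoint[symmetric]) (auto intro!: sum.cong)
    moreover have "(\<Sum>i\<in>S - ?R. u i * (h i - x)) \<le> 0"
      using S u0 by (intro sum_nonpos mult_nonneg_nonpos) auto
    ultimately show ?thesis by simp
  qed
  also have "\<dots> \<le> (\<Sum>i\<in>?R. u i * (h i - x))"
    using u0 by (intro sum_mono2) auto
  finally have "0 \<le> (h 0 - x) + (\<Sum>i\<in>?R. u i * (h i - x))" by simp
  then have "0 \<le> mean u ?R h - x"
    unfolding mean_minus[OF u R] using total_weight_nonneg[OF u R]
    by (intro divide_nonneg_nonneg) linarith+
  then show ?thesis by simp
qed

lemma best_eq_superlevel:
  assumes u: "nonneg_weights n u"
  shows "best n u f (Suc r) l
    = mean u {i\<in>{1..n}. best n u f (Suc r) l < best n u f r (add_choice i l)}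
        (\<lambda>j. best n u f r (add_choice j l))"
proof (rule antisym)
  obtain S where S: "S \<subseteq> {1..n}"
    and *: "best n u f (Suc r) l = mean u S (\<lambda>j. best n u f r (add_choice j l))"
    using best_attained by blast
  show "best n u f (Suc r) l
    \<le> mean u {i\<in>{1..n}. best n u f (Suc r) l < best n u f r (add_choice i l)}
        (\<lambda>j. best n u f r (add_choice j l))"
    by (rule mean_superlevel_ge[OF u S]) (simp only: * order_refl)
qed (rule mean_le_best, auto)

section \<open>Removing a customer, and robustness\<close>

text \<open>A policy that pretends to own one more unit of product \<open>j\<close> loses at most the probability of the
  final states in which that unit counts, which is what \<open>D\<close> records.\<close>
lemma policy_value_without_one_purchase:
  assumes u: "nonneg_weights n u" and A: "A \<in> policies n"
    and D: "\<And>l. f (add_choice j l) \<le> f l + D (add_choice j l)"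
  shows "policy_value u A f r (add_choice j l)
    \<le> best n u f r l + policy_value u A D r (add_choice j l)"
proof (induction r arbitrary: l)
  case 0
  then show ?case using D by simp
next
  case (Suc r)
  let ?S = "A (Suc r) (add_choice j l)"
  have S: "?S \<subseteq> {1..n}" using A by (auto simp: policies_def)
  have "policy_value u A f (Suc r) (add_choice j l)
    \<le> mean u ?S (\<lambda>i. best n u f r (add_choice i l)
         + policy_value u A D r (add_choice i (add_choice j l)))"
    unfolding policy_value.simps using Suc.IH
    by (intro mean_mono[OF u S]) (simp_all add: add_choice_commute[of _ j])
  then show ?case using mean_le_best[OF S, of u f r l] by (simp add: mean_add)
qed

text \<open>Skip one of \<open>r\<close> customers, chosen uniformly, and continue as if the skipped customer had
  been served. With \<open>D i l\<close> the indicator that units of \<open>i\<close> count in the final state \<open>l\<close>, the loss is \<open>1 / r\<close>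
  times the expected number of counting units bought after the start. Moving the units already present at the
  start to the other side gives a statement that is linear in the load vector and hence passes through the
  average over the next choice; the induction step adds the two ways of skipping, namely the next customer
  or a later one.\<close>
theorem policy_value_skip_one_customer:
  assumes u: "nonneg_weights n u" and A: "A \<in> policies n"
    and D: "\<And>j l. j \<in> {1..n} \<Longrightarrow> f (add_choice j l) \<le> f l + D j (add_choice j l)"
    and f: "\<And>l. (\<Sum>i\<in>{1..n}. real (l i) * D i l) \<le> f l"
  shows "real r * policy_value u A f r l + (\<Sum>i\<in>{1..n}. real (l i) * policy_value u A (D i) r l)
    \<le> real r * best n u f (r - 1) l + policy_value u A f r l"
proof (induction r arbitrary: l)
  case 0
  then show ?case using f by simp
next
  case (Suc r)
  let ?S = "A (Suc r) l" and ?U = "policy_value u A f" and ?q = "\<lambda>i. policy_value u A (D i)"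
  let ?V = "best n u f"
  let ?c = "\<lambda>j. if j = 0 then 0 else ?q j r (add_choice j l)"
  have S: "?S \<subseteq> {1..n}" using A by (auto simp: policies_def)
  have Uq: "?U (Suc r) l = mean u ?S (\<lambda>j. ?U r (add_choice j l))"
    "?q i (Suc r) l = mean u ?S (\<lambda>j. ?q i r (add_choice j l))" for i
    by simp_all
  have sums: "(\<Sum>i\<in>{1..n}. real (add_choice j l i) * ?q i r (add_choice j l))
     = (\<Sum>i\<in>{1..n}. real (l i) * ?q i r (add_choice j l)) + ?c j" if "j = 0 \<or> j \<in> {1..n}" for j
  proof -
    have "(\<Sum>i\<in>{1..n}. real (add_choice j l i) * ?q i r (add_choice j l))
      = (\<Sum>i\<in>{1..n}. real (l i) * ?q i r (add_choice j l)
           + (if i = j then ?q i r (add_choice j l) else 0))"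
      by (intro sum.cong) (auto simp: add_choice_apply algebra_simps)
    also have "\<dots> = (\<Sum>i\<in>{1..n}. real (l i) * ?q i r (add_choice j l)) + ?c j"
      using that by (auto simp: sum.distrib)
    finally show ?thesis .
  qed
  have skip: "?U (Suc r) l \<le> ?V r l + mean u ?S ?c"
  proof -
    have "?U (Suc r) l \<le> mean u ?S (\<lambda>j. ?V r l + ?c j)"
      unfolding Uq
    proof (intro mean_mono[OF u S])
      show "?U r (add_choice 0 l) \<le> ?V r l + ?c 0"
        using policy_value_le_best[OF u A] by simp
    next
      fix i assume "i \<in> ?S"
      then have i: "i \<in> {1..n}" using S by auto
      show "?U r (add_choice i l) \<le> ?V r l + ?c i"
        using policy_value_without_one_purchase[where D = "D i", OF u A D[OF i]] i by simp
    qed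
    then show ?thesis by (simp add: mean_add mean_const[OF u S])
  qed
  have "real r * ?U (Suc r) l + (\<Sum>i\<in>{1..n}. real (l i) * ?q i (Suc r) l) + mean u ?S ?c
    = mean u ?S (\<lambda>j. real r * ?U r (add_choice j l)
        + (\<Sum>i\<in>{1..n}. real (l i) * ?q i r (add_choice j l)) + ?c j)"
    unfolding Uq by (simp only: mean_add mean_cmult mean_sum finite_atLeastAtMost)
  also have "\<dots> \<le> mean u ?S (\<lambda>j. real r * ?V (r - 1) (add_choice j l) + ?U r (add_choice j l))"
  proof (intro mean_mono[OF u S])
    show "real r * ?U r (add_choice i l) + (\<Sum>k\<in>{1..n}. real (l k) * ?q k r (add_choice i l)) + ?c i
       \<le> real r * ?V (r - 1) (add_choice i l) + ?U r (add_choice i l)" if "i \<in> ?S" for i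
    proof -
      have "i \<in> {1..n}" using that S by blast
      then show ?thesis using Suc.IH[of "add_choice i l"] sums[of i] by linarith
    qed
    show "real r * ?U r (add_choice 0 l) + (\<Sum>k\<in>{1..n}. real (l k) * ?q k r (add_choice 0 l)) + ?c 0
       \<le> real r * ?V (r - 1) (add_choice 0 l) + ?U r (add_choice 0 l)"
      using Suc.IH[of l] by simp
  qed
  also have "\<dots> = real r * mean u ?S (\<lambda>j. ?V (r - 1) (add_choice j l)) + ?U (Suc r) l"
    unfolding Uq by (simp only: mean_add mean_cmult)
  also have "\<dots> \<le> real r * ?V r l + ?U (Suc r) l"
  proof (cases r)
    case (Suc r')
    then show ?thesis using mean_le_best[OF S, of u f r' l] by (auto intro!: mult_left_mono simp del: best.simps)
  qed simp
  finally show ?case using skip by (simp add: algebra_simps del: best.simps)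
qed

lemma best_eq_policy_value:
  assumes u: "nonneg_weights n u"
  shows "\<exists>A\<in>policies n. \<forall>r l. policy_value u A f r l = best n u f r l"
proof -
  define A :: policy where "A r l = (case r of 0 \<Rightarrow> {} | Suc r' \<Rightarrow>
    {i\<in>{1..n}. best n u f r l < best n u f r' (add_choice i l)})" for r l
  have "A \<in> policies n" by (auto simp: policies_def A_def split: nat.splits)
  moreover have "policy_value u A f r l = best n u f r l" for r l
  proof (induction r arbitrary: l)
    case (Suc r)
    have "A (Suc r) l = {i\<in>{1..n}. best n u f (Suc r) l < best n u f r (add_choice i l)}"
      by (simp only: A_def nat.case)
    then show ?case unfolding policy_value.simps Suc
      using best_eq_superlevel[OF u, of f r l] by (simp only:)
  qed simp
  ultimately show ?thesis by blast
qed

text \<open>The marginal value of a customer is at most a \<open>1 / r\<close> fraction of the value. This is what turns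
  relative errors per step into a harmonic sum.\<close>
corollary best_increment_le:
  assumes u: "nonneg_weights n u"
    and D: "\<And>j l. j \<in> {1..n} \<Longrightarrow> f (add_choice j l) \<le> f l + D j (add_choice j l)"
    and f: "\<And>l. (\<Sum>i\<in>{1..n}. real (l i) * D i l) \<le> f l"
    and D0: "\<And>i l. 0 \<le> D i l"
  shows "real (Suc r) * (best n u f (Suc r) l - best n u f r l) \<le> best n u f (Suc r) l"
proof -
  obtain A where A: "A \<in> policies n" and eq: "\<And>r l. policy_value u A f r l = best n u f r l"
    using best_eq_policy_value[OF u] by metis
  have "0 \<le> policy_value u A (D i) (Suc r) l" for i
    using policy_value_mono[OF u A, of "\<lambda>_. 0" "D i"] D0 policy_value_const[OF u A, of 0] by metis
  then have "0 \<le> (\<Sum>i\<in>{1..n}. real (l i) * policy_value u A (D i) (Suc r) l)"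
    by (intro sum_nonneg) simp
  then show ?thesis
    using policy_value_skip_one_customer[where D = D and f = f and r = "Suc r" and l = l, OF u A D f]
    by (simp add: eq algebra_simps del: best.simps policy_value.simps)
qed

text \<open>The value of a policy each of whose steps realizes the
  gain of the potential \<open>V\<close> up to a factor \<open>1 - d\<close> and an additive error \<open>\<kappa>\<close>. The step \<open>r + 1\<close> loses
  \<open>d\<close> times the gain, that is, at most \<open>d / (r + 1)\<close> times the value.\<close>
theorem policy_value_robust:
  assumes u: "nonneg_weights n u" and A: "A \<in> policies n"
    and inc: "\<And>r l. real (Suc r) * (V (Suc r) l - V r l) \<le> V (Suc r) l"
    and mono: "\<And>r l. V r l \<le> V (Suc r) l"
    and step: "\<And>r l. (1 - d) * (V (Suc r) l - V r l) - \<kappa>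
        \<le> mean u (A (Suc r) l) (\<lambda>j. V r (add_choice j l)) - V r l"
    and d: "0 \<le> d" "d * harm T \<le> 1" and \<kappa>: "0 \<le> \<kappa>" and "r \<le> T"
  shows "(1 - d * harm r) * V r l - real r * \<kappa> \<le> policy_value u A (V 0) r l"
  using \<open>r \<le> T\<close>
proof (induction r arbitrary: l)
  case (Suc r)
  let ?S = "A (Suc r) l" and ?c = "1 - d * harm r"
  have S: "?S \<subseteq> {1..n}" using A by (auto simp: policies_def)
  have "d * harm r \<le> d * harm T" using Suc.prems d(1) by (intro mult_left_mono harm_mono) auto
  then have c: "0 \<le> ?c" "?c \<le> 1" 
    using d mult_nonneg_nonneg[OF d(1) harm_nonneg[of r]] by auto
  have inc': "V (Suc r) l - V r l \<le> V (Suc r) l / real (Suc r)"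
    using inc[of r l] by (simp add: field_simps)
  have "(1 - d * harm (Suc r)) * V (Suc r) l - real (Suc r) * \<kappa>
    = ?c * V (Suc r) l - d * (V (Suc r) l / real (Suc r)) - \<kappa> - real r * \<kappa>"
    by (simp add: harm_Suc field_simps)
  also have "\<dots> \<le> ?c * V (Suc r) l - d * (?c * (V (Suc r) l - V r l)) - ?c * \<kappa> - real r * \<kappa>"
  proof -
    have "?c * (V (Suc r) l - V r l) \<le> 1 * (V (Suc r) l - V r l)"
      using c mono[of r l] by (intro mult_right_mono) auto
    then have "d * (?c * (V (Suc r) l - V r l)) \<le> d * (V (Suc r) l / real (Suc r))"
      using inc' d(1) by (intro mult_left_mono) auto
    moreover have "?c * \<kappa> \<le> 1 * \<kappa>" using c \<kappa> by (intro mult_right_mono) auto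
    ultimately show ?thesis by simp
  qed
  also have "\<dots> = ?c * (V r l + ((1 - d) * (V (Suc r) l - V r l) - \<kappa>)) - real r * \<kappa>"
    by (simp add: algebra_simps)
  also have "\<dots> \<le> ?c * mean u ?S (\<lambda>j. V r (add_choice j l)) - real r * \<kappa>"
    using step[of r l] c by (intro diff_right_mono mult_left_mono) auto
  also have "\<dots> = mean u ?S (\<lambda>j. ?c * V r (add_choice j l) - real r * \<kappa>)"
    by (simp add: mean_diff mean_cmult mean_const[OF u S])
  also have "\<dots> \<le> policy_value u A (V 0) (Suc r) l"
    using Suc by (simp, intro mean_mono[OF u S]) auto
  finally show ?case .
qed (simp add: harm_def)

section \<open>Maximum loads and capped loads\<close>

abbreviation peak :: "nat \<Rightarrow> (nat \<Rightarrow> nat) \<Rightarrow> real" where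
  "peak n l \<equiv> real (max_load n l)"

lemma load_le_max_load: "i \<in> {1..n} \<Longrightarrow> l i \<le> max_load n l"
  unfolding max_load_def by (intro Max_ge) auto

lemma max_load_attained: "1 \<le> n \<Longrightarrow> \<exists>i\<in>{1..n}. l i = max_load n l"
proof -
  assume "1 \<le> n"
  then have "max_load n l \<in> l ` {1..n}" unfolding max_load_def by (intro Max_in) auto
  then show ?thesis by force
qed

definition winner :: "nat \<Rightarrow> (nat \<Rightarrow> nat) \<Rightarrow> nat" where
  "winner n l = (SOME i. i \<in> {1..n} \<and> l i = max_load n l)"

lemma winner:
  assumes "1 \<le> n"
  shows "winner n l \<in> {1..n}" and "l (winner n l) = max_load n l"
proof -
  have "\<exists>i. i \<in> {1..n} \<and> l i = max_load n l" using max_load_attained[OF assms, of l] by blast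
  then have "winner n l \<in> {1..n} \<and> l (winner n l) = max_load n l"
    unfolding winner_def by (rule someI_ex)
  then show "winner n l \<in> {1..n}" and "l (winner n l) = max_load n l" by blast+
qed

lemma max_load_le_iff: "1 \<le> n \<Longrightarrow> max_load n l \<le> c \<longleftrightarrow> (\<forall>i\<in>{1..n}. l i \<le> c)"
  unfolding max_load_def by (subst Max_le_iff) auto

lemma max_load_add_choice:
  assumes "1 \<le> n" "j \<in> {1..n}"
  shows "max_load n l \<le> max_load n (add_choice j l)"
    and "max_load n (add_choice j l) \<le> max_load n l + 1"
proof -
  show "max_load n l \<le> max_load n (add_choice j l)"
    unfolding max_load_le_iff[OF assms(1)]
  proof
    fix i assume "i \<in> {1..n}"
    then have "add_choice j l i \<le> max_load n (add_choice j l)" by (rule load_le_max_load)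
    moreover have "l i \<le> add_choice j l i" by (simp add: add_choice_def)
    ultimately show "l i \<le> max_load n (add_choice j l)" by simp
  qed
  show "max_load n (add_choice j l) \<le> max_load n l + 1"
    unfolding max_load_le_iff[OF assms(1)]
  proof
    fix i assume i: "i \<in> {1..n}"
    then have "add_choice j l i \<le> l i + 1" by (auto simp: add_choice_def)
    then show "add_choice j l i \<le> max_load n l + 1" using load_le_max_load[OF i, of l] by simp
  qed
qed

definition capped_load :: "nat \<Rightarrow> nat \<Rightarrow> (nat \<Rightarrow> nat) \<Rightarrow> real" where
  "capped_load L n l = real (min L (max_load n l))"

lemma capped_load_add_choice:
  assumes "1 \<le> n" "j \<in> {1..n}"
  shows "capped_load L n l \<le> capped_load L n (add_choice j l)"
    and "capped_load L n (add_choice j l) \<le> capped_load L n l + 1"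
  using max_load_add_choice[OF assms, of l] by (auto simp: capped_load_def)

text \<open>Every unit of the winner may count for the capped maximum unless the winner exceeds the cap; in
  that case the removal of a single unit leaves the capped maximum unchanged.\<close>
definition critical :: "nat \<Rightarrow> nat \<Rightarrow> nat \<Rightarrow> (nat \<Rightarrow> nat) \<Rightarrow> real" where
  "critical L n i l = (if i = winner n l \<and> l i \<le> L then 1 else 0)"

lemma capped_load_critical:
  assumes n: "1 \<le> n" and j: "j \<in> {1..n}"
  shows "capped_load L n (add_choice j l) \<le> capped_load L n l + critical L n j (add_choice j l)"
proof (cases "j = winner n (add_choice j l)")
  case True
  then have "add_choice j l j = max_load n (add_choice j l)" using winner(2)[OF n] by metis
  then have "l j + 1 = max_load n (add_choice j l)" using j by (simp add: add_choice_apply)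
  then show ?thesis
    using True capped_load_add_choice(2)[OF n j, of L l] load_le_max_load[OF j, of l] j
    by (auto simp: critical_def add_choice_apply capped_load_def)
next
  case False
  let ?w = "winner n (add_choice j l)"
  have w: "?w \<in> {1..n}" using winner(1)[OF n] .
  have "max_load n (add_choice j l) = add_choice j l ?w" using winner(2)[OF n] by simp
  also have "\<dots> = l ?w" using w False by (simp add: add_choice_apply)
  also have "\<dots> \<le> max_load n l" by (rule load_le_max_load[OF w])
  finally show ?thesis using False by (auto simp: capped_load_def critical_def)
qed

lemma sum_critical_le:
  assumes n: "1 \<le> n"
  shows "(\<Sum>i\<in>{1..n}. real (l i) * critical L n i l) \<le> capped_load L n l"
proof -
  have "(\<Sum>i\<in>{1..n}. real (l i) * critical L n i l)
      = (\<Sum>i\<in>{1..n}. if i = winner n l then real (l i) * critical L n i l else 0)"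
    by (intro sum.cong) (auto simp: critical_def)
  also have "\<dots> = real (l (winner n l)) * critical L n (winner n l) l"
    using winner(1)[OF n, of l] by simp
  also have "\<dots> \<le> capped_load L n l"
    using winner(2)[OF n, of l] by (simp add: critical_def capped_load_def)
  finally show ?thesis .
qed

lemma best_capped_load:
  assumes n: "1 \<le> n" and u: "nonneg_weights n u"
  shows "real (Suc r) * (best n u (capped_load L n) (Suc r) l - best n u (capped_load L n) r l)
           \<le> best n u (capped_load L n) (Suc r) l"
    and "j \<in> {1..n} \<Longrightarrow> best n u (capped_load L n) r l \<le> best n u (capped_load L n) r (add_choice j l)"
    and "j \<in> {1..n} \<Longrightarrow>
           best n u (capped_load L n) r (add_choice j l) \<le> best n u (capped_load L n) r l + 1"
  subgoal
    by (rule best_increment_le[where D = "critical L n", OF u capped_load_critical[OF n]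
          sum_critical_le[OF n]]) (auto simp: critical_def)
  subgoal by (rule best_add_choice_mono[OF u capped_load_add_choice(1)[OF n]])
  subgoal by (rule best_add_choice_le[OF u capped_load_add_choice(2)[OF n]])
  done

section \<open>Regimes with a fixed offer\<close>

lemma fixed_offer_value_mono:
  assumes u: "nonneg_weights n u" and N: "N \<subseteq> {1..n}"
    and f: "\<And>j l. j \<in> {1..n} \<Longrightarrow> f l \<le> f (add_choice j l)" and j: "j \<in> {1..n}"
  shows "policy_value u (\<lambda>_ _. N) f r l \<le> policy_value u (\<lambda>_ _. N) f r (add_choice j l)"
proof (induction r arbitrary: l)
  case 0
  then show ?case using f j by simp
next
  case (Suc r)
  show ?case unfolding policy_value.simps
    using Suc.IH by (intro mean_mono[OF u N]) (simp_all add: add_choice_commute[of _ j])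
qed

text \<open>A coupling argument in expectation form. Think of \<open>A\<close> as running on the load vector \<open>l\<close>, while
  \<open>x\<close> collects each of its purchases independently with probability \<open>1 - d\<close>. The product that wins for \<open>A\<close>
  keeps a fraction \<open>1 - d\<close> of its purchases on average, which is the left-hand side: \<open>x\<close> is evaluated at the
  winner of \<open>A\<close>, and only the units bought from now on are thinned. Offering
  everything buys at least as often as the thinned process.\<close>
theorem offer_everything:
  assumes n: "1 \<le> n" and u: "nonneg_weights n u" and A: "A \<in> policies n"
    and d: "0 \<le> d" "d \<le> 1" "(1 - d) * (1 + total_weight u {1..n}) \<le> 1"
  shows "(1 - d) * policy_value u A (peak n) r l
      + (\<Sum>i\<in>{1..n}. (real (x i) - (1 - d) * real (l i))
            * policy_value u A (\<lambda>l. if i = winner n l then 1 else 0) r l)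
    \<le> policy_value u (\<lambda>_ _. {1..n}) (peak n) r x"
proof (induction r arbitrary: l x)
  case 0
  have "(\<Sum>i\<in>{1..n}. (real (x i) - (1 - d) * real (l i)) * (if i = winner n l then 1 else 0))
    = (\<Sum>i\<in>{1..n}. if i = winner n l then real (x i) - (1 - d) * real (l i) else 0)"
    by (intro sum.cong) auto
  also have "\<dots> = real (x (winner n l)) - (1 - d) * real (max_load n l)"
    using winner[OF n, of l] by simp
  finally show ?case using load_le_max_load[OF winner(1)[OF n], of x l] by simp
next
  case (Suc r)
  let ?S = "A (Suc r) l" and ?N = "{1..n}"
  let ?f = "peak n"
  let ?U = "policy_value u A ?f"
  let ?q = "\<lambda>i. policy_value u A (\<lambda>l. if i = winner n l then 1 else 0)"
  let ?W = "policy_value u (\<lambda>_ _. ?N) ?f"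
  let ?h = "\<lambda>j. d * ?W r x + (1 - d) * ?W r (add_choice j x)"
  have S: "?S \<subseteq> {1..n}" using A by (auto simp: policies_def)
  have finS: "finite ?S" using S finite_subset by blast
  have Wmono: "?W r y \<le> ?W r (add_choice j y)" if "j \<in> {1..n}" for j y
    using max_load_add_choice(1)[OF n] that by (intro fixed_offer_value_mono[OF u]) auto
  have u0: "0 \<le> u i" if "i \<in> {1..n}" for i using u that by (auto simp: nonneg_weights_def)
  have tS: "0 \<le> total_weight u ?S" "0 \<le> total_weight u ?N"
    using total_weight_nonneg[OF u] S by auto
  \<comment> \<open>Everything on offer, every gain has at least \<open>1 - d\<close> times its probability under \<open>?S\<close>.\<close>
  have lower: "mean u ?S ?h \<le> ?W (Suc r) x"
  proof -
    have gain: "mean u ?S ?h = ?W r x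
        + (\<Sum>i\<in>?S. u i * ((1 - d) * (?W r (add_choice i x) - ?W r x))) / (1 + total_weight u ?S)"
      by (simp add: mean_gain[OF u S] algebra_simps)
    have "(\<Sum>i\<in>?S. u i * ((1 - d) * (?W r (add_choice i x) - ?W r x))) / (1 + total_weight u ?S)
      = (\<Sum>i\<in>?S. (1 - d) / (1 + total_weight u ?S) * (u i * (?W r (add_choice i x) - ?W r x)))"
      by (simp add: sum_divide_distrib mult_ac)
    also have "\<dots> \<le> (\<Sum>i\<in>?S. 1 / (1 + total_weight u ?N) * (u i * (?W r (add_choice i x) - ?W r x)))"
    proof (intro sum_mono mult_right_mono mult_nonneg_nonneg)
      have "(1 - d) / (1 + total_weight u ?S) \<le> (1 - d) / 1"
        using d tS by (intro divide_left_mono) auto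
      also have "\<dots> \<le> 1 / (1 + total_weight u ?N)"
        unfolding div_by_1 using d(3) tS(2) by (subst pos_le_divide_eq) linarith+
      finally show "(1 - d) / (1 + total_weight u ?S) \<le> 1 / (1 + total_weight u ?N)" .
      show "0 \<le> u i" "0 \<le> ?W r (add_choice i x) - ?W r x" if "i \<in> ?S" for i
        using that S u0 Wmono[of i x] by auto
    qed
    also have "\<dots> \<le> (\<Sum>i\<in>?N. 1 / (1 + total_weight u ?N) * (u i * (?W r (add_choice i x) - ?W r x)))"
    proof (rule sum_mono2[OF finite_atLeastAtMost S])
      fix i assume "i \<in> ?N - ?S"
      then have i: "i \<in> ?N" by blast
      show "0 \<le> 1 / (1 + total_weight u ?N) * (u i * (?W r (add_choice i x) - ?W r x))"
        using u0[OF i] Wmono[OF i, of x] tS(2) by (intro mult_nonneg_nonneg divide_nonneg_nonneg) linarith+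
    qed
    also have "\<dots> = ?W (Suc r) x - ?W r x"
      unfolding policy_value.simps mean_gain[OF u order_refl] add_choice_0
      by (simp add: sum_divide_distrib)
    finally show ?thesis using gain by linarith
  qed
  \<comment> \<open>A purchase of \<open>j\<close> by \<open>A\<close> is dropped with probability \<open>d\<close> and kept with probability \<open>1 - d\<close>; the expected
    gain of \<open>x j\<close> compensates for the growth of \<open>(1 - d) l j\<close>.\<close>
  have pt: "(1 - d) * ?U r (add_choice j l)
      + (\<Sum>i\<in>{1..n}. (real (x i) - (1 - d) * real (l i)) * ?q i r (add_choice j l)) \<le> ?h j"
    if j: "j = 0 \<or> j \<in> {1..n}" for j
  proof -
    let ?l = "add_choice j l"
    let ?c = "if j = 0 then 0 else ?q j r ?l"
    have 1: "(\<Sum>i\<in>{1..n}. (real (x i) - (1 - d) * real (?l i)) * ?q i r ?l)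
      = (\<Sum>i\<in>{1..n}. (real (x i) - (1 - d) * real (l i)) * ?q i r ?l) - (1 - d) * ?c"
    proof -
      have "(\<Sum>i\<in>{1..n}. (real (x i) - (1 - d) * real (?l i)) * ?q i r ?l)
        = (\<Sum>i\<in>{1..n}. (real (x i) - (1 - d) * real (l i)) * ?q i r ?l
              - (if i = j then (1 - d) * ?q i r ?l else 0))"
        by (intro sum.cong) (auto simp: add_choice_apply algebra_simps)
      then show ?thesis using j by (auto simp: sum_subtractf)
    qed
    have 2: "(\<Sum>i\<in>{1..n}. (real (add_choice j x i) - (1 - d) * real (?l i)) * ?q i r ?l)
      = (\<Sum>i\<in>{1..n}. (real (x i) - (1 - d) * real (?l i)) * ?q i r ?l) + ?c"
    proof -
      have "(\<Sum>i\<in>{1..n}. (real (add_choice j x i) - (1 - d) * real (?l i)) * ?q i r ?l)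
        = (\<Sum>i\<in>{1..n}. (real (x i) - (1 - d) * real (?l i)) * ?q i r ?l
              + (if i = j then ?q i r ?l else 0))"
        by (intro sum.cong) (auto simp: add_choice_apply algebra_simps)
      then show ?thesis using j by (auto simp: sum.distrib)
    qed
    let ?X = "(1 - d) * ?U r ?l + (\<Sum>i\<in>{1..n}. (real (x i) - (1 - d) * real (l i)) * ?q i r ?l)"
    have "?X - (1 - d) * ?c \<le> ?W r x" using Suc.IH[of ?l x] 1 by linarith
    then have a: "d * (?X - (1 - d) * ?c) \<le> d * ?W r x" using d(1) by (rule mult_left_mono)
    have "?X - (1 - d) * ?c + ?c \<le> ?W r (add_choice j x)"
      using Suc.IH[of ?l "add_choice j x"] 1 2 by linarith
    then have b: "(1 - d) * (?X - (1 - d) * ?c + ?c) \<le> (1 - d) * ?W r (add_choice j x)"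
      using d(2) by (intro mult_left_mono) linarith+
    have "X = d * (X - (1 - d) * c) + (1 - d) * (X - (1 - d) * c + c)" for X c :: real
      by (simp add: algebra_simps)
    from this[of ?X ?c] show ?thesis using a b by linarith
  qed
  have "(1 - d) * ?U (Suc r) l
      + (\<Sum>i\<in>{1..n}. (real (x i) - (1 - d) * real (l i)) * ?q i (Suc r) l)
    = mean u ?S (\<lambda>j. (1 - d) * ?U r (add_choice j l)
      + (\<Sum>i\<in>{1..n}. (real (x i) - (1 - d) * real (l i)) * ?q i r (add_choice j l)))"
    unfolding policy_value.simps by (simp only: mean_add mean_cmult mean_sum finite_atLeastAtMost)
  also have "\<dots> \<le> mean u ?S ?h"
    using pt[OF disjI1[OF refl]] pt[OF disjI2[OF subsetD[OF S]]] by (rule mean_mono[OF u S])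
  finally show ?case using lower by linarith
qed

text \<open>Instead of Jensen's inequality, the tangent of the logarithm at the upper bound \<open>K\<close> of
  the exponential moment is used: \<open>ln y \<le> y / K - 1 + ln K\<close>.\<close>
lemma policy_value_le_ln:
  assumes n: "1 \<le> n" and u: "nonneg_weights n u" and A: "A \<in> policies n"
    and w: "\<And>i. i \<in> {1..n} \<Longrightarrow> u i \<le> w" "0 \<le> w" and a: "0 < a"
  shows "policy_value u A (peak n) T (\<lambda>_. 0) * ln (1 + a)
    \<le> ln (real n) + a * (real T * (w / (1 + w)))"
proof -
  let ?p = "w / (1 + w)" and ?z = "\<lambda>_::nat. 0::nat"
  define K where "K = real n * exp (a * (real T * ?p))"
  have K: "K > 0" using n by (simp add: K_def)
  have p0: "0 \<le> ?p" using w by auto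
  have pt: "ln (1 + a) * real (max_load n l) + 0 * 1 \<le> (1 / K) * exp_sum (1 + a) n l + (ln K - 1) * 1" for l
  proof -
    have "(1 + a) ^ l (winner n l) \<le> exp_sum (1 + a) n l"
      unfolding exp_sum_def using winner(1)[OF n, of l] a by (intro member_le_sum) auto
    then have e: "(1 + a) ^ max_load n l \<le> exp_sum (1 + a) n l" using winner(2)[OF n, of l] by simp
    have pos: "0 < (1 + a) ^ max_load n l" using a by simp
    have "ln ((1 + a) ^ max_load n l / K) \<le> (1 + a) ^ max_load n l / K - 1"
      using pos K by (intro ln_le_minus_one) auto
    then have "real (max_load n l) * ln (1 + a) \<le> (1 + a) ^ max_load n l / K + (ln K - 1)"
      using pos K a by (simp add: ln_div ln_realpow)
    also have "(1 + a) ^ max_load n l / K \<le> exp_sum (1 + a) n l / K"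
      using e K by (intro divide_right_mono) auto
    finally show ?thesis by (simp add: mult.commute)
  qed
  have "ln (1 + a) * policy_value u A (peak n) T ?z + 0 * policy_value u A (\<lambda>_. 1) T ?z
    \<le> (1 / K) * policy_value u A (exp_sum (1 + a) n) T ?z + (ln K - 1) * policy_value u A (\<lambda>_. 1) T ?z"
    unfolding policy_value_linear[symmetric] by (rule policy_value_mono[OF u A pt])
  also have "\<dots> = (1 / K) * policy_value u A (exp_sum (1 + a) n) T ?z + (ln K - 1)"
    by (simp add: policy_value_const[OF u A])
  also have "(1 / K) * policy_value u A (exp_sum (1 + a) n) T ?z \<le> (1 / K) * K"
  proof (rule mult_left_mono)
    have "policy_value u A (exp_sum (1 + a) n) T ?z
      \<le> (1 + (1 + a - 1) * ?p) ^ T * exp_sum (1 + a) n ?z"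
      using a w by (intro policy_value_exp_sum[OF u A]) auto
    also have "\<dots> = (1 + a * ?p) ^ T * real n" by (simp add: exp_sum_def)
    also have "\<dots> \<le> exp (a * ?p) ^ T * real n"
      using a p0 by (intro mult_right_mono power_mono exp_ge_add_one_self add_nonneg_nonneg mult_nonneg_nonneg) auto
    also have "\<dots> = K" by (simp add: K_def exp_of_nat_mult[symmetric] mult_ac)
    finally show "policy_value u A (exp_sum (1 + a) n) T ?z \<le> K" .
  qed (use K in auto)
  also have "(1 / K) * K + (ln K - 1) = ln K" using K by simp
  also have "ln K = ln (real n) + a * (real T * ?p)" using n by (simp add: K_def ln_mult)
  finally show ?thesis by (simp add: mult.commute)
qed

lemma policy_value_single:
  assumes n: "1 \<le> n" and u: "nonneg_weights n u" and h: "h \<in> {1..n}"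
  shows "real r * (u h / (1 + u h))
    \<le> policy_value u (\<lambda>_ _. {h}) (peak n) r (\<lambda>_. 0)"
proof -
  have A: "(\<lambda>_ _. {h}) \<in> policies n" using h by (auto simp: policies_def)
  have "policy_value u (\<lambda>_ _. {h}) (\<lambda>l. real (l h)) r l = real (l h) + real r * (u h / (1 + u h))" for l
  proof (induction r arbitrary: l)
    case (Suc r)
    have "0 \<le> u h" using u h by (auto simp: nonneg_weights_def)
    moreover have "(a + u h * (b + a)) / (1 + u h) = a + b * (u h / (1 + u h))" if "0 \<le> u h" for a b
      using that by (simp add: field_simps)
    ultimately show ?case using h
      by (simp add: Suc mean_gain[OF u] add_choice_apply total_weight_def)
        (simp add: add_divide_distrib distrib_right)
  qed simp
  from this[of "\<lambda>_. 0"] show ?thesis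
    using policy_value_mono[OF u A, of "\<lambda>l. real (l h)" "peak n" r "\<lambda>_. 0"]
      load_le_max_load[OF h] by simp
qed

text \<open>With \<open>ln (1 + a) \<ge> a / (1 + a)\<close> the exponential bound becomes \<open>(1 + a)\<^sup>2 T p\<close> once \<open>ln n \<le> a\<^sup>2 T p\<close>, and
  \<open>(1 - 2 a) (1 + a)\<^sup>2 \<le> 1\<close>.\<close>
theorem offer_heaviest:
  assumes n: "1 \<le> n" and u: "nonneg_weights n u" and A: "A \<in> policies n"
    and h: "h \<in> {1..n}" "\<And>i. i \<in> {1..n} \<Longrightarrow> u i \<le> u h"
    and a: "0 < a" and T: "ln (real n) \<le> a ^ 2 * (real T * (u h / (1 + u h)))"
  shows "(1 - 2 * a) * policy_value u A (peak n) T (\<lambda>_. 0)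
    \<le> policy_value u (\<lambda>_ _. {h}) (peak n) T (\<lambda>_. 0)"
proof -
  let ?p = "real T * (u h / (1 + u h))"
  let ?U = "policy_value u A (peak n) T (\<lambda>_. 0)"
  have uh: "0 \<le> u h" using u h by (auto simp: nonneg_weights_def)
  have U0: "0 \<le> ?U"
    using policy_value_mono[OF u A, of "\<lambda>_. 0" "peak n" T "\<lambda>_. 0"]
    by (simp add: policy_value_const[OF u A])
  have "a / (1 + a) \<le> ln (1 + a)"
  proof -
    have "ln (1 / (1 + a)) \<le> 1 / (1 + a) - 1" using a by (intro ln_le_minus_one) auto
    then show ?thesis using a by (simp add: ln_div field_simps)
  qed
  then have "?U * (a / (1 + a)) \<le> ?U * ln (1 + a)" using U0 by (rule mult_left_mono)
  also have "\<dots> \<le> ln (real n) + a * ?p"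
    using policy_value_le_ln[OF n u A h(2) uh a] .
  also have "\<dots> \<le> a * ((1 + a) * ?p)" 
  proof -
    have "a * ((1 + a) * ?p) = a * ?p + a\<^sup>2 * ?p"
      by (simp only: power2_eq_square distrib_left distrib_right mult_1 mult_ac)
    then show ?thesis using T by linarith
  qed
  finally have "?U / (1 + a) * a \<le> ((1 + a) * ?p) * a" by (simp add: mult_ac)
  then have "?U / (1 + a) \<le> (1 + a) * ?p" using a by (rule mult_right_le_imp_le)
  then have U: "?U \<le> (1 + a)\<^sup>2 * ?p" using a by (simp add: field_simps power2_eq_square)
  have "(1 - 2 * a) * ?U \<le> ?p"
  proof (cases "1 - 2 * a \<le> 0")
    case True
    then have "(1 - 2 * a) * ?U \<le> 0" using U0 by (simp add: mult_nonpos_nonneg)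
    also have "0 \<le> ?p" using uh by simp
    finally show ?thesis .
  next
    case False
    then have "(1 - 2 * a) * ?U \<le> (1 - 2 * a) * ((1 + a)\<^sup>2 * ?p)" using U by (intro mult_left_mono) auto
    also have "\<dots> = ((1 - 2 * a) * (1 + a)\<^sup>2) * ?p" by simp
    also have "\<dots> \<le> 1 * ?p"
    proof (rule mult_right_mono)
      have "(1 - 2 * a) * (1 + a)\<^sup>2 = 1 - a\<^sup>2 * (3 + 2 * a)"
        by (simp add: power2_eq_square algebra_simps)
      also have "\<dots> \<le> 1" using a by simp
      finally show "(1 - 2 * a) * (1 + a)\<^sup>2 \<le> 1" .
    qed (use uh in simp)
    finally show ?thesis by simp
  qed
  then show ?thesis using policy_value_single[OF n u h(1), of T] by linarith
qed

lemma policy_value_le_horizon: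
  assumes n: "1 \<le> n" and u: "nonneg_weights n u" and A: "A \<in> policies n"
  shows "policy_value u A (peak n) r l \<le> real (max_load n l) + real r"
proof (induction r arbitrary: l)
  case (Suc r)
  have S: "A (Suc r) l \<subseteq> {1..n}" using A by (auto simp: policies_def)
  have "policy_value u A (peak n) (Suc r) l
    \<le> mean u (A (Suc r) l) (\<lambda>_. real (max_load n l) + real (Suc r))"
    unfolding policy_value.simps
  proof (rule mean_mono[OF u S])
    show "policy_value u A (peak n) r (add_choice 0 l)
        \<le> real (max_load n l) + real (Suc r)" using Suc.IH[of l] by simp
    show "policy_value u A (peak n) r (add_choice i l)
        \<le> real (max_load n l) + real (Suc r)" if "i \<in> A (Suc r) l" for i
      using Suc.IH[of "add_choice i l"] max_load_add_choice(2)[OF n, of i l] that S by fastforce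
  qed
  then show ?case by (simp add: mean_const[OF u S])
qed simp

section \<open>Capping loads and rounding weights\<close>

lemma max_load_le_capped:
  assumes n: "1 \<le> n"
  shows "real (max_load n l) \<le> capped_load L n l + exp_sum 2 n l / 2 ^ L"
proof (cases "max_load n l \<le> L")
  case True
  then show ?thesis by (simp add: capped_load_def exp_sum_def sum_nonneg)
next
  case False
  have "(2::real) ^ l (winner n l) \<le> exp_sum 2 n l"
    unfolding exp_sum_def using winner(1)[OF n, of l] by (intro member_le_sum) auto
  then have e: "(2::real) ^ max_load n l / 2 ^ L \<le> exp_sum 2 n l / 2 ^ L"
    using winner(2)[OF n, of l] by (intro divide_right_mono) auto
  have "real (max_load n l - L) \<le> 2 ^ (max_load n l - L)"
    by (metis less_exp less_imp_le of_nat_le_iff of_nat_numeral of_nat_power)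
  also have "\<dots> = 2 ^ max_load n l / 2 ^ L" using False by (simp add: power_diff)
  finally show ?thesis using e False by (simp add: capped_load_def)
qed

lemma best_max_load_le_capped:
  assumes n: "1 \<le> n" and u: "nonneg_weights n u"
    and w: "\<And>i. i \<in> {1..n} \<Longrightarrow> u i \<le> w" "0 \<le> w"
  shows "best n u (peak n) T (\<lambda>_. 0)
    \<le> best n u (capped_load L n) T (\<lambda>_. 0) + (1 + w / (1 + w)) ^ T * real n / 2 ^ L"
proof -
  let ?z = "\<lambda>_::nat. 0::nat"
  obtain A where A: "A \<in> policies n"
    and eq: "policy_value u A (peak n) T ?z = best n u (peak n) T ?z"
    using best_eq_policy_value[OF u] by metis
  have "policy_value u A (peak n) T ?z
    \<le> policy_value u A (\<lambda>l. 1 * capped_load L n l + (1 / 2 ^ L) * exp_sum 2 n l) T ?z"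
    using max_load_le_capped[OF n, of _ L] by (intro policy_value_mono[OF u A]) simp
  also have "\<dots> = policy_value u A (capped_load L n) T ?z
      + policy_value u A (exp_sum 2 n) T ?z / 2 ^ L"
    unfolding policy_value_linear by simp
  also have "\<dots> \<le> best n u (capped_load L n) T ?z
      + ((1 + (2 - 1) * (w / (1 + w))) ^ T * exp_sum 2 n ?z) / 2 ^ L"
    using w by (intro add_mono divide_right_mono policy_value_le_best[OF u A]
        policy_value_exp_sum[OF u A]) auto
  finally show ?thesis by (simp add: eq exp_sum_def)
qed

text \<open>The optimal policy for \<open>u\<close> is run with the smaller weights \<open>u'\<close>. Smaller denominators only help,
  the gains lie between 0 and 1, and thus a step loses a fraction \<open>d\<close> of its gain and at most \<open>\<eta>\<close> for
  each offered product.\<close>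
lemma best_weights_decrease:
  assumes n: "1 \<le> n" and u: "nonneg_weights n u" and u': "nonneg_weights n u'"
    and le: "\<And>i. i \<in> {1..n} \<Longrightarrow> u' i \<le> u i"
    and ge: "\<And>i. i \<in> {1..n} \<Longrightarrow> (1 - d) * u i - \<eta> \<le> u' i"
    and d: "0 \<le> d" "d * harm T \<le> 1" and \<eta>: "0 \<le> \<eta>"
  shows "(1 - d * harm T) * best n u (capped_load L n) T l - real T * (real n * \<eta>)
    \<le> best n u' (capped_load L n) T l"
proof -
  let ?V = "best n u (capped_load L n)"
  obtain Sf where Sf: "\<And>r l. Sf r l \<subseteq> {1..n}"
    "\<And>r l. ?V (Suc r) l = mean u (Sf r l) (\<lambda>j. ?V r (add_choice j l))"
    using best_attained[of n u "capped_load L n"] by metis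
  define A :: policy where "A r l = Sf (r - 1) l" for r l
  have A: "A \<in> policies n" using Sf(1) by (simp add: A_def policies_def)
  have step: "(1 - d) * (?V (Suc r) l - ?V r l) - real n * \<eta>
      \<le> mean u' (A (Suc r) l) (\<lambda>j. ?V r (add_choice j l)) - ?V r l" for r l
  proof -
    let ?S = "Sf r l" and ?g = "\<lambda>i. ?V r (add_choice i l) - ?V r l"
    have S: "?S \<subseteq> {1..n}" by (rule Sf(1))
    have finS: "finite ?S" using S finite_subset by blast
    have g: "0 \<le> ?g i" "?g i \<le> 1" if "i \<in> ?S" for i
      using best_capped_load(2,3)[OF n u, of i L r l] that S by auto
    have t: "0 \<le> total_weight u' ?S" "0 \<le> total_weight u ?S"
      using total_weight_nonneg[OF u' S] total_weight_nonneg[OF u S] .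
    have tle: "total_weight u' ?S \<le> total_weight u ?S"
      unfolding total_weight_def using le S by (intro sum_mono) auto
    let ?t = "1 + total_weight u ?S"
    have "(1 - d) * (\<Sum>i\<in>?S. u i * ?g i) - real n * \<eta> \<le> (\<Sum>i\<in>?S. u' i * ?g i)"
    proof -
      have "(1 - d) * (\<Sum>i\<in>?S. u i * ?g i) - (\<Sum>i\<in>?S. u' i * ?g i)
          = (\<Sum>i\<in>?S. ((1 - d) * u i - u' i) * ?g i)"
        by (simp add: sum_distrib_left sum_subtractf[symmetric] algebra_simps)
      also have "\<dots> \<le> (\<Sum>i\<in>?S. \<eta>)"
      proof (rule sum_mono)
        fix i assume i: "i \<in> ?S"
        have "((1 - d) * u i - u' i) * ?g i \<le> \<eta> * ?g i"
          using ge[of i] g[OF i] i S by (intro mult_right_mono) auto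
        also have "\<dots> \<le> \<eta> * 1" using g[OF i] \<eta> by (intro mult_left_mono)
        finally show "((1 - d) * u i - u' i) * ?g i \<le> \<eta>" by simp
      qed
      also have "\<dots> = real (card ?S) * \<eta>" by simp
      also have "\<dots> \<le> real n * \<eta>"
        using card_mono[OF _ S] \<eta> by (intro mult_right_mono) auto
      finally show ?thesis by simp
    qed
    then have "((1 - d) * (\<Sum>i\<in>?S. u i * ?g i) - real n * \<eta>) / ?t \<le> (\<Sum>i\<in>?S. u' i * ?g i) / ?t"
      using t by (intro divide_right_mono) auto
    also have "\<dots> \<le> (\<Sum>i\<in>?S. u' i * ?g i) / (1 + total_weight u' ?S)"
      using tle t g u' S
      by (intro divide_left_mono sum_nonneg mult_nonneg_nonneg) (auto simp: nonneg_weights_def)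
    finally have 1: "((1 - d) * (\<Sum>i\<in>?S. u i * ?g i) - real n * \<eta>) / ?t
      \<le> (\<Sum>i\<in>?S. u' i * ?g i) / (1 + total_weight u' ?S)" .
    have "real n * \<eta> / ?t \<le> real n * \<eta> / 1"
      using t \<eta> by (intro divide_left_mono) auto
    then have 2: "(1 - d) * ((\<Sum>i\<in>?S. u i * ?g i) / ?t) - real n * \<eta>
      \<le> ((1 - d) * (\<Sum>i\<in>?S. u i * ?g i) - real n * \<eta>) / ?t"
      by (simp add: diff_divide_distrib)
    have 3: "?V (Suc r) l - ?V r l = (\<Sum>i\<in>?S. u i * ?g i) / ?t"
      unfolding Sf(2) mean_gain[OF u S] by simp
    have 4: "mean u' ?S (\<lambda>j. ?V r (add_choice j l)) - ?V r l
       = (\<Sum>i\<in>?S. u' i * ?g i) / (1 + total_weight u' ?S)"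
      unfolding mean_gain[OF u' S] by simp
    show ?thesis using 1 2 3 4 by (simp add: A_def del: best.simps)
  qed
  have "(1 - d * harm T) * ?V T l - real T * (real n * \<eta>) \<le> policy_value u' A (?V 0) T l"
    using best_capped_load(1)[OF n u, of _ L] step d \<eta>
    by (intro policy_value_robust[OF u' A, where V = ?V and d = d]) (auto intro: best_Suc_mono simp del: best.simps)
  also have "?V 0 = capped_load L n" by (rule ext) simp
  also have "policy_value u' A (capped_load L n) T l \<le> best n u' (capped_load L n) T l"
    by (rule policy_value_le_best[OF u' A])
  finally show ?thesis .
qed

text \<open>The optimal policy for \<open>u\<close>, with products of weight 0 removed from the offers: for \<open>u\<close> they make
  no difference, but they would when the policy is run with positive weights.\<close>
definition greedy_policy :: "nat \<Rightarrow> (nat \<Rightarrow> real) \<Rightarrow> ((nat \<Rightarrow> nat) \<Rightarrow> real) \<Rightarrow> policy" where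
  "greedy_policy n u f r l =
     {i \<in> {1..n}. 0 < u i \<and> best n u f r l < best n u f (r - 1) (add_choice i l)}"

lemma greedy_policy_in_policies: "greedy_policy n u f \<in> policies n"
  by (auto simp: policies_def greedy_policy_def)

lemma mean_greedy_policy:
  assumes u: "nonneg_weights n u"
  shows "mean u (greedy_policy n u f (Suc r) l) (\<lambda>j. best n u f r (add_choice j l)) = best n u f (Suc r) l"
proof -
  let ?R = "{i\<in>{1..n}. best n u f (Suc r) l < best n u f r (add_choice i l)}"
  let ?G = "greedy_policy n u f (Suc r) l"
  have "(\<Sum>i\<in>?R. u i * h i) = (\<Sum>i\<in>?G. u i * h i)" for h
    using u by (intro sum.mono_neutral_right)
      (auto simp: greedy_policy_def nonneg_weights_def order.strict_iff_order simp del: best.simps)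
  from this this[of "\<lambda>_. 1"] show ?thesis
    using best_eq_superlevel[OF u, of f r l] by (simp add: mean_def total_weight_def del: best.simps)
qed

text \<open>Conversely, the policy computed from the smaller weights \<open>u'\<close> is run with \<open>u\<close>. On the offered products the
  weights grow by a factor at most \<open>1 + d\<close>, and so do the denominators.\<close>
lemma greedy_policy_weights_increase:
  assumes n: "1 \<le> n" and u: "nonneg_weights n u" and u': "nonneg_weights n u'"
    and le: "\<And>i. i \<in> {1..n} \<Longrightarrow> u' i \<le> u i"
    and ge: "\<And>i. i \<in> {1..n} \<Longrightarrow> 0 < u' i \<Longrightarrow> u i \<le> (1 + d) * u' i"
    and d: "0 \<le> d" "d * harm T \<le> 1"
  shows "(1 - d * harm T) * best n u' (capped_load L n) T l
    \<le> policy_value u (greedy_policy n u' (capped_load L n)) (capped_load L n) T l"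
proof -
  let ?V = "best n u' (capped_load L n)" and ?A = "greedy_policy n u' (capped_load L n)"
  have step: "(1 - d) * (?V (Suc r) l - ?V r l) - 0
      \<le> mean u (?A (Suc r) l) (\<lambda>j. ?V r (add_choice j l)) - ?V r l" for r l
  proof -
    let ?S = "?A (Suc r) l" and ?g = "\<lambda>i. ?V r (add_choice i l) - ?V r l"
    have S: "?S \<subseteq> {1..n}" and pos: "\<And>i. i \<in> ?S \<Longrightarrow> 0 < u' i" by (auto simp: greedy_policy_def)
    have g: "0 \<le> ?g i" if "i \<in> ?S" for i
      using best_capped_load(2)[OF n u', of i L r l] that S by auto
    have t: "0 \<le> total_weight u' ?S" "0 \<le> total_weight u ?S"
      using total_weight_nonneg[OF u' S] total_weight_nonneg[OF u S] .
    have "total_weight u ?S \<le> (1 + d) * total_weight u' ?S"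
      unfolding total_weight_def sum_distrib_left using ge pos S by (intro sum_mono) auto
    then have t2: "1 + total_weight u ?S \<le> (1 + d) * (1 + total_weight u' ?S)"
      using d by (simp add: distrib_left)
    have G0: "0 \<le> (\<Sum>i\<in>?S. u' i * ?g i)"
      using g pos by (intro sum_nonneg mult_nonneg_nonneg) (auto intro: less_imp_le)
    have "(1 - d) * ((\<Sum>i\<in>?S. u' i * ?g i) / (1 + total_weight u' ?S))
      \<le> (1 / (1 + d)) * ((\<Sum>i\<in>?S. u' i * ?g i) / (1 + total_weight u' ?S))"
    proof (rule mult_right_mono)
      show "1 - d \<le> 1 / (1 + d)" using d(1) by (simp add: field_simps)
      show "0 \<le> (\<Sum>i\<in>?S. u' i * ?g i) / (1 + total_weight u' ?S)" using G0 t by simp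
    qed
    also have "\<dots> = (\<Sum>i\<in>?S. u' i * ?g i) / ((1 + d) * (1 + total_weight u' ?S))" by simp
    also have "\<dots> \<le> (\<Sum>i\<in>?S. u' i * ?g i) / (1 + total_weight u ?S)"
      using t2 t G0 d(1) by (intro divide_left_mono mult_pos_pos) auto
    also have "\<dots> \<le> (\<Sum>i\<in>?S. u i * ?g i) / (1 + total_weight u ?S)"
      using le g S t by (intro divide_right_mono sum_mono mult_right_mono) auto
    finally have 1: "(1 - d) * ((\<Sum>i\<in>?S. u' i * ?g i) / (1 + total_weight u' ?S))
      \<le> (\<Sum>i\<in>?S. u i * ?g i) / (1 + total_weight u ?S)" .
    have 3: "?V (Suc r) l - ?V r l = (\<Sum>i\<in>?S. u' i * ?g i) / (1 + total_weight u' ?S)"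
      unfolding mean_greedy_policy[OF u', symmetric] mean_gain[OF u' S] by simp
    have 4: "mean u ?S (\<lambda>j. ?V r (add_choice j l)) - ?V r l
       = (\<Sum>i\<in>?S. u i * ?g i) / (1 + total_weight u ?S)"
      unfolding mean_gain[OF u S] by simp
    show ?thesis using 1 unfolding 3 4 by simp
  qed
  have "(1 - d * harm T) * ?V T l - real T * 0 \<le> policy_value u ?A (?V 0) T l"
    using best_capped_load(1)[OF n u', of _ L] step d
    by (intro policy_value_robust[OF u greedy_policy_in_policies, where V = ?V and d = d])
      (auto intro: best_Suc_mono simp del: best.simps)
  also have "?V 0 = capped_load L n" by (rule ext) simp
  finally show ?thesis by simp
qed

text \<open>With \<open>c = 1 - 1 / m\<close> and \<open>e = 1 / (4 m\<^sup>2)\<close>, the passage to capped loads costs \<open>e\<close>, the passage to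
  rounded weights a factor \<open>c\<close> and another \<open>e\<close>, and the way back a factor \<open>c\<close>. The optimum is at least the
  probability of a sale to one customer who is offered everything, hence at least \<open>1 / (2 m)\<close>,
  so both additive losses together are at most a fraction \<open>1 / m\<close> of it.\<close>
theorem rounded_greedy_policy:
  assumes n: "1 \<le> n" and T: "1 \<le> T" and m: "2 \<le> m" and u: "nonneg_weights n u" and u': "nonneg_weights n u'"
    and w: "\<And>i. i \<in> {1..n} \<Longrightarrow> u i \<le> w" "0 \<le> w"
    and tot: "1 < real m * total_weight u {1..n}"
    and le: "\<And>i. i \<in> {1..n} \<Longrightarrow> u' i \<le> u i"
    and ge: "\<And>i. i \<in> {1..n} \<Longrightarrow> if 0 < u' i then u i \<le> (1 + d) * u' i else u i \<le> \<eta>"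
    and d: "0 \<le> d" "d * harm T \<le> 1 / real m" and \<eta>: "0 \<le> \<eta>" "\<eta> * (4 * real m ^ 2 * real n * real T) \<le> 1"
    and L: "(1 + w / (1 + w)) ^ T * real n * (4 * real m ^ 2) \<le> 2 ^ L"
  shows "(1 - 3 / real m) * best n u (peak n) T (\<lambda>_. 0)
    \<le> policy_value u (greedy_policy n u' (capped_load L n)) (peak n) T (\<lambda>_. 0)"
proof -
  let ?z = "\<lambda>_::nat. 0::nat" and ?A = "greedy_policy n u' (capped_load L n)"
  let ?O = "best n u (peak n) T ?z"
  let ?V = "best n u (capped_load L n) T ?z" and ?W = "best n u' (capped_load L n) T ?z"
  define c where "c = 1 - 1 / real m"
  define e where "e = 1 / (4 * real m ^ 2)"
  have mr: "2 \<le> real m" using m by simp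
  have c: "0 \<le> c" "c \<le> 1" using mr by (auto simp: c_def field_simps)
  have e0: "0 \<le> e" by (simp add: e_def)
  have cd: "c \<le> 1 - d * harm T" using d by (simp add: c_def)
  have dh: "d * harm T \<le> 1" using cd c by linarith
  have d1: "d \<le> 1"
  proof -
    have "(1::real) = harm 1" by (simp add: harm_def)
    also have "\<dots> \<le> harm T" using T by (rule harm_mono)
    finally have "d * 1 \<le> d * harm T" using d(1) by (rule mult_left_mono)
    then show ?thesis using dh by simp
  qed
  have V0: "0 \<le> best n x (capped_load L n) T ?z" if "nonneg_weights n x" for x
  proof -
    have 0: "(\<lambda>_ _. {}) \<in> policies n" by (simp add: policies_def)
    have "0 \<le> policy_value x (\<lambda>_ _. {}) (capped_load L n) T ?z"
      using policy_value_mono[OF that 0, of "\<lambda>_. 0" "capped_load L n" T ?z]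
      by (simp add: policy_value_const[OF that 0] capped_load_def)
    then show ?thesis using policy_value_le_best[OF that 0, of "capped_load L n" T ?z] by linarith
  qed
  have OV: "?O \<le> ?V + e"
  proof -
    have "?O \<le> ?V + (1 + w / (1 + w)) ^ T * real n / 2 ^ L"
      by (rule best_max_load_le_capped[OF n u w])
    also have "(1 + w / (1 + w)) ^ T * real n / 2 ^ L \<le> e"
      using L mr by (simp add: e_def field_simps)
    finally show ?thesis by simp
  qed
  have VW: "c * ?V - e \<le> ?W"
  proof -
    have "c * ?V - e \<le> (1 - d * harm T) * ?V - real T * (real n * \<eta>)"
    proof (intro diff_mono mult_right_mono cd V0[OF u])
      show "real T * (real n * \<eta>) \<le> e" using \<eta>(2) mr by (simp add: e_def field_simps)
    qed
    also have "\<dots> \<le> ?W"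
    proof (rule best_weights_decrease[OF n u u' le _ d(1) dh \<eta>(1)])
      fix i assume i: "i \<in> {1..n}"
      have ui: "0 \<le> u i" "0 \<le> u' i" using u u' i by (auto simp: nonneg_weights_def)
      have "(1 - d) * u i \<le> u' i + \<eta>"
      proof (cases "0 < u' i")
        case True
        then have "u i \<le> (1 + d) * u' i" using ge[OF i] by simp
        then have "(1 - d) * u i \<le> (1 - d) * ((1 + d) * u' i)" using d1 by (intro mult_left_mono) auto
        also have "\<dots> = (1 - d\<^sup>2) * u' i" by (simp add: power2_eq_square algebra_simps)
        also have "\<dots> \<le> 1 * u' i" using ui by (intro mult_right_mono) auto
        finally show ?thesis using \<eta>(1) by simp
      next
        case False
        then have "u i \<le> \<eta>" using ge[OF i] by simp
        moreover have "(1 - d) * u i \<le> 1 * u i" using ui d by (intro mult_right_mono) auto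
        ultimately show ?thesis using ui by simp
      qed
      then show "(1 - d) * u i - \<eta> \<le> u' i" by simp
    qed
    finally show ?thesis .
  qed
  have WE: "c * ?W \<le> policy_value u ?A (peak n) T ?z"
  proof -
    have "c * ?W \<le> (1 - d * harm T) * ?W" by (intro mult_right_mono cd V0[OF u'])
    also have "\<dots> \<le> policy_value u ?A (capped_load L n) T ?z"
      using ge by (intro greedy_policy_weights_increase[OF n u u' le _ d(1) dh]) (auto split: if_splits)
    also have "\<dots> \<le> policy_value u ?A (peak n) T ?z"
      by (rule policy_value_mono[OF u greedy_policy_in_policies]) (simp add: capped_load_def)
    finally show ?thesis .
  qed
  have O: "1 / (2 * real m) \<le> ?O"
  proof -
    let ?w = "total_weight u {1..n}"
    have "1 / (2 * real m) \<le> 1 - 1 / (1 + ?w)"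
    proof -
      have w: "1 / real m \<le> ?w" using tot mr by (simp add: field_simps)
      then have "1 / (1 + ?w) \<le> 1 / (1 + 1 / real m)" 
        using mr total_weight_nonneg[OF u order_refl]
        by (intro divide_left_mono mult_pos_pos add_pos_nonneg) auto
      also have "\<dots> = 1 - 1 / (real m + 1)" using mr by (simp add: field_simps)
      also have "\<dots> \<le> 1 - 1 / (2 * real m)" using mr by (intro diff_left_mono divide_left_mono) auto
      finally show ?thesis by simp
    qed
    also have "\<dots> = mean u {1..n} (\<lambda>j. if j = 0 then 0 else 1)"
    proof -
      have w0: "0 \<le> ?w" by (rule total_weight_nonneg[OF u]) simp
      have "(\<Sum>i = 1..n. u i * (if i = 0 then 0 else 1)) = ?w"
        unfolding total_weight_def by (intro sum.cong) auto
      then show ?thesis using w0 by (simp add: mean_def field_simps)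
    qed
    also have "\<dots> \<le> mean u {1..n} (\<lambda>j. best n u (peak n) 0 (add_choice j ?z))"
    proof (rule mean_mono[OF u order_refl])
      fix i assume i: "i \<in> {1..n}"
      show "(if i = 0 then 0 else 1) \<le> best n u (peak n) 0 (add_choice i ?z)"
        using load_le_max_load[OF i, of "add_choice i ?z"] i by (auto simp: add_choice_apply)
    qed simp
    also have "\<dots> \<le> best n u (peak n) 1 ?z"
      unfolding One_nat_def by (rule mean_le_best) simp
    also have "\<dots> \<le> ?O" using T
      by (rule lift_Suc_mono_le[of "\<lambda>r. best n u (peak n) r ?z", OF best_Suc_mono])
    finally show ?thesis .
  qed
  have "c * (c * (?O - e) - e) \<le> c * ?W"
  proof (rule mult_left_mono[OF _ c(1)])
    have "c * (?O - e) \<le> c * ?V" using OV c by (intro mult_left_mono) auto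
    then show "c * (?O - e) - e \<le> ?W" using VW by linarith
  qed
  moreover have "(1 - 3 / real m) * ?O \<le> c * (c * (?O - e) - e)"
  proof -
    have "c * c * e + c * e \<le> 2 * e"
    proof -
      have ce: "c * e \<le> 1 * e" using c(2) e0 by (rule mult_right_mono)
      moreover have "c * (c * e) \<le> 1 * (c * e)" using c e0 by (intro mult_right_mono mult_nonneg_nonneg) auto
      ultimately show ?thesis by simp
    qed
    also have "2 * e = 1 / (2 * real m) * (1 / real m)" using mr by (simp add: e_def power2_eq_square)
    also have "\<dots> \<le> ?O * (1 / real m)" using O by (rule mult_right_mono) simp
    finally have 1: "c * c * e + c * e \<le> ?O / real m" by simp
    have O0: "0 \<le> ?O" using O mr by (smt (verit) divide_nonneg_nonneg)
    have "(1 - 2 / real m) * ?O \<le> c * c * ?O"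
      by (rule mult_right_mono[OF _ O0]) (simp add: c_def algebra_simps)
    moreover have "(1 - 3 / real m) * ?O = (1 - 2 / real m) * ?O - ?O / real m"
      by (simp add: algebra_simps diff_divide_distrib[symmetric])
    ultimately show ?thesis using 1 by (simp add: algebra_simps)
  qed
  ultimately show ?thesis using WE by linarith
qed

section \<open>Load vectors as numbers\<close>

definition digit :: "nat \<Rightarrow> nat \<Rightarrow> nat \<Rightarrow> nat" where
  "digit B e c = c div B ^ e mod B"

lemma sum_digits_less:
  assumes "\<And>e. e < K \<Longrightarrow> d e < B"
  shows "(\<Sum>e<K. d e * B ^ e) < (B::nat) ^ K"
  using assms
proof (induction K)
  case (Suc K)
  have "d K + 1 \<le> B" using Suc.prems by (simp add: Suc_leI)
  then have "(d K + 1) * B ^ K \<le> B * B ^ K" by (rule mult_right_mono) simp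
  then show ?case using Suc by (simp add: algebra_simps)
qed simp

lemma digit_sum_digits:
  assumes "\<And>e. e < K \<Longrightarrow> d e < B" and "e < K"
  shows "digit B e (\<Sum>e<K. d e * B ^ e) = d e"
  using assms
proof (induction K)
  case (Suc K)
  have B: "0 < B" using Suc.prems by fastforce
  have IH: "digit B e (\<Sum>e<K. d e * B ^ e) = d e" if "e < K" using Suc that by simp
  have less: "(\<Sum>e<K. d e * B ^ e) < B ^ K" using Suc.prems by (intro sum_digits_less) simp
  show ?case
  proof (cases "e = K")
    case True
    then show ?thesis using less B Suc.prems by (simp add: digit_def div_mult_self3)
  next
    case False
    then have e: "e < K" using Suc.prems by simp
    have "d K * B ^ K = (d K * B ^ (K - e - 1)) * B * B ^ e"
      using e by (simp add: mult.assoc power_Suc[symmetric] power_add[symmetric] del: power_Suc)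
    then have "(\<Sum>e<Suc K. d e * B ^ e)
        = (\<Sum>e<K. d e * B ^ e) + (d K * B ^ (K - e - 1) * B) * B ^ e" by (simp only: sum.lessThan_Suc)
    then have "(\<Sum>e<Suc K. d e * B ^ e) div B ^ e
        = (\<Sum>e<K. d e * B ^ e) div B ^ e + d K * B ^ (K - e - 1) * B"
      using B by (simp only: div_mult_self1) simp
    then show ?thesis using IH[OF e] by (simp add: digit_def)
  qed
qed simp

lemma sum_over_types:
  assumes "finite I" "\<And>i. i \<in> I \<Longrightarrow> t i < (K::nat)"
  shows "(\<Sum>i\<in>I. g (t i)) = (\<Sum>e<K. of_nat (card {i\<in>I. t i = e}) * (g e :: 'a::comm_semiring_1))"
proof -
  have "(\<Sum>i\<in>I. g (t i)) = (\<Sum>e<K. \<Sum>i\<in>{i\<in>I. t i = e}. g (t i))"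
    using assms by (intro sum.group[symmetric]) auto
  also have "\<dots> = (\<Sum>e<K. of_nat (card {i\<in>I. t i = e}) * g e)"
    by (intro sum.cong) simp_all
  finally show ?thesis .
qed

text \<open>A type is a pair of a weight class and a capped load, numbered class by class so that a purchase
  moves a product to the next type.\<close>
definition type_of :: "nat \<Rightarrow> (nat \<Rightarrow> nat) \<Rightarrow> (nat \<Rightarrow> nat) \<Rightarrow> nat \<Rightarrow> nat" where
  "type_of L cls l i = cls i * Suc L + min (l i) L"

text \<open>In base \<open>B\<close> with \<open>n < B\<close>, the digit at position \<open>e\<close> is the number of products of type \<open>e\<close>.\<close>
definition code :: "nat \<Rightarrow> nat \<Rightarrow> nat \<Rightarrow> (nat \<Rightarrow> nat) \<Rightarrow> (nat \<Rightarrow> nat) \<Rightarrow> nat" where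
  "code n B L cls l = (\<Sum>i\<in>{1..n}. B ^ type_of L cls l i)"

text \<open>The change of the code when a product of type \<open>e\<close> is bought; at the cap the type stays.\<close>
definition code_inc :: "nat \<Rightarrow> nat \<Rightarrow> nat \<Rightarrow> nat" where
  "code_inc B L e = (if e mod Suc L < L then B ^ Suc e - B ^ e else 0)"

lemma type_of_mod [simp]: "type_of L cls l i mod Suc L = min (l i) L"
  by (simp add: type_of_def del: mult_Suc_right)

lemma type_of_div [simp]: "type_of L cls l i div Suc L = cls i"
  by (simp add: type_of_def del: mult_Suc_right)

lemma type_of_less:
  assumes "cls i < k"
  shows "type_of L cls l i < k * Suc L"
proof -
  have "type_of L cls l i < (cls i + 1) * Suc L" by (simp add: type_of_def)
  also have "\<dots> \<le> k * Suc L" using assms by (intro mult_le_mono1) simp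
  finally show ?thesis .
qed

lemma code_eq_sum_digits:
  assumes "\<And>i. i \<in> {1..n} \<Longrightarrow> cls i < k"
  shows "code n B L cls l
    = (\<Sum>e<k * Suc L. card {i\<in>{1..n}. type_of L cls l i = e} * B ^ e)"
  unfolding code_def
  using sum_over_types[of "{1..n}" "type_of L cls l" "k * Suc L" "\<lambda>e. B ^ e"]
    type_of_less assms by simp

lemma card_types_less:
  assumes "n < B"
  shows "card {i\<in>{1..n}. P i} < B"
proof -
  have "card {i\<in>{1..n}. P i} \<le> card {1..n}" by (intro card_mono) auto
  then show ?thesis using assms by simp
qed

lemma code_less:
  assumes "\<And>i. i \<in> {1..n} \<Longrightarrow> cls i < k" "n < B"
  shows "code n B L cls l < B ^ (k * Suc L)"
proof -
  have "code n B L cls l = (\<Sum>e<k * Suc L. card {i\<in>{1..n}. type_of L cls l i = e} * B ^ e)"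
    by (rule code_eq_sum_digits) (rule assms(1))
  then show ?thesis using sum_digits_less card_types_less[OF assms(2)] by simp
qed

lemma digit_code:
  assumes "\<And>i. i \<in> {1..n} \<Longrightarrow> cls i < k" "n < B" "e < k * Suc L"
  shows "digit B e (code n B L cls l) = card {i\<in>{1..n}. type_of L cls l i = e}"
proof -
  have "code n B L cls l = (\<Sum>e<k * Suc L. card {i\<in>{1..n}. type_of L cls l i = e} * B ^ e)"
    by (rule code_eq_sum_digits) (rule assms(1))
  moreover have "digit B e (\<Sum>e<k * Suc L. card {i\<in>{1..n}. type_of L cls l i = e} * B ^ e)
      = card {i\<in>{1..n}. type_of L cls l i = e}"
    by (rule digit_sum_digits[OF card_types_less[OF assms(2)] assms(3)])
  ultimately show ?thesis by (simp only:)
qed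

lemma code_add_choice:
  assumes i: "i \<in> {1..n}" and B: "0 < B"
  shows "code n B L cls (add_choice i l) = code n B L cls l + code_inc B L (type_of L cls l i)"
proof -
  let ?t = "type_of L cls l"
  have s: "code n B L cls l' = B ^ type_of L cls l' i + (\<Sum>j\<in>{1..n} - {i}. B ^ type_of L cls l' j)" for l'
    unfolding code_def using i by (intro sum.remove) auto
  have "(\<Sum>j\<in>{1..n} - {i}. B ^ type_of L cls (add_choice i l) j) = (\<Sum>j\<in>{1..n} - {i}. B ^ ?t j)"
    by (intro sum.cong) (auto simp: type_of_def add_choice_def)
  moreover have "B ^ type_of L cls (add_choice i l) i = B ^ ?t i + code_inc B L (?t i)"
  proof (cases "l i < L")
    case True
    then have "type_of L cls (add_choice i l) i = Suc (?t i)"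
      using i by (simp add: type_of_def add_choice_apply)
    moreover have "B ^ ?t i \<le> B ^ Suc (?t i)" using B by simp
    ultimately show ?thesis using True by (simp add: code_inc_def del: power_Suc power_increasing_iff)
  next
    case False
    then have "type_of L cls (add_choice i l) i = ?t i"
      using i by (simp add: type_of_def add_choice_apply)
    then show ?thesis using False by (simp add: code_inc_def)
  qed
  ultimately show ?thesis by (simp add: s[of l] s[of "add_choice i l"])
qed

section \<open>The dynamic program on codes\<close>

primrec top_level :: "nat \<Rightarrow> nat \<Rightarrow> nat \<Rightarrow> nat \<Rightarrow> nat" where
  "top_level B L c 0 = 0"
| "top_level B L c (Suc e) =
     (if 0 < digit B e c \<and> top_level B L c e < e mod Suc L then e mod Suc L
      else top_level B L c e)"

text \<open>The average for the offer of all types whose purchase leads to a value at least that of type \<open>f\<close>.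
  A type \<open>f\<close> that no product has still determines an admissible offer, so all \<open>K\<close> types can be tried.\<close>
definition threshold_value ::
    "nat \<Rightarrow> nat \<Rightarrow> (nat \<Rightarrow> real) \<Rightarrow> nat \<Rightarrow> (nat \<Rightarrow> real) \<Rightarrow> nat \<Rightarrow> nat \<Rightarrow> real" where
  "threshold_value B L w K V c f =
     (V c + (\<Sum>e<K. if V (c + code_inc B L e) < V (c + code_inc B L f) then 0
                     else real (digit B e c) * w (e div Suc L) * V (c + code_inc B L e)))
     / (1 + (\<Sum>e<K. if V (c + code_inc B L e) < V (c + code_inc B L f) then 0
                     else real (digit B e c) * w (e div Suc L)))"

primrec best_threshold ::
    "nat \<Rightarrow> nat \<Rightarrow> (nat \<Rightarrow> real) \<Rightarrow> nat \<Rightarrow> (nat \<Rightarrow> real) \<Rightarrow> nat \<Rightarrow> nat \<Rightarrow> real" where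
  "best_threshold B L w K V c 0 = V c"
| "best_threshold B L w K V c (Suc f) =
     (if best_threshold B L w K V c f < threshold_value B L w K V c f
      then threshold_value B L w K V c f else best_threshold B L w K V c f)"

text \<open>The values outside the table are 0 because the array is initially 0 and never written there.\<close>
primrec table :: "nat \<Rightarrow> nat \<Rightarrow> (nat \<Rightarrow> real) \<Rightarrow> nat \<Rightarrow> nat \<Rightarrow> nat \<Rightarrow> real" where
  "table B L w K 0 c = (if c < B ^ K then real (top_level B L c K) else 0)"
| "table B L w K (Suc r) c =
     (if c < B ^ K then best_threshold B L w K (table B L w K r) c K else 0)"

lemma top_level_eq:
  "top_level B L c e = Max (insert 0 ((\<lambda>e. e mod Suc L) ` {e'. e' < e \<and> 0 < digit B e' c}))"
proof (induction e)
  case (Suc e)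
  have eq: "{e'. e' < Suc e \<and> 0 < digit B e' c}
     = (if 0 < digit B e c then insert e {e'. e' < e \<and> 0 < digit B e' c}
        else {e'. e' < e \<and> 0 < digit B e' c})"
    by (auto simp: less_Suc_eq)
  show ?case
  proof (cases "0 < digit B e c")
    case True
    have "Max (insert 0 (insert (e mod Suc L) ((\<lambda>e. e mod Suc L) ` {e'. e' < e \<and> 0 < digit B e' c})))
        = max (e mod Suc L) (top_level B L c e)"
      unfolding Suc.IH insert_commute[of 0] by (intro Max_insert) auto
    then show ?thesis using True by (simp add: eq max_def not_less)
  next
    case False
    then show ?thesis using Suc.IH by (simp add: eq)
  qed
qed simp

lemma best_threshold_le:
  "(\<And>f. f < F \<Longrightarrow> threshold_value B L w K V c f \<le> x) \<Longrightarrow> V c \<le> x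
    \<Longrightarrow> best_threshold B L w K V c F \<le> x"
  by (induction F) auto

lemma best_threshold_ge:
  "V c \<le> best_threshold B L w K V c F"
  "f < F \<Longrightarrow> threshold_value B L w K V c f \<le> best_threshold B L w K V c F"
proof -
  show "V c \<le> best_threshold B L w K V c F" by (induction F) auto
  show "f < F \<Longrightarrow> threshold_value B L w K V c f \<le> best_threshold B L w K V c F"
    by (induction F) (auto simp: less_Suc_eq)
qed

text \<open>Products of one type have the same weight and the same value after a purchase, so sums over products
  become sums over types weighted with digits. An optimal offer consists of the products with values above the
  optimum (\<open>best_eq_superlevel\<close>); it is empty or equals the threshold offer of its least valuable product.\<close>
theorem table_eq_best:
  fixes n B L k :: nat and cls :: "nat \<Rightarrow> nat" and w u :: "nat \<Rightarrow> real"
  assumes n: "1 \<le> n" and cls: "\<And>i. i \<in> {1..n} \<Longrightarrow> cls i < k" and B: "n < B"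
    and u: "nonneg_weights n u" and w: "\<And>i. i \<in> {1..n} \<Longrightarrow> u i = w (cls i)"
  shows "table B L w (k * Suc L) r (code n B L cls l) = best n u (capped_load L n) r l"
proof (induction r arbitrary: l)
  case 0
  let ?K = "k * Suc L" and ?c = "code n B L cls l"
  have "(\<lambda>e. e mod Suc L) ` {e. e < ?K \<and> 0 < digit B e ?c} = (\<lambda>i. min (l i) L) ` {1..n}"
  proof -
    have "{e. e < ?K \<and> 0 < digit B e ?c} = type_of L cls l ` {1..n}"
    proof (intro set_eqI iffI)
      fix e assume "e \<in> {e. e < ?K \<and> 0 < digit B e ?c}"
      then have "card {i\<in>{1..n}. type_of L cls l i = e} > 0"
        using digit_code[OF cls B, where e = e and L = L and l = l] by auto
      then have "{i\<in>{1..n}. type_of L cls l i = e} \<noteq> {}" by (metis card.empty less_irrefl)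
      then show "e \<in> type_of L cls l ` {1..n}" by blast
    next
      fix e assume "e \<in> type_of L cls l ` {1..n}"
      then obtain i where i: "i \<in> {1..n}" "e = type_of L cls l i" by blast
      have e: "e < ?K" using type_of_less[of cls i k L l] cls[OF i(1)] i(2) by simp
      have "card {i\<in>{1..n}. type_of L cls l i = e} > 0" using i by (subst card_gt_0_iff) auto
      then show "e \<in> {e. e < ?K \<and> 0 < digit B e ?c}"
        using digit_code[OF cls B e, where l = l] e by simp
    qed
    then show ?thesis by (simp add: image_image del: One_nat_def add_Suc_right add_0_right)
  qed
  then have "top_level B L ?c ?K = Max (insert 0 ((\<lambda>i. min (l i) L) ` {1..n}))"
    unfolding top_level_eq by simp
  also have "\<dots> = Max ((\<lambda>i. min (l i) L) ` {1..n})"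
    using n by (subst Max_insert) auto
  also have "\<dots> = min L (max_load n l)"
  proof (rule Max_eqI)
    show "y \<le> min L (max_load n l)" if "y \<in> (\<lambda>i. min (l i) L) ` {1..n}" for y
      using that load_le_max_load[of _ n l] by fastforce
    show "min L (max_load n l) \<in> (\<lambda>i. min (l i) L) ` {1..n}"
      using winner[OF n, of l] by (auto simp: image_iff min.commute intro!: bexI[of _ "winner n l"])
  qed simp
  finally show ?case using code_less[OF cls B] by (simp add: capped_load_def)
next
  case (Suc r)
  let ?K = "k * Suc L" and ?c = "code n B L cls l" and ?t = "type_of L cls l"
  let ?V = "table B L w ?K r" and ?h = "\<lambda>j. best n u (capped_load L n) r (add_choice j l)"
  have B0: "0 < B" using B by simp
  have V0: "?V ?c = ?h 0" using Suc.IH by simp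
  have Vi: "?V (?c + code_inc B L (?t i)) = ?h i" if "i \<in> {1..n}" for i
    using Suc.IH[of "add_choice i l"] code_add_choice[OF that B0] by simp
  have tl: "?t i < ?K" if "i \<in> {1..n}" for i using type_of_less[of cls i] cls[OF that] by simp
  define R where "R f = {i\<in>{1..n}. ?V (?c + code_inc B L f) \<le> ?h i}" for f
  have R: "R f \<subseteq> {1..n}" for f by (auto simp: R_def)
  have group: "(\<Sum>e<?K. if ?V (?c + code_inc B L e) < ?V (?c + code_inc B L f) then 0
        else real (digit B e ?c) * w (e div Suc L) * g e) = (\<Sum>i\<in>R f. u i * g (?t i))" for f and g :: "nat \<Rightarrow> real"
  proof -
    let ?g = "\<lambda>e. if ?V (?c + code_inc B L e) < ?V (?c + code_inc B L f) then 0 else w (e div Suc L) * g e"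
    have "(\<Sum>i\<in>R f. u i * g (?t i)) = (\<Sum>i\<in>{1..n}. ?g (?t i))"
      using w Vi by (intro sum.mono_neutral_cong_left) (auto simp: R_def simp del: mult_Suc_right)
    also have "\<dots> = (\<Sum>e<?K. real (card {i\<in>{1..n}. ?t i = e}) * ?g e)"
      using tl by (intro sum_over_types) auto
    also have "\<dots> = (\<Sum>e<?K. if ?V (?c + code_inc B L e) < ?V (?c + code_inc B L f) then 0
        else real (digit B e ?c) * w (e div Suc L) * g e)"
      using digit_code[OF cls B, where L = L and l = l] by (intro sum.cong) auto
    finally show ?thesis by simp
  qed
  have tv: "threshold_value B L w ?K ?V ?c f = mean u (R f) ?h" for f
  proof -
    have 1: "(\<Sum>i\<in>R f. u i * ?V (?c + code_inc B L (?t i))) = (\<Sum>i\<in>R f. u i * ?h i)"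
      using Vi subsetD[OF R] by (intro sum.cong) (simp_all del: mult_Suc_right)
    have 2: "(\<Sum>e<?K. if ?V (?c + code_inc B L e) < ?V (?c + code_inc B L f) then 0
        else real (digit B e ?c) * w (e div Suc L)) = (\<Sum>i\<in>R f. u i)"
      using group[of f "\<lambda>_. 1"] by (simp only: mult_1_right)
    show ?thesis
      unfolding threshold_value_def mean_def group[of f "\<lambda>e. ?V (?c + code_inc B L e)"] total_weight_def
      unfolding 1 2 V0 ..
  qed
  have "best_threshold B L w ?K ?V ?c ?K = best n u (capped_load L n) (Suc r) l"
  proof (rule antisym)
    show "best_threshold B L w ?K ?V ?c ?K \<le> best n u (capped_load L n) (Suc r) l"
      using mean_le_best[OF R] best_Suc_mono[of n u _ r l] V0
      by (intro best_threshold_le) (simp_all only: tv add_choice_0)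
    let ?x = "best n u (capped_load L n) (Suc r) l"
    let ?S = "{i\<in>{1..n}. ?x < ?h i}"
    have x: "?x = mean u ?S ?h" by (rule best_eq_superlevel[OF u])
    show "?x \<le> best_threshold B L w ?K ?V ?c ?K"
    proof (cases "?S = {}")
      case True
      have "?x = ?V ?c" unfolding V0 using x unfolding True by (simp add: mean_def total_weight_def del: best.simps)
      then show ?thesis using best_threshold_ge(1) by simp
    next
      case False
      define i where "i = arg_min_on ?h ?S"
      have i: "i \<in> ?S" "\<And>j. j \<in> ?S \<Longrightarrow> ?h i \<le> ?h j"
        unfolding i_def using False arg_min_if_finite(1)[of ?S ?h] arg_min_least[of ?S _ ?h] by auto
      have "R (?t i) = ?S"
      proof (intro set_eqI iffI)
        fix j assume "j \<in> R (?t i)"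
        then have j: "j \<in> {1..n}" "?h i \<le> ?h j" using Vi[of i] i(1) by (auto simp: R_def)
        have "?x < ?h i" using i(1) by blast
        then have "?x < ?h j" using j(2) by (rule less_le_trans)
        then show "j \<in> ?S" using j(1) by blast
      next
        fix j assume j: "j \<in> ?S"
        then show "j \<in> R (?t i)" using Vi[of i] i(1) i(2)[OF j] by (auto simp: R_def)
      qed
      then have "?x = threshold_value B L w ?K ?V ?c (?t i)" unfolding tv using x by (simp only:)
      then show ?thesis using best_threshold_ge(2)[OF tl[of i]] i(1) by simp
    qed
  qed
  then show ?case using code_less[OF cls B] by (simp del: best.simps)
qed

section \<open>Weight classes\<close>

definition class_of :: "real \<Rightarrow> real \<Rightarrow> real \<Rightarrow> nat" where
  "class_of \<eta> q x = (LEAST c. x \<le> \<eta> * q ^ c)"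

text \<open>The lower end of the interval of weights in class \<open>c\<close>; class 0 holds the weights up to \<open>\<eta>\<close>, which are rounded to 0.
  The intervals are open below since the test of a loop is a strict inequality.\<close>
definition class_weight :: "real \<Rightarrow> real \<Rightarrow> nat \<Rightarrow> real" where
  "class_weight \<eta> q c = (if c = 0 then 0 else \<eta> * q ^ (c - 1))"

lemma class_of_exists:
  assumes "0 < \<eta>" "1 < q"
  shows "\<exists>c. x \<le> \<eta> * (q::real) ^ c"
proof -
  obtain c where "x / \<eta> < q ^ c" using real_arch_pow[OF assms(2)] by blast
  then show ?thesis using assms(1) by (auto simp: field_simps intro!: exI[of _ c])
qed

lemma class_of_le_power:
  assumes "0 < \<eta>" "1 < q"
  shows "x \<le> \<eta> * q ^ class_of \<eta> q x"
  unfolding class_of_def using class_of_exists[OF assms] by (rule LeastI_ex)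

lemma less_class_of: "c < class_of \<eta> q x \<Longrightarrow> \<eta> * q ^ c < x"
  unfolding class_of_def using not_less_Least by fastforce

lemma class_of_le: "x \<le> \<eta> * q ^ c \<Longrightarrow> class_of \<eta> q x \<le> c"
  unfolding class_of_def by (rule Least_le)

lemma class_of_mono:
  assumes "0 < \<eta>" "1 < q" "x \<le> y"
  shows "class_of \<eta> q x \<le> class_of \<eta> q y"
  using class_of_le_power[OF assms(1,2), of y] assms(3) by (intro class_of_le) linarith

lemma class_weight_bounds:
  assumes q: "0 < \<eta>" "1 < q" and x: "0 < x"
  shows "0 \<le> class_weight \<eta> q (class_of \<eta> q x)"
    and "class_weight \<eta> q (class_of \<eta> q x) \<le> x"
    and "if 0 < class_weight \<eta> q (class_of \<eta> q x) then x \<le> q * class_weight \<eta> q (class_of \<eta> q x) else x \<le> \<eta>"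
proof -
  let ?c = "class_of \<eta> q x"
  show "0 \<le> class_weight \<eta> q ?c" using q by (simp add: class_weight_def)
  show "class_weight \<eta> q ?c \<le> x"
    using less_class_of[of "?c - 1" \<eta> q x] x by (auto simp: class_weight_def)
  show "if 0 < class_weight \<eta> q ?c then x \<le> q * class_weight \<eta> q ?c else x \<le> \<eta>"
  proof (cases "?c = 0")
    case True
    then show ?thesis using class_of_le_power[OF q, of x] by (simp add: class_weight_def)
  next
    case False
    then have "q * class_weight \<eta> q ?c = \<eta> * q ^ ?c"
      by (cases ?c) (simp_all add: class_weight_def)
    moreover have "0 < class_weight \<eta> q ?c" using q False by (simp add: class_weight_def)
    ultimately show ?thesis using class_of_le_power[OF q, of x] by simp
  qed
qed

section \<open>Weakest preconditions with running time\<close>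

text \<open>Total correctness: the program halts, and the time and the final memory satisfy \<open>Q\<close>. As \<open>Q\<close> sees
  the time, straight-line code is evaluated by rewriting.\<close>
definition wp :: "prog \<Rightarrow> (nat \<Rightarrow> mem \<Rightarrow> bool) \<Rightarrow> mem \<Rightarrow> bool" where
  "wp c Q s \<longleftrightarrow> (\<exists>t s'. runs c s t s' \<and> Q t s')"

lemma wp_Do [simp]: "wp (Do i) Q s \<longleftrightarrow> Q 1 (effect i s)"
  unfolding wp_def by (metis runs.Do DoE)

lemma wp_Seq [simp]: "wp (Seq c d) Q s \<longleftrightarrow> wp c (\<lambda>t. wp d (\<lambda>t'. Q (t + t'))) s"
  unfolding wp_def by (blast intro: runs.Seq elim: SeqE)

lemma wp_Branch [simp]:
  "wp (Branch b c d) Q s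
     \<longleftrightarrow> (if holds b s then wp c (\<lambda>t. Q (Suc t)) s else wp d (\<lambda>t. Q (Suc t)) s)"
  unfolding wp_def by (auto intro: runs.BranchTrue[simplified] runs.BranchFalse[simplified] elim!: BranchE)

lemma wp_mono: "wp c P s \<Longrightarrow> (\<And>t s'. P t s' \<Longrightarrow> Q t s') \<Longrightarrow> wp c Q s"
  unfolding wp_def by blast

text \<open>The variables and arrays that a program may write are read off its text, so that
  everything else is known to be unchanged and can be left out of invariants.\<close>
datatype loc = IV vname | RV vname | IA vname | RA vname

primrec instr_target :: "instr \<Rightarrow> loc" where
  "instr_target (IConst x k) = IV x"
| "instr_target (IAdd x y z) = IV x"
| "instr_target (ISub x y z) = IV x"
| "instr_target (ILoad x a y) = IV x"
| "instr_target (IStore a y x) = IA a"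
| "instr_target (ROfInt x y) = RV x"
| "instr_target (RAdd x y z) = RV x"
| "instr_target (RSub x y z) = RV x"
| "instr_target (RMul x y z) = RV x"
| "instr_target (RDiv x y z) = RV x"
| "instr_target (RLoad x a y) = RV x"
| "instr_target (RStore a y x) = RA a"

primrec targets :: "prog \<Rightarrow> loc set" where
  "targets (Do i) = {instr_target i}"
| "targets (Seq c d) = targets c \<union> targets d"
| "targets (Branch b c d) = targets c \<union> targets d"
| "targets (Loop b c) = targets c"

definition frame :: "loc set \<Rightarrow> mem \<Rightarrow> mem \<Rightarrow> bool" where
  "frame X s s' \<longleftrightarrow>
     (\<forall>x. IV x \<notin> X \<longrightarrow> ivar s' x = ivar s x) \<and> (\<forall>x. RV x \<notin> X \<longrightarrow> rvar s' x = rvar s x) \<and>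
     (\<forall>x. IA x \<notin> X \<longrightarrow> iarr s' x = iarr s x) \<and> (\<forall>x. RA x \<notin> X \<longrightarrow> rarr s' x = rarr s x)"

lemma frameD:
  assumes "frame X s s'"
  shows "IV x \<notin> X \<Longrightarrow> ivar s' x = ivar s x" "RV x \<notin> X \<Longrightarrow> rvar s' x = rvar s x"
    "IA x \<notin> X \<Longrightarrow> iarr s' x = iarr s x" "RA x \<notin> X \<Longrightarrow> rarr s' x = rarr s x"
  using assms by (auto simp: frame_def)

lemma frame_refl [simp]: "frame X s s"
  by (simp add: frame_def)

lemma frame_trans: "frame X s s' \<Longrightarrow> frame X s' s'' \<Longrightarrow> frame X s s''"
  by (simp add: frame_def)

lemma frame_mono: "frame X s s' \<Longrightarrow> X \<subseteq> Y \<Longrightarrow> frame Y s s'"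
  unfolding frame_def by blast

lemma runs_frame: "runs c s t s' \<Longrightarrow> frame (targets c) s s'"
proof (induction rule: runs.induct)
  case (Do i s)
  then show ?case by (cases i) (auto simp: frame_def)
next
  case (LoopTrue b s c t s' t' s'')
  then show ?case by (auto intro: frame_trans)
qed (auto intro: frame_trans frame_mono)

lemma wp_frame: "wp c (\<lambda>t s'. frame (targets c) s s' \<longrightarrow> Q t s') s \<Longrightarrow> wp c Q s"
  unfolding wp_def using runs_frame by blast

lemma wp_Loop_True: "holds b s \<Longrightarrow> wp c (\<lambda>t. wp (Loop b c) (\<lambda>t'. Q (t + t' + 1))) s \<Longrightarrow> wp (Loop b c) Q s"
  unfolding wp_def by (blast intro: runs.LoopTrue)

lemma wp_Loop_False: "\<not> holds b s \<Longrightarrow> Q 1 s \<Longrightarrow> wp (Loop b c) Q s"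
  unfolding wp_def by (blast intro: runs.LoopFalse)

lemma wp_Loop_aux:
  assumes step: "\<And>j s. j < N \<Longrightarrow> I j s \<Longrightarrow> holds b s \<and> wp c (\<lambda>t s'. t \<le> C \<and> I (Suc j) s') s"
    and exit: "\<And>s. I N s \<Longrightarrow> \<not> holds b s"
    and j: "j \<le> N" and I: "I j s"
  shows "wp (Loop b c) (\<lambda>t s'. t \<le> (N - j) * (C + 1) + 1 \<and> I N s') s"
  using j I
proof (induction "N - j" arbitrary: j s)
  case 0
  then have "j = N" by simp
  then show ?case using exit 0 by (intro wp_Loop_False) auto
next
  case (Suc d)
  have j: "j < N" "d = N - Suc j" using Suc.hyps(2) by auto
  have w: "wp c (\<lambda>t s'. t \<le> C \<and> I (Suc j) s') s" and b: "holds b s"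
    using step[OF j(1) Suc.prems(2)] by auto
  have "wp c (\<lambda>t. wp (Loop b c) (\<lambda>t' s''. t + t' + 1 \<le> (N - j) * (C + 1) + 1 \<and> I N s'')) s"
  proof (rule wp_mono[OF w])
    fix t s' assume *: "t \<le> C \<and> I (Suc j) s'"
    have "wp (Loop b c) (\<lambda>t s'. t \<le> (N - Suc j) * (C + 1) + 1 \<and> I N s') s'"
      using Suc.hyps(1)[OF j(2)] j(1) * by simp
    then show "wp (Loop b c) (\<lambda>t' s''. t + t' + 1 \<le> (N - j) * (C + 1) + 1 \<and> I N s'') s'"
    proof (rule wp_mono)
      fix t' s'' assume t': "t' \<le> (N - Suc j) * (C + 1) + 1 \<and> I N s''"
      have "N - j = Suc (N - Suc j)" using j by simp
      then have "(N - j) * (C + 1) = (C + 1) + (N - Suc j) * (C + 1)" by (simp only: mult_Suc)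
      then show "t + t' + 1 \<le> (N - j) * (C + 1) + 1 \<and> I N s''" using t' * by linarith
    qed
  qed
  then show ?case using b by (intro wp_Loop_True)
qed

text \<open>The invariant is indexed by the number of completed iterations, and the frame relative to the state before
  the loop may be assumed throughout.\<close>
lemma wp_Loop:
  assumes I: "I 0 s"
    and step: "\<And>j s'. j < N \<Longrightarrow> frame (targets c) s s' \<Longrightarrow> I j s' \<Longrightarrow>
       holds b s' \<and> wp c (\<lambda>t s''. frame (targets c) s s'' \<longrightarrow> t \<le> C \<and> I (Suc j) s'') s'"
    and exit: "\<And>s'. frame (targets c) s s' \<Longrightarrow> I N s' \<Longrightarrow> \<not> holds b s'"
    and Q: "\<And>t s'. t \<le> N * (C + 1) + 1 \<Longrightarrow> frame (targets c) s s' \<Longrightarrow> I N s' \<Longrightarrow> Q t s'"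
  shows "wp (Loop b c) Q s"
proof -
  have "wp (Loop b c) (\<lambda>t s'. t \<le> (N - 0) * (C + 1) + 1 \<and> (frame (targets c) s s' \<and> I N s')) s"
  proof (rule wp_Loop_aux)
    fix j s' assume j: "j < N" and I': "frame (targets c) s s' \<and> I j s'"
    have w: "holds b s' \<and> wp c (\<lambda>t s''. frame (targets c) s s'' \<longrightarrow> t \<le> C \<and> I (Suc j) s'') s'"
      using step j I' by blast
    have "wp c (\<lambda>t s''. t \<le> C \<and> frame (targets c) s s'' \<and> I (Suc j) s'') s'"
    proof (rule wp_frame, rule wp_mono[OF conjunct2[OF w]], intro impI)
      fix t s'' assume "frame (targets c) s s'' \<longrightarrow> t \<le> C \<and> I (Suc j) s''" "frame (targets c) s' s''"
      then show "t \<le> C \<and> frame (targets c) s s'' \<and> I (Suc j) s''"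
        using I' frame_trans by blast
    qed
    then show "holds b s' \<and> wp c (\<lambda>t s''. t \<le> C \<and> frame (targets c) s s'' \<and> I (Suc j) s'') s'"
      using w by blast
  qed (use exit I in auto)
  then show ?thesis by (rule wp_mono) (use Q in auto)
qed

text \<open>The increment is taken from the variable \<open>one\<close>, since addition has no constant operands.\<close>
definition For :: "vname \<Rightarrow> nat \<Rightarrow> vname \<Rightarrow> prog \<Rightarrow> prog" where
  "For i lo hi c = Seq (Do (IConst i lo)) (Loop (ILess i hi) (Seq c (Do (IAdd i i ''one''))))"

lemma targets_For [simp]: "targets (For i lo hi c) = insert (IV i) (targets c)"
  by (auto simp: For_def)

lemma wp_For:
  assumes one: "ivar s ''one'' = 1" and hi: "ivar s hi = lo + N"
    and tg: "IV i \<notin> targets c" "IV hi \<notin> insert (IV i) (targets c)" "IV ''one'' \<notin> insert (IV i) (targets c)"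
    and I: "I 0 (s\<lparr>ivar := (ivar s)(i := lo)\<rparr>)"
    and step: "\<And>j s'. j < N \<Longrightarrow> frame (insert (IV i) (targets c)) s s' \<Longrightarrow> ivar s' i = lo + j \<Longrightarrow> I j s' \<Longrightarrow>
       wp c (\<lambda>t s''. frame (insert (IV i) (targets c)) s s'' \<longrightarrow> t \<le> C \<and>
          I (Suc j) (s''\<lparr>ivar := (ivar s'')(i := lo + Suc j)\<rparr>)) s'"
    and Q: "\<And>t s'. t \<le> N * (C + 2) + 2 \<Longrightarrow> frame (insert (IV i) (targets c)) s s' \<Longrightarrow>
       ivar s' i = lo + N \<Longrightarrow> I N s' \<Longrightarrow> Q t s'"
  shows "wp (For i lo hi c) Q s"
proof -
  let ?X = "insert (IV i) (targets c)" and ?s = "s\<lparr>ivar := (ivar s)(i := lo)\<rparr>"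
  have fr0: "frame ?X s ?s" by (simp add: frame_def)
  have "wp (Loop (ILess i hi) (Seq c (Do (IAdd i i ''one'')))) (\<lambda>t. Q (1 + t)) ?s"
  proof (rule wp_Loop[where I = "\<lambda>j s'. ivar s' i = lo + j \<and> I j s'" and N = N and C = "C + 1"])
    show "ivar ?s i = lo + 0 \<and> I 0 ?s" using I by simp
  next
    fix j s' assume j: "j < N" and fr: "frame (targets (Seq c (Do (IAdd i i ''one'')))) ?s s'"
      and I': "ivar s' i = lo + j \<and> I j s'"
    have fr': "frame ?X s s'" using frame_trans[OF fr0] fr by simp
    note st = frameD[OF fr']
    have "holds (ILess i hi) s'" using I' j st(1)[of hi] tg hi by simp
    moreover have "wp (Seq c (Do (IAdd i i ''one''))) (\<lambda>t s''. t \<le> C + 1 \<and> ivar s'' i = lo + Suc j \<and> I (Suc j) s'') s'"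
      unfolding wp_Seq wp_Do
    proof (rule wp_frame, rule wp_mono[OF step[OF j fr' conjunct1[OF I'] conjunct2[OF I']]], intro impI)
      fix t s'' assume a: "frame ?X s s'' \<longrightarrow> t \<le> C \<and> I (Suc j) (s''\<lparr>ivar := (ivar s'')(i := lo + Suc j)\<rparr>)"
        and f: "frame (targets c) s' s''"
      have f': "frame ?X s s''" using frame_trans[OF fr' frame_mono[OF f]] by blast
      have "ivar s'' i = lo + j" using frameD(1)[OF f] tg(1) I' by simp
      moreover have "ivar s'' ''one'' = 1" using frameD(1)[OF f'] tg(3) one by simp
      ultimately show "t + 1 \<le> C + 1 \<and> ivar (effect (IAdd i i ''one'') s'') i = lo + Suc j
           \<and> I (Suc j) (effect (IAdd i i ''one'') s'')"
        using a f' by (simp add: add.commute)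
    qed
    ultimately show "holds (ILess i hi) s' \<and> wp (Seq c (Do (IAdd i i ''one'')))
      (\<lambda>t s''. frame (targets (Seq c (Do (IAdd i i ''one'')))) ?s s'' \<longrightarrow>
          t \<le> C + 1 \<and> ivar s'' i = lo + Suc j \<and> I (Suc j) s'') s'"
      by (auto elim: wp_mono)
  next
    fix s' assume fr: "frame (targets (Seq c (Do (IAdd i i ''one'')))) ?s s'" and I': "ivar s' i = lo + N \<and> I N s'"
    have fr': "frame ?X s s'" using frame_trans[OF fr0] fr by simp
    show "\<not> holds (ILess i hi) s'" using I' frameD(1)[OF fr', of hi] tg hi by simp
  next
    fix t s' assume t: "t \<le> N * (C + 1 + 1) + 1" and fr: "frame (targets (Seq c (Do (IAdd i i ''one'')))) ?s s'"
      and I': "ivar s' i = lo + N \<and> I N s'"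
    have fr': "frame ?X s s'" using frame_trans[OF fr0] fr by simp
    show "Q (1 + t) s'" using Q[OF _ fr'] t I' by simp
  qed
  then show ?thesis by (simp add: For_def)
qed

section \<open>Programs for the table\<close>

definition nop :: prog where "nop = Do (IConst ''nop'' 0)"

text \<open>Appending a program rather than another list keeps the nesting to the right, which is how time and
  memory are propagated.\<close>
primrec seq :: "instr list \<Rightarrow> prog \<Rightarrow> prog" where
  "seq [] c = c"
| "seq (i # is) c = Seq (Do i) (seq is c)"

lemma targets_seq [simp]: "targets (seq is c) = set (map instr_target is) \<union> targets c"
  by (induction "is") auto

lemma wp_seq_Cons [simp]: "wp (seq (i # is) c) Q s \<longleftrightarrow> wp (seq is c) (\<lambda>t. Q (Suc t)) (effect i s)"
  by simp

definition tables_ready :: "nat \<Rightarrow> nat \<Rightarrow> (nat \<Rightarrow> real) \<Rightarrow> nat \<Rightarrow> mem \<Rightarrow> bool" where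
  "tables_ready B L w K s \<longleftrightarrow>
     ivar s ''one'' = 1 \<and> ivar s ''z'' = 0 \<and> rvar s ''one'' = 1 \<and> rvar s ''z'' = 0 \<and>
     ivar s ''K'' = K \<and> ivar s ''N'' = B ^ K \<and>
     (\<forall>e<K. iarr s ''pw'' e = B ^ e \<and> iarr s ''inc'' e = code_inc B L e
        \<and> iarr s ''lv'' e = e mod Suc L \<and> rarr s ''tw'' e = w (e div Suc L))"

definition table_locs :: "loc set" where
  "table_locs = {IV ''one'', IV ''z'', RV ''one'', RV ''z'', IV ''K'', IV ''N'',
     IA ''pw'', IA ''inc'', IA ''lv'', RA ''tw''}"

lemma tables_ready_frame:
  assumes "frame X s s'" "X \<inter> table_locs = {}" "tables_ready B L w K s"
  shows "tables_ready B L w K s'"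
proof -
  have "x \<notin> X" if "x \<in> table_locs" for x using assms(2) that by blast
  then show ?thesis using assms(3)
    by (simp add: tables_ready_def table_locs_def frameD[OF assms(1)])
qed

text \<open>Digits are found from the highest position downwards by repeated subtraction, as there is no division on
  integers. The variable \<open>x1\<close> holds the remainder plus 1, because the test \<open>y \<le> x\<close> must be written
  as \<open>y < x + 1\<close>.\<close>
definition decode :: prog where
  "decode = seq [IAdd ''x1'' ''cd'' ''one'', IAdd ''e'' ''K'' ''z'']
     (Loop (ILess ''z'' ''e'')
       (seq [ISub ''e'' ''e'' ''one'', ILoad ''y'' ''pw'' ''e'', IConst ''c'' 0]
         (Seq (Loop (ILess ''y'' ''x1'')
                (seq [ISub ''x1'' ''x1'' ''y''] (Do (IAdd ''c'' ''c'' ''one''))))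
              (Do (IStore ''d'' ''e'' ''c'')))))"

lemma targets_decode [simp]:
  "targets decode = {IV ''x1'', IV ''e'', IV ''y'', IV ''c'', IA ''d''}"
  by (auto simp: decode_def)

text \<open>Once the positions above \<open>e\<close> are read, \<open>c mod B ^ Suc e\<close> remains; subtracting \<open>B ^ e\<close> as often as
  possible reads off the digit.\<close>
lemma mod_power_Suc_digit: "c mod B ^ Suc e = digit B e c * B ^ e + c mod B ^ e" for B :: nat
  by (simp add: digit_def mod_mult2_eq mult.commute[of _ "B ^ e"] power_Suc2 del: power_Suc)

lemma digit_less: "0 < B \<Longrightarrow> digit B e c < B"
  by (simp add: digit_def)

lemma wp_subtract_loop:
  assumes "0 < Y" and "ivar s ''y'' = Y" "ivar s ''x1'' = k * Y + m + 1" "m < Y"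
    "ivar s ''c'' = 0" "ivar s ''one'' = 1"
    and Q: "\<And>t s'. t \<le> k * 3 + 1 \<Longrightarrow> frame {IV ''x1'', IV ''c''} s s' \<Longrightarrow>
      ivar s' ''x1'' = m + 1 \<Longrightarrow> ivar s' ''c'' = k \<Longrightarrow> Q t s'"
  shows "wp (Loop (ILess ''y'' ''x1'') (seq [ISub ''x1'' ''x1'' ''y''] (Do (IAdd ''c'' ''c'' ''one'')))) Q s"
proof (rule wp_Loop[where N = k and C = 2
      and I = "\<lambda>j s'. ivar s' ''x1'' = (k - j) * Y + m + 1 \<and> ivar s' ''c'' = j"], goal_cases)
  case (2 j s')
  have "(k - j) * Y = (k - Suc j) * Y + Y" using 2(1) by (metis Suc_diff_Suc add.commute mult_Suc)
  then show ?case using 2(3) assms by (simp add: frameD[OF 2(2)])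
next
  case (3 s')
  then show ?case using assms by (simp add: frameD[OF 3(1)])
next
  case (4 t s')
  have "frame {IV ''x1'', IV ''c''} s s'" by (rule frame_mono[OF 4(2)]) simp
  then show ?case using 4(1,3) by (intro Q) simp_all
qed (use assms in simp_all)

lemma wp_decode:
  assumes B: "0 < B" and rdy: "tables_ready B L w K s" and cd: "ivar s ''cd'' = c" "c < B ^ K"
    and Q: "\<And>t s'. t \<le> K * (3 * B + 6) + 3 \<Longrightarrow> frame (targets decode) s s' \<Longrightarrow>
      (\<forall>e<K. iarr s' ''d'' e = digit B e c) \<Longrightarrow> Q t s'"
  shows "wp decode Q s"
  unfolding decode_def wp_seq_Cons seq.simps(1)
proof (rule wp_Loop[where N = K and C = "3 * B + 5"
      and I = "\<lambda>j s'. ivar s' ''e'' = K - j \<and> ivar s' ''x1'' = c mod B ^ (K - j) + 1 \<and>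
         (\<forall>e. K - j \<le> e \<and> e < K \<longrightarrow> iarr s' ''d'' e = digit B e c)"], goal_cases)
  case 1
  then show ?case using rdy cd by (simp add: tables_ready_def)
next
  case (2 j s')
  define e where "e = K - Suc j"
  have e: "K - j = Suc e" "e < K" using 2(1) by (auto simp: e_def)
  note fr = frameD[OF 2(2)]
  have x1: "ivar s' ''x1'' = digit B e c * B ^ e + c mod B ^ e + 1"
    using 2(3) unfolding e mod_power_Suc_digit by simp
  have env: "ivar s' ''one'' = 1" "ivar s' ''z'' = 0" "iarr s' ''pw'' e = B ^ e" "ivar s' ''e'' = Suc e"
    using rdy 2(3) e by (simp_all add: fr tables_ready_def)
  have dB: "digit B e c < B" by (rule digit_less[OF B])
  show ?case
    unfolding wp_seq_Cons seq.simps(1) wp_Seq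
  proof (intro conjI wp_subtract_loop[where Y = "B ^ e" and k = "digit B e c" and m = "c mod B ^ e"], goal_cases)
    case 1
    show ?case using env by simp
  next
    case (8 t s'')
    have "iarr s' ''d'' e' = digit B e' c" if "Suc e \<le> e'" "e' < K" for e'
      using 2(3) e that by simp
    then show ?case unfolding e_def[symmetric] using 8(1,3,4) dB env by (auto simp: frameD[OF 8(2)])
  qed (use env x1 B in \<open>simp_all\<close>)
next
  case (3 s')
  note fr = frameD[OF 3(1)]
  show ?case using rdy 3(2) by (simp add: fr tables_ready_def)
next
  case (4 t s')
  have "frame (targets decode) s (effect (IAdd ''e'' ''K'' ''z'') (effect (IAdd ''x1'' ''cd'' ''one'') s))"
    by (simp add: frame_def)
  moreover have "frame (targets decode) (effect (IAdd ''e'' ''K'' ''z'') (effect (IAdd ''x1'' ''cd'' ''one'') s)) s'"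
    by (rule frame_mono[OF 4(2)]) simp
  ultimately have "frame (targets decode) s s'" by (rule frame_trans)
  then show ?case using 4 by (intro Q) (auto simp: algebra_simps)
qed

definition level_scan :: prog where
  "level_scan = For ''e2'' 0 ''K''
     (seq [ILoad ''x'' ''d'' ''e2'']
       (Branch (ILess ''z'' ''x'')
         (seq [ILoad ''y'' ''lv'' ''e2'']
           (Branch (ILess ''mx'' ''y'') (Do (IAdd ''mx'' ''y'' ''z'')) nop))
         nop))"

lemma targets_level_scan [simp]:
  "targets level_scan = {IV ''e2'', IV ''x'', IV ''y'', IV ''mx'', IV ''nop''}"
  by (auto simp: level_scan_def nop_def)

lemma wp_level_scan:
  assumes rdy: "tables_ready B L w K s" and d: "\<forall>e<K. iarr s ''d'' e = digit B e c"
    and mx: "ivar s ''mx'' = 0"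
    and Q: "\<And>t s'. t \<le> K * 7 + 2 \<Longrightarrow> frame (targets level_scan) s s' \<Longrightarrow>
      ivar s' ''mx'' = top_level B L c K \<Longrightarrow> Q t s'"
  shows "wp level_scan Q s"
  unfolding level_scan_def
proof (rule wp_For[where N = K and C = 5 and I = "\<lambda>j s'. ivar s' ''mx'' = top_level B L c j"], goal_cases)
  case (7 j s')
  note fr = frameD[OF 7(2)]
  have "iarr s' ''d'' j = digit B j c" "iarr s' ''lv'' j = j mod Suc L" "ivar s' ''z'' = 0"
    using rdy d 7(1) by (simp_all add: fr tables_ready_def nop_def)
  then show ?case using 7(3,4) by (simp add: nop_def)
next
  case (8 t s')
  have "frame (targets level_scan) s s'" using 8(2) by (simp add: level_scan_def)
  then show ?case using 8 by (intro Q) auto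
qed (use rdy mx in \<open>simp_all add: tables_ready_def nop_def\<close>)

definition init_table :: prog where
  "init_table = For ''cd'' 0 ''N''
     (Seq decode (seq [IConst ''mx'' 0] (Seq level_scan
       (seq [ROfInt ''x'' ''mx''] (Do (RStore ''V'' ''cd'' ''x''))))))"

lemma targets_init_table [simp]:
  "targets init_table = {IV ''cd'', RV ''x'', RA ''V''} \<union> targets decode \<union> targets level_scan"
  by (auto simp: init_table_def)

lemma wp_init_table:
  assumes B: "0 < B" and rdy: "tables_ready B L w K s" and V: "rarr s ''V'' = (\<lambda>_. 0)"
    and Q: "\<And>t s'. t \<le> B ^ K * (K * (3 * B + 13) + 10) + 2 \<Longrightarrow> frame (targets init_table) s s' \<Longrightarrow>
      rarr s' ''V'' = table B L w K 0 \<Longrightarrow> Q t s'"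
  shows "wp init_table Q s"
  unfolding init_table_def
proof (rule wp_For[where N = "B ^ K" and C = "K * (3 * B + 13) + 8"
      and I = "\<lambda>j s'. rarr s' ''V'' = (\<lambda>c. if c < j then table B L w K 0 c else 0)"], goal_cases)
  case (7 j s1)
  have r1: "tables_ready B L w K s1"
    by (rule tables_ready_frame[OF 7(2) _ rdy]) (simp add: table_locs_def)
  show ?case unfolding wp_Seq
  proof (rule wp_decode[OF B r1, where c = j], goal_cases)
    case (3 t2 s2)
    note f2 = frameD[OF 3(2)]
    have r2: "tables_ready B L w K (effect (IConst ''mx'' 0) s2)"
      using tables_ready_frame[OF 3(2) _ r1] by (simp add: table_locs_def tables_ready_def)
    show ?case unfolding wp_seq_Cons seq.simps(1) wp_Seq
    proof (rule wp_level_scan[OF r2, where c = j], goal_cases)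
      case a: (3 t3 s3)
      note f3 = frameD[OF a(2)]
      have "ivar s3 ''cd'' = j" "rarr s3 ''V'' = rarr s1 ''V''" using 7(3) by (simp_all add: f3 f2)
      then show ?case using 3(1) a(1,3) 7(1,4) by (auto simp: fun_eq_iff algebra_simps)
    qed (use 3(3) in simp_all)
  qed (use 7 in simp_all)
next
  case (8 t s')
  have "frame (targets init_table) s s'" using 8(2) by (rule frame_mono) simp
  moreover have "rarr s' ''V'' = table B L w K 0" using 8(4) by (auto simp: fun_eq_iff)
  ultimately show ?case using 8(1) by (intro Q) (auto simp: algebra_simps)
qed (use rdy V in \<open>simp_all add: tables_ready_def fun_eq_iff\<close>)

definition threshold_scan :: prog where
  "threshold_scan = For ''e2'' 0 ''K''
     (seq [ILoad ''a'' ''inc'' ''e2'', IAdd ''a'' ''cd'' ''a'', RLoad ''ve'' ''V'' ''a'']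
       (Branch (RLess ''ve'' ''vf'') nop
         (seq [ILoad ''a'' ''d'' ''e2'', ROfInt ''y'' ''a'', RLoad ''w'' ''tw'' ''e2'',
               RMul ''y'' ''y'' ''w'', RAdd ''den'' ''den'' ''y'', RMul ''y'' ''y'' ''ve'']
           (Do (RAdd ''num'' ''num'' ''y'')))))"

lemma targets_threshold_scan [simp]:
  "targets threshold_scan =
     {IV ''e2'', IV ''a'', RV ''ve'', IV ''nop'', RV ''y'', RV ''w'', RV ''den'', RV ''num''}"
  by (auto simp: threshold_scan_def nop_def)

lemma wp_threshold_scan:
  fixes V :: "nat \<Rightarrow> real"
  assumes rdy: "tables_ready B L w K s" and d: "\<forall>e<K. iarr s ''d'' e = digit B e c"
    and cd: "ivar s ''cd'' = c" and V: "\<forall>e<K. rarr s ''V'' (c + code_inc B L e) = V (c + code_inc B L e)"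
    and vf: "rvar s ''vf'' = V (c + code_inc B L f)"
    and num: "rvar s ''num'' = V c" and den: "rvar s ''den'' = 1"
    and Q: "\<And>t s'. t \<le> K * 13 + 2 \<Longrightarrow> frame (targets threshold_scan) s s' \<Longrightarrow>
      rvar s' ''num'' / rvar s' ''den'' = threshold_value B L w K V c f \<Longrightarrow> Q t s'"
  shows "wp threshold_scan Q s"
  unfolding threshold_scan_def
proof (rule wp_For[where N = K and C = 11 and I = "\<lambda>j s'.
    rvar s' ''num'' = V c + (\<Sum>e<j. if V (c + code_inc B L e) < V (c + code_inc B L f) then 0
                     else real (digit B e c) * w (e div Suc L) * V (c + code_inc B L e)) \<and>
    rvar s' ''den'' = 1 + (\<Sum>e<j. if V (c + code_inc B L e) < V (c + code_inc B L f) then 0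
                     else real (digit B e c) * w (e div Suc L))"], goal_cases)
  case (7 j s')
  note fr = frameD[OF 7(2)]
  have "iarr s' ''d'' j = digit B j c" "iarr s' ''inc'' j = code_inc B L j" "rarr s' ''tw'' j = w (j div Suc L)"
    "ivar s' ''cd'' = c" "rarr s' ''V'' (c + code_inc B L j) = V (c + code_inc B L j)"
    "rvar s' ''vf'' = V (c + code_inc B L f)"
    using rdy d cd V vf 7(1) by (simp_all add: fr tables_ready_def nop_def)
  then show ?case using 7(3,4) by (simp add: nop_def)
next
  case (8 t s')
  have "frame (targets threshold_scan) s s'" using 8(2) by (rule frame_mono) (auto simp: nop_def)
  then show ?case using 8 by (intro Q) (auto simp: threshold_value_def)
qed (use rdy num den in \<open>simp_all add: tables_ready_def nop_def\<close>)

definition best_scan :: prog where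
  "best_scan = For ''f'' 0 ''K''
     (seq [ILoad ''a'' ''inc'' ''f'', IAdd ''a'' ''cd'' ''a'', RLoad ''vf'' ''V'' ''a'',
           RAdd ''num'' ''v0'' ''z'', RAdd ''den'' ''one'' ''z'']
       (Seq threshold_scan (seq [RDiv ''y'' ''num'' ''den'']
         (Branch (RLess ''x'' ''y'') (Do (RAdd ''x'' ''y'' ''z'')) nop))))"

lemma targets_best_scan [simp]:
  "targets best_scan = {IV ''f'', RV ''vf'', RV ''x''} \<union> targets threshold_scan"
  by (auto simp: best_scan_def nop_def)

lemma wp_best_scan:
  fixes V :: "nat \<Rightarrow> real"
  assumes rdy: "tables_ready B L w K s" and d: "\<forall>e<K. iarr s ''d'' e = digit B e c"
    and cd: "ivar s ''cd'' = c" and V: "\<forall>e<K. rarr s ''V'' (c + code_inc B L e) = V (c + code_inc B L e)"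
    and v0: "rvar s ''v0'' = V c" and x: "rvar s ''x'' = V c"
    and Q: "\<And>t s'. t \<le> K * (K * 13 + 12) + 2 \<Longrightarrow> frame (targets best_scan) s s' \<Longrightarrow>
      rvar s' ''x'' = best_threshold B L w K V c K \<Longrightarrow> Q t s'"
  shows "wp best_scan Q s"
  unfolding best_scan_def
proof (rule wp_For[where N = K and C = "K * 13 + 10"
      and I = "\<lambda>j s'. rvar s' ''x'' = best_threshold B L w K V c j"], goal_cases)
  case (7 j s1)
  note fr = frameD[OF 7(2)]
  let ?s = "effect (RAdd ''den'' ''one'' ''z'') (effect (RAdd ''num'' ''v0'' ''z'')
    (effect (RLoad ''vf'' ''V'' ''a'') (effect (IAdd ''a'' ''cd'' ''a'') (effect (ILoad ''a'' ''inc'' ''f'') s1))))"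
  have r1: "tables_ready B L w K s1"
    by (rule tables_ready_frame[OF 7(2) _ rdy]) (simp add: table_locs_def nop_def)
  then have r1': "tables_ready B L w K ?s" by (simp add: tables_ready_def)
  have env: "\<forall>e<K. iarr s1 ''d'' e = digit B e c" "iarr s1 ''inc'' j = code_inc B L j"
    "ivar s1 ''cd'' = c" "\<forall>e<K. rarr s1 ''V'' (c + code_inc B L e) = V (c + code_inc B L e)"
    "rvar s1 ''v0'' = V c" "rvar s1 ''z'' = 0" "rvar s1 ''one'' = 1" "ivar s1 ''f'' = j"
    "rarr s1 ''V'' (c + code_inc B L j) = V (c + code_inc B L j)"
    using rdy d cd V v0 7(1,3) by (simp_all add: fr tables_ready_def nop_def)
  show ?case unfolding wp_seq_Cons seq.simps(1) wp_Seq
  proof (rule wp_threshold_scan[OF r1', where c = c and V = V and f = j], goal_cases)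
    case a: (7 t2 s2)
    have "rvar s2 ''x'' = best_threshold B L w K V c j" "rvar s2 ''z'' = 0"
      using 7(4) env by (simp_all add: frameD[OF a(2)])
    then show ?case using a(1,3) by (simp add: nop_def)
  qed (use env in simp_all)
next
  case (8 t s')
  have "frame (targets best_scan) s s'" using 8(2) by (rule frame_mono) (auto simp: nop_def)
  then show ?case using 8(1,4) by (intro Q) (simp_all add: algebra_simps)
qed (use rdy x in \<open>simp_all add: tables_ready_def nop_def\<close>)

lemma table_outside: "\<not> c < B ^ K \<Longrightarrow> table B L w K r c = 0"
  by (cases r) simp_all

text \<open>The update is done in place: the entry for \<open>c\<close> depends on entries at \<open>c\<close> or above only, and these still
  hold the values of the previous round.\<close>
definition update_table :: prog where
  "update_table = For ''cd'' 0 ''N''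
     (Seq decode (seq [RLoad ''v0'' ''V'' ''cd'', RAdd ''x'' ''v0'' ''z'']
       (Seq best_scan (Do (RStore ''V'' ''cd'' ''x'')))))"

lemma targets_update_table [simp]:
  "targets update_table = {IV ''cd'', RV ''v0'', RV ''x'', RA ''V''} \<union> targets decode \<union> targets best_scan"
  by (auto simp: update_table_def)

lemma wp_update_table:
  assumes B: "0 < B" and rdy: "tables_ready B L w K s" and V: "rarr s ''V'' = table B L w K r"
    and Q: "\<And>t s'. t \<le> B ^ K * (K * (3 * B + K * 13 + 18) + 10) + 2 \<Longrightarrow> frame (targets update_table) s s' \<Longrightarrow>
      rarr s' ''V'' = table B L w K (Suc r) \<Longrightarrow> Q t s'"
  shows "wp update_table Q s"
  unfolding update_table_def
proof (rule wp_For[where N = "B ^ K" and C = "K * (3 * B + K * 13 + 18) + 8"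
      and I = "\<lambda>j s'. rarr s' ''V'' = (\<lambda>c. if c < j then table B L w K (Suc r) c else table B L w K r c)"], goal_cases)
  case (7 j s1)
  have r1: "tables_ready B L w K s1"
    by (rule tables_ready_frame[OF 7(2) _ rdy]) (simp add: table_locs_def)
  show ?case unfolding wp_Seq
  proof (rule wp_decode[OF B r1, where c = j], goal_cases)
    case (3 t2 s2)
    note f2 = frameD[OF 3(2)]
    have r2: "tables_ready B L w K (effect (RAdd ''x'' ''v0'' ''z'') (effect (RLoad ''v0'' ''V'' ''cd'') s2))"
      using tables_ready_frame[OF 3(2) _ r1] by (simp add: table_locs_def tables_ready_def)
    have env: "ivar s2 ''cd'' = j" "rarr s2 ''V'' = rarr s1 ''V''" "rvar s2 ''z'' = 0"
      using 7(3) r1 by (simp_all add: f2 tables_ready_def)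
    show ?case unfolding wp_seq_Cons seq.simps(1) wp_Seq
    proof (rule wp_best_scan[OF r2, where c = j and V = "table B L w K r"], goal_cases)
      case a: (6 t3 s3)
      have "ivar s3 ''cd'' = j" "rarr s3 ''V'' = rarr s1 ''V''"
        using env by (simp_all add: frameD[OF a(2)])
      then show ?case using 3(1) a(1,3) 7(1,4) by (auto simp: fun_eq_iff algebra_simps)
    qed (use 3(3) env 7(4) in simp_all)
  qed (use 7 in simp_all)
next
  case (8 t s')
  have "frame (targets update_table) s s'" using 8(2) by (rule frame_mono) simp
  moreover have "rarr s' ''V'' = table B L w K (Suc r)"
    using 8(4) table_outside[of _ B K L w r] by (auto simp: fun_eq_iff)
  ultimately show ?case using 8(1) by (intro Q) (auto simp: algebra_simps)
qed (use rdy V in \<open>simp_all add: tables_ready_def fun_eq_iff\<close>)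

section \<open>Programs for types, codes and offers\<close>

definition filled :: "nat \<Rightarrow> nat \<Rightarrow> (nat \<Rightarrow> real) \<Rightarrow> nat \<Rightarrow> mem \<Rightarrow> bool" where
  "filled B L w K s \<longleftrightarrow>
     (\<forall>e<K. iarr s ''pw'' e = B ^ e \<and> iarr s ''inc'' e = code_inc B L e
        \<and> iarr s ''lv'' e = e mod Suc L \<and> rarr s ''tw'' e = w (e div Suc L))"

definition multiply_power :: prog where
  "multiply_power = For ''j'' 0 ''P'' (Do (IAdd ''acc'' ''acc'' ''p''))"

lemma targets_multiply_power [simp]: "targets multiply_power = {IV ''j'', IV ''acc''}"
  by (auto simp: multiply_power_def)

lemma wp_multiply_power:
  assumes "ivar s ''one'' = 1" "ivar s ''P'' = B" "ivar s ''acc'' = 0" "ivar s ''p'' = p"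
    and Q: "\<And>t s'. t \<le> B * 3 + 2 \<Longrightarrow> frame (targets multiply_power) s s' \<Longrightarrow> ivar s' ''acc'' = B * p \<Longrightarrow> Q t s'"
  shows "wp multiply_power Q s"
  unfolding multiply_power_def
proof (rule wp_For[where N = B and C = 1 and I = "\<lambda>j s'. ivar s' ''acc'' = j * p"], goal_cases)
  case (7 j s')
  then show ?case using assms by (simp add: frameD[OF 7(2)])
next
  case (8 t s')
  have "frame (targets multiply_power) s s'" using 8(2) by (simp add: multiply_power_def insert_commute)
  then show ?case using 8(1,4) by (intro Q) auto
qed (use assms in simp_all)

text \<open>Writes the entries of one weight class. The next power of \<open>B\<close> is computed by repeated addition, as
  integer instructions are additive.\<close>
definition fill_class :: prog where
  "fill_class = For ''lev'' 0 ''L1''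
     (seq [RStore ''tw'' ''e'' ''wc'', IStore ''lv'' ''e'' ''lev'', IStore ''pw'' ''e'' ''p'', IConst ''acc'' 0]
       (Seq multiply_power
         (Seq (Branch (ILess ''lev'' ''L'') (Do (ISub ''df'' ''acc'' ''p'')) (Do (IConst ''df'' 0)))
           (seq [IStore ''inc'' ''e'' ''df'', IAdd ''p'' ''acc'' ''z''] (Do (IAdd ''e'' ''e'' ''one''))))))"

lemma targets_fill_class [simp]:
  "targets fill_class = {IV ''lev'', RA ''tw'', IA ''lv'', IA ''pw'', IA ''inc'', IV ''p'', IV ''e'', IV ''df''}
     \<union> targets multiply_power"
  by (auto simp: fill_class_def)

lemma wp_fill_class:
  assumes env: "ivar s ''one'' = 1" "ivar s ''z'' = 0" "ivar s ''P'' = B" "ivar s ''L'' = L" "ivar s ''L1'' = Suc L"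
    and st: "ivar s ''e'' = c * Suc L" "ivar s ''p'' = B ^ (c * Suc L)" "rvar s ''wc'' = w c"
    and fl: "filled B L w (c * Suc L) s"
    and Q: "\<And>t s'. t \<le> Suc L * (B * 3 + 13) + 2 \<Longrightarrow> frame (targets fill_class) s s' \<Longrightarrow>
       ivar s' ''e'' = Suc c * Suc L \<Longrightarrow> ivar s' ''p'' = B ^ (Suc c * Suc L) \<Longrightarrow>
       filled B L w (Suc c * Suc L) s' \<Longrightarrow> Q t s'"
  shows "wp fill_class Q s"
  unfolding fill_class_def
proof (rule wp_For[where N = "Suc L" and C = "B * 3 + 11"
      and I = "\<lambda>j s'. ivar s' ''e'' = c * Suc L + j \<and> ivar s' ''p'' = B ^ (c * Suc L + j) \<and> filled B L w (c * Suc L + j) s'"], goal_cases)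
  case (7 j s1)
  note fr = frameD[OF 7(2)]
  let ?e = "c * Suc L + j"
  let ?s = "effect (IConst ''acc'' 0) (effect (IStore ''pw'' ''e'' ''p'') (effect (IStore ''lv'' ''e'' ''lev'') (effect (RStore ''tw'' ''e'' ''wc'') s1)))"
  have env1: "ivar s1 ''one'' = 1" "ivar s1 ''z'' = 0" "ivar s1 ''P'' = B" "ivar s1 ''L'' = L" "rvar s1 ''wc'' = w c"
    "ivar s1 ''lev'' = j" "ivar s1 ''e'' = ?e" "ivar s1 ''p'' = B ^ ?e"
    using env st 7(3,4) by (simp_all add: fr)
  have fl1: "filled B L w ?e s1" using 7(4) by simp
  have em: "?e mod Suc L = j" "?e div Suc L = c" using 7(1) by (simp_all del: mult_Suc_right)
  show ?case unfolding wp_seq_Cons seq.simps(1) wp_Seq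
  proof (rule wp_multiply_power[where B = B and p = "B ^ ?e"], goal_cases)
    case (5 t2 s2)
    note f2 = frameD[OF 5(2)]
    have s2: "ivar s2 ''one'' = 1" "ivar s2 ''z'' = 0" "ivar s2 ''L'' = L" "ivar s2 ''lev'' = j" "ivar s2 ''e'' = ?e"
      "ivar s2 ''p'' = B ^ ?e" "iarr s2 ''pw'' = (iarr s1 ''pw'')(?e := B ^ ?e)" "iarr s2 ''lv'' = (iarr s1 ''lv'')(?e := j)"
      "rarr s2 ''tw'' = (rarr s1 ''tw'')(?e := w c)" "iarr s2 ''inc'' = iarr s1 ''inc''"
      using env1 by (simp_all add: f2 del: mult_Suc_right)
    have inc: "code_inc B L ?e = (if j < L then B * B ^ ?e - B ^ ?e else 0)"
      unfolding code_inc_def em by simp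
    have fl2: "filled B L w (Suc ?e) s'"
      if "iarr s' ''pw'' = (iarr s1 ''pw'')(?e := B ^ ?e)" "iarr s' ''lv'' = (iarr s1 ''lv'')(?e := j)"
        "rarr s' ''tw'' = (rarr s1 ''tw'')(?e := w c)"
        "iarr s' ''inc'' = (iarr s1 ''inc'')(?e := if j < L then B * B ^ ?e - B ^ ?e else 0)" for s'
      using fl1 em unfolding filled_def that inc[symmetric] by (auto simp: less_Suc_eq simp del: mult_Suc_right)
    show ?case using 5(1,3) s2 by (simp add: fl2 del: mult_Suc_right)
  qed (use env1 in simp_all)
next
  case (8 t s')
  have "frame (targets fill_class) s s'" using 8(2) by (rule frame_mono) auto
  moreover have "c * Suc L + Suc L = Suc c * Suc L" by simp
  ultimately show ?case using 8(1,4) by (intro Q) (simp_all only:, auto simp: algebra_simps)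
qed (use env st fl in \<open>simp_all add: filled_def\<close>)


text \<open>The classes are enumerated until the boundary reaches the largest weight; in this way the
  number of classes needs no logarithm.\<close>
definition build_tables :: prog where
  "build_tables = seq [IConst ''e'' 0, IConst ''p'' 1, ROfInt ''wc'' ''z'', RAdd ''b'' ''eta'' ''z'']
     (Seq fill_class
       (Seq (Loop (RLess ''b'' ''vm'') (seq [RAdd ''wc'' ''b'' ''z'', RMul ''b'' ''b'' ''q''] fill_class))
         (seq [IAdd ''K'' ''e'' ''z''] (Do (IAdd ''N'' ''p'' ''z'')))))"

lemma targets_build_tables [simp]:
  "targets build_tables = {RV ''wc'', RV ''b'', IV ''K'', IV ''N''} \<union> targets fill_class"
  by (auto simp: build_tables_def)

lemma wp_build_tables:
  assumes env: "ivar s ''one'' = 1" "ivar s ''z'' = 0" "ivar s ''P'' = B" "ivar s ''L'' = L" "ivar s ''L1'' = Suc L"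
      "rvar s ''one'' = 1" "rvar s ''z'' = 0" "rvar s ''eta'' = \<eta>" "rvar s ''q'' = q" "rvar s ''vm'' = vm"
    and q: "0 < \<eta>" "1 < q" and k: "k = class_of \<eta> q vm"
    and Q: "\<And>t s'. t \<le> Suc k * (Suc L * (B * 3 + 13) + 5) + 7 \<Longrightarrow> frame (targets build_tables) s s' \<Longrightarrow>
       tables_ready B L (class_weight \<eta> q) (Suc k * Suc L) s' \<Longrightarrow> Q t s'"
  shows "wp build_tables Q s"
  unfolding build_tables_def wp_seq_Cons seq.simps(1) wp_Seq
proof (rule wp_fill_class[where B = B and L = L and c = 0 and w = "class_weight \<eta> q"], goal_cases)
  case (10 t1 s1)
  note f1 = frameD[OF 10(2)]
  let ?b = "seq [RAdd ''wc'' ''b'' ''z'', RMul ''b'' ''b'' ''q''] fill_class"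
  let ?C = "Suc L * (B * 3 + 13) + 4"
  have env1: "ivar s1 ''one'' = 1" "ivar s1 ''z'' = 0" "ivar s1 ''P'' = B" "ivar s1 ''L'' = L" "ivar s1 ''L1'' = Suc L"
      "rvar s1 ''z'' = 0" "rvar s1 ''q'' = q" "rvar s1 ''vm'' = vm" "rvar s1 ''one'' = 1" "rvar s1 ''b'' = \<eta>"
    using env by (simp_all add: f1)
  show ?case
  proof (rule wp_Loop[where N = k and C = ?C and I = "\<lambda>j s'. rvar s' ''b'' = \<eta> * q ^ j \<and>
       ivar s' ''e'' = Suc j * Suc L \<and> ivar s' ''p'' = B ^ (Suc j * Suc L) \<and>
       filled B L (class_weight \<eta> q) (Suc j * Suc L) s'"], goal_cases)
    case 1
    then show ?case using 10 env1 by simp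
  next
    case (2 j s2)
    note f2 = frameD[OF 2(2)]
    have env2: "ivar s2 ''one'' = 1" "ivar s2 ''z'' = 0" "ivar s2 ''P'' = B" "ivar s2 ''L'' = L" "ivar s2 ''L1'' = Suc L"
      "rvar s2 ''z'' = 0" "rvar s2 ''q'' = q" "rvar s2 ''vm'' = vm"
      using env1 by (simp_all add: f2)
    have "wp ?b (\<lambda>t s''. frame (targets ?b) s1 s'' \<longrightarrow> t \<le> ?C \<and> rvar s'' ''b'' = \<eta> * q ^ Suc j \<and>
       ivar s'' ''e'' = Suc (Suc j) * Suc L \<and> ivar s'' ''p'' = B ^ (Suc (Suc j) * Suc L) \<and>
       filled B L (class_weight \<eta> q) (Suc (Suc j) * Suc L) s'') s2"
      unfolding wp_seq_Cons seq.simps(1) wp_Seq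
    proof (rule wp_fill_class[where B = B and L = L and c = "Suc j" and w = "class_weight \<eta> q"], goal_cases)
      case (10 t3 s3)
      note f3 = frameD[OF 10(2)]
      have "rvar s3 ''b'' = \<eta> * q ^ Suc j" using 2(3) env2 by (simp add: f3)
      then show ?case using 10 by (simp del: mult_Suc_right mult_Suc)
    qed (use env2 2(3) in \<open>simp_all add: class_weight_def filled_def del: mult_Suc_right mult_Suc\<close>)
    moreover have "holds (RLess ''b'' ''vm'') s2"
      using env2 2(3) less_class_of[of j \<eta> q vm] 2(1) k by simp
    ultimately show ?case by blast
  next
    case (3 s2)
    note f2 = frameD[OF 3(1)]
    have "rvar s2 ''vm'' = vm" using env1 by (simp add: f2)
    then show ?case using 3(2) class_of_le_power[OF q, of vm] k by simp
  next
    case (4 t2 s2)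
    note f2 = frameD[OF 4(2)]
    have env2: "ivar s2 ''one'' = 1" "ivar s2 ''z'' = 0" "rvar s2 ''one'' = 1" "rvar s2 ''z'' = 0"
      using env1 by (simp_all add: f2)
    have fr: "frame (targets build_tables) s s2"
    proof (rule frame_trans)
      show "frame (targets build_tables) s s1"
        using frame_trans[OF _ frame_mono[OF 10(2)], of "targets build_tables" s] by (simp add: frame_def)
      show "frame (targets build_tables) s1 s2" by (rule frame_mono[OF 4(2)]) auto
    qed
    show ?case unfolding wp_Do
    proof (rule Q, goal_cases)
      case 1
      show ?case using 4(1) 10(1) by (simp add: algebra_simps)
    next
      case 2
      show ?case using fr by (simp add: frame_def)
    next
      case 3
      show ?case using 4(3) env2 by (simp add: tables_ready_def filled_def del: mult_Suc_right mult_Suc)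
    qed
  qed
qed (use env in \<open>simp_all add: class_weight_def filled_def\<close>)

definition classify :: prog where
  "classify = seq [IConst ''code'' 0] (For ''i'' 1 ''n1''
     (seq [RLoad ''x'' ''v'' ''i'', IConst ''t'' 0, RAdd ''b'' ''eta'' ''z'']
       (Seq (Loop (RLess ''b'' ''x'') (seq [IAdd ''t'' ''t'' ''L1''] (Do (RMul ''b'' ''b'' ''q''))))
         (seq [ILoad ''y'' ''load'' ''i'']
           (Seq (Branch (ILess ''y'' ''L'') (Do (IAdd ''t'' ''t'' ''y'')) (Do (IAdd ''t'' ''t'' ''L'')))
             (seq [IStore ''ty'' ''i'' ''t'', ILoad ''y'' ''pw'' ''t''] (Do (IAdd ''code'' ''code'' ''y''))))))))"

lemma targets_classify [simp]:
  "targets classify = {IV ''code'', IV ''i'', IV ''t'', IV ''y'', RV ''x'', RV ''b'', IA ''ty''}"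
  by (auto simp: classify_def)

text \<open>The class of a weight is found by counting boundaries below it; every step skips the types of one class.\<close>
lemma wp_class_loop:
  assumes env: "ivar s ''L1'' = Suc L" "rvar s ''q'' = q" "rvar s ''b'' = \<eta>" "ivar s ''t'' = 0" "rvar s ''x'' = x"
    and q: "0 < \<eta>" "1 < q"
    and Q: "\<And>t s'. t \<le> class_of \<eta> q x * 3 + 1 \<Longrightarrow> frame {IV ''t'', RV ''b''} s s' \<Longrightarrow>
       ivar s' ''t'' = class_of \<eta> q x * Suc L \<Longrightarrow> Q t s'"
  shows "wp (Loop (RLess ''b'' ''x'') (seq [IAdd ''t'' ''t'' ''L1''] (Do (RMul ''b'' ''b'' ''q'')))) Q s"
proof (rule wp_Loop[where N = "class_of \<eta> q x" and C = 2
      and I = "\<lambda>j s'. rvar s' ''b'' = \<eta> * q ^ j \<and> ivar s' ''t'' = j * Suc L"], goal_cases)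
  case (2 j s')
  show ?case using 2(3) env less_class_of[OF 2(1)] by (simp add: frameD[OF 2(2)])
next
  case (3 s')
  show ?case using 3(2) env class_of_le_power[OF q, of x] by (simp add: frameD[OF 3(1)])
next
  case (4 t s')
  have "frame {IV ''t'', RV ''b''} s s'" by (rule frame_mono[OF 4(2)]) simp
  then show ?case using 4(1,3) by (intro Q) simp_all
qed (use env in simp_all)

lemma wp_classify:
  assumes rdy: "tables_ready B L w K s"
    and env: "ivar s ''n1'' = Suc n" "ivar s ''L'' = L" "ivar s ''L1'' = Suc L" "rvar s ''eta'' = \<eta>" "rvar s ''q'' = q"
      "\<And>i. i \<in> {1..n} \<Longrightarrow> rarr s ''v'' i = v i" "iarr s ''load'' = l"
    and cls: "\<And>i. i \<in> {1..n} \<Longrightarrow> class_of \<eta> q (v i) < k" "K = k * Suc L"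
    and q: "0 < \<eta>" "1 < q"
    and Q: "\<And>t s'. t \<le> n * (k * 3 + 12) + 3 \<Longrightarrow> frame (targets classify) s s' \<Longrightarrow>
       \<forall>i\<in>{1..n}. iarr s' ''ty'' i = type_of L (\<lambda>i. class_of \<eta> q (v i)) l i \<Longrightarrow>
       ivar s' ''code'' = code n B L (\<lambda>i. class_of \<eta> q (v i)) l \<Longrightarrow> Q t s'"
  shows "wp classify Q s"
  unfolding classify_def wp_seq_Cons seq.simps(1)
proof (rule wp_For[where N = n and C = "k * 3 + 10"
      and I = "\<lambda>j s'. (\<forall>i\<in>{1..j}. iarr s' ''ty'' i = type_of L (\<lambda>i. class_of \<eta> q (v i)) l i) \<and>
         ivar s' ''code'' = (\<Sum>i\<in>{1..j}. B ^ type_of L (\<lambda>i. class_of \<eta> q (v i)) l i)"], goal_cases)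
  case (7 j s1)
  note f1 = frameD[OF 7(2)]
  let ?i = "Suc j"
  have i: "?i \<in> {1..n}" using 7(1) by simp
  have r1: "tables_ready B L w K s1"
    by (rule tables_ready_frame[OF 7(2)]) (use rdy in \<open>auto simp: table_locs_def tables_ready_def\<close>)
  have env1: "ivar s1 ''L'' = L" "ivar s1 ''L1'' = Suc L" "rvar s1 ''eta'' = \<eta>" "rvar s1 ''q'' = q"
    "rarr s1 ''v'' ?i = v ?i" "iarr s1 ''load'' = l" "ivar s1 ''i'' = ?i" "rvar s1 ''z'' = 0"
    using env i 7(3) r1 by (simp_all add: f1 tables_ready_def)
  let ?t = "type_of L (\<lambda>i. class_of \<eta> q (v i)) l ?i"
  have t: "?t < K" unfolding cls(2) by (rule type_of_less) (rule cls(1)[OF i])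
  have ck: "class_of \<eta> q (v ?i) < k" by (rule cls(1)[OF i])
  have te: "l ?i < L \<Longrightarrow> class_of \<eta> q (v ?i) * Suc L + l ?i = ?t"
    "\<not> l ?i < L \<Longrightarrow> class_of \<eta> q (v ?i) * Suc L + L = ?t"
    by (simp_all add: type_of_def)
  show ?case unfolding wp_seq_Cons seq.simps(1) wp_Seq
  proof (rule wp_class_loop[where L = L and q = q and \<eta> = \<eta> and x = "v ?i"], goal_cases)
    case (8 t2 s2)
    note f2 = frameD[OF 8(2)]
    have e2: "ivar s2 ''L'' = L" "iarr s2 ''load'' = l" "ivar s2 ''i'' = ?i" "iarr s2 ''pw'' ?t = B ^ ?t"
      "iarr s2 ''ty'' = iarr s1 ''ty''" "ivar s2 ''code'' = ivar s1 ''code''"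
      using env1 r1 t by (simp_all add: f2 tables_ready_def)
    show ?case using 8(1,3) 7(4) e2 ck
      by (simp add: te atLeastAtMostSuc_conv del: mult_Suc_right)
  qed (use env1 q in simp_all)
next
  case (8 t s')
  have "frame (targets classify) s s'"
    by (rule frame_trans[OF _ frame_mono[OF 8(2)]]) (auto simp: frame_def)
  then show ?case using 8(1,4) by (intro Q) (auto simp: code_def algebra_simps)
qed (use env rdy in \<open>simp_all add: tables_ready_def\<close>)

definition save_rewards :: prog where
  "save_rewards = For ''i'' 1 ''n1''
     (seq [ILoad ''t'' ''ty'' ''i'', ILoad ''a'' ''inc'' ''t'', IAdd ''a'' ''code'' ''a'', RLoad ''y'' ''V'' ''a'']
       (Do (RStore ''rew'' ''i'' ''y'')))"

lemma targets_save_rewards [simp]: "targets save_rewards = {IV ''i'', IV ''t'', IV ''a'', RV ''y'', RA ''rew''}"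
  by (auto simp: save_rewards_def)

lemma wp_save_rewards:
  assumes rdy: "tables_ready B L w K s" and n1: "ivar s ''n1'' = Suc n"
    and ty: "\<forall>i\<in>{1..n}. iarr s ''ty'' i = ty i \<and> ty i < K" and V: "rarr s ''V'' = V" and c: "ivar s ''code'' = c"
    and Q: "\<And>t s'. t \<le> n * 7 + 2 \<Longrightarrow> frame (targets save_rewards) s s' \<Longrightarrow>
       \<forall>i\<in>{1..n}. rarr s' ''rew'' i = V (c + code_inc B L (ty i)) \<Longrightarrow> Q t s'"
  shows "wp save_rewards Q s"
  unfolding save_rewards_def
proof (rule wp_For[where N = n and C = 5
      and I = "\<lambda>j s'. \<forall>i\<in>{1..j}. rarr s' ''rew'' i = V (c + code_inc B L (ty i))"], goal_cases)
  case (7 j s1)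
  note f1 = frameD[OF 7(2)]
  have "iarr s1 ''ty'' (Suc j) = ty (Suc j)" "iarr s1 ''inc'' (ty (Suc j)) = code_inc B L (ty (Suc j))"
    "rarr s1 ''V'' = V" "ivar s1 ''code'' = c"
    using ty V c rdy 7(1) by (simp_all add: f1 tables_ready_def)
  then show ?case using 7(3,4) by (simp add: atLeastAtMostSuc_conv)
next
  case (8 t s')
  have "frame (targets save_rewards) s s'" by (rule frame_mono[OF 8(2)]) auto
  then show ?case using 8(1,4) by (intro Q) auto
qed (use n1 rdy in \<open>simp_all add: tables_ready_def\<close>)

text \<open>Here \<open>x\<close> is the value of the current state with \<open>r\<close> customers left, while the saved rewards are
  values with \<open>r - 1\<close> customers left.\<close>
definition offer_improving :: prog where
  "offer_improving = For ''i'' 1 ''n1''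
     (seq [RLoad ''y'' ''rew'' ''i'']
       (Branch (RLess ''x'' ''y'')
         (seq [ILoad ''t'' ''ty'' ''i'', RLoad ''y'' ''tw'' ''t'']
           (Branch (RLess ''z'' ''y'') (Do (IStore ''offer'' ''i'' ''one'')) nop))
         nop))"

lemma targets_offer_improving [simp]:
  "targets offer_improving = {IV ''i'', IV ''t'', RV ''y'', IV ''nop'', IA ''offer''}"
  by (auto simp: offer_improving_def nop_def)

lemma wp_offer_improving:
  assumes rdy: "tables_ready B L w K s" and n1: "ivar s ''n1'' = Suc n"
    and ty: "\<forall>i\<in>{1..n}. iarr s ''ty'' i = ty i \<and> ty i < K" and R: "\<forall>i\<in>{1..n}. rarr s ''rew'' i = R i"
    and x: "rvar s ''x'' = x" and off: "iarr s ''offer'' = (\<lambda>_. 0)"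
    and Q: "\<And>t s'. t \<le> n * 8 + 2 \<Longrightarrow>
       \<forall>i\<in>{1..n}. iarr s' ''offer'' i = (if x < R i \<and> 0 < w (ty i div Suc L) then 1 else 0) \<Longrightarrow> Q t s'"
  shows "wp offer_improving Q s"
  unfolding offer_improving_def
proof (rule wp_For[where N = n and C = 6
      and I = "\<lambda>j s'. \<forall>i. iarr s' ''offer'' i = (if i \<in> {1..j} \<and> x < R i \<and> 0 < w (ty i div Suc L) then 1 else 0)"], goal_cases)
  case (7 j s1)
  note f1 = frameD[OF 7(2)]
  have "iarr s1 ''ty'' (Suc j) = ty (Suc j)" "rarr s1 ''tw'' (ty (Suc j)) = w (ty (Suc j) div Suc L)"
    "rarr s1 ''rew'' (Suc j) = R (Suc j)" "rvar s1 ''x'' = x" "rvar s1 ''z'' = 0" "ivar s1 ''one'' = 1"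
    using ty R x rdy 7(1) by (simp_all add: f1 tables_ready_def nop_def)
  then show ?case using 7(3,4) by (auto simp: nop_def le_Suc_eq)
next
  case (8 t s')
  show ?case using 8(1,4) by (intro Q) auto
qed (use n1 rdy off in \<open>simp_all add: tables_ready_def nop_def\<close>)

section \<open>The assortment program\<close>

text \<open>After \<open>r - 1\<close> rounds the values of all possible purchases are saved, and one more round gives the
  value of the current state, with which they are compared.\<close>
definition dp_assort :: prog where
  "dp_assort = Seq build_tables (Seq classify (Seq init_table (Seq (For ''rd'' 1 ''r'' update_table)
     (Seq save_rewards (Seq update_table (seq [RLoad ''x'' ''V'' ''code''] offer_improving))))))"

text \<open>All parameters are bounded by the number \<open>Z = B\<^sup>K\<close> of codes, which makes each round cost \<open>O(Z\<^sup>3)\<close>.\<close>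
lemma dp_time_arith:
  fixes Z :: nat
  assumes "B \<le> Z" "K \<le> Z" "n \<le> Z" "Suc k \<le> Z" "Suc L \<le> Z" "1 \<le> Z" "1 \<le> r"
    and "t1 \<le> Suc k * (Suc L * (B * 3 + 13) + 5) + 7"
      "t2 \<le> n * (Suc k * 3 + 12) + 3"
      "t3 \<le> Z * (K * (3 * B + 13) + 10) + 2"
      "t4 \<le> (r - 1) * (Z * (K * (3 * B + K * 13 + 18) + 10) + 2 + 2) + 2"
      "t5 \<le> n * 7 + 2"
      "t6 \<le> Z * (K * (3 * B + K * 13 + 18) + 10) + 2"
      "t7 \<le> n * 8 + 2"
  shows "t1 + (t2 + (t3 + (t4 + (t5 + (t6 + Suc t7))))) \<le> r * (200 * Z ^ 3)"
proof -
  define W where "W = Z ^ 3"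
  have W: "Z * (Z * Z) = W" by (simp add: W_def power3_eq_cube mult.assoc)
  have Z: "Z * Z \<le> W" "Z \<le> W" "1 \<le> W"
    using assms(6) power_increasing[of 2 3 Z] power_increasing[of 1 3 Z] power_increasing[of 0 3 Z]
    by (simp_all add: W_def power2_eq_square)
  have "B * 3 + 13 \<le> 16 * Z" using assms(1,6) by simp
  then have "Suc L * (B * 3 + 13) \<le> Z * (16 * Z)" using assms(5) by (intro mult_le_mono)
  then have "Suc k * (Suc L * (B * 3 + 13) + 5) \<le> Z * (Z * (16 * Z) + 5)"
    using mult_le_mono[OF assms(4)] by simp
  also have "\<dots> = 16 * W + 5 * Z" by (simp add: distrib_left W[symmetric])
  finally have 1: "t1 \<le> 28 * W" using Z assms by linarith
  have "Suc k * 3 + 12 \<le> 15 * Z" using assms(4,6) by simp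
  then have "n * (Suc k * 3 + 12) \<le> Z * (15 * Z)" using assms by (intro mult_le_mono)
  also have "\<dots> = 15 * (Z * Z)" by simp
  finally have 2: "t2 \<le> 18 * W" using Z assms by linarith
  have "3 * B + 13 \<le> 16 * Z" using assms(1,6) by simp
  then have "K * (3 * B + 13) \<le> Z * (16 * Z)" using assms by (intro mult_le_mono)
  then have "Z * (K * (3 * B + 13) + 10) \<le> Z * (Z * (16 * Z) + 10)" by (intro mult_le_mono2 add_le_mono1)
  also have "\<dots> = 16 * W + 10 * Z" by (simp add: distrib_left W[symmetric])
  finally have 3: "t3 \<le> 28 * W" using Z assms by linarith
  let ?u = "Z * (K * (3 * B + K * 13 + 18) + 10) + 2"
  have "3 * B + K * 13 + 18 \<le> 34 * Z" using assms(1,2,6) by simp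
  then have "K * (3 * B + K * 13 + 18) \<le> Z * (34 * Z)" using assms by (intro mult_le_mono)
  then have "Z * (K * (3 * B + K * 13 + 18) + 10) \<le> Z * (Z * (34 * Z) + 10)" by (intro mult_le_mono2 add_le_mono1)
  also have "\<dots> = 34 * W + 10 * Z" by (simp add: distrib_left W[symmetric])
  finally have u: "?u \<le> 46 * W" using Z by linarith
  have "?u + 2 \<le> 48 * W" using u Z by linarith
  then have "(r - 1) * (?u + 2) \<le> (r - 1) * (48 * W)" by (intro mult_le_mono) auto
  then have 4: "t4 \<le> (r - 1) * (48 * W) + 2 * W" using assms(11) Z by linarith
  have 5: "t5 \<le> 9 * W" "t7 \<le> 10 * W" "t6 \<le> 46 * W" using assms Z u by linarith+
  have "t1 + (t2 + (t3 + (t4 + (t5 + (t6 + Suc t7))))) \<le> (r - 1) * (48 * W) + 142 * W"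
    using 1 2 3 4 5 Z by linarith
  also have "\<dots> \<le> (r - 1) * (200 * W) + 200 * W" by (intro add_le_mono mult_le_mono) auto
  also have "\<dots> = r * (200 * W)" using assms(7) by (cases r) auto
  finally show ?thesis by (simp add: W_def)
qed

lemma wp_dp_assort:
  fixes n r L B :: nat and v :: "nat \<Rightarrow> real" and \<eta> q vm :: real
  defines "k \<equiv> class_of \<eta> q vm"
  defines "u \<equiv> \<lambda>i. class_weight \<eta> q (class_of \<eta> q (v i))"
  assumes n: "1 \<le> n" "n < B" and r: "1 \<le> r"
    and env: "ivar s ''one'' = 1" "ivar s ''z'' = 0" "ivar s ''P'' = B" "ivar s ''L'' = L" "ivar s ''L1'' = Suc L"
      "rvar s ''one'' = 1" "rvar s ''z'' = 0" "rvar s ''eta'' = \<eta>" "rvar s ''q'' = q" "rvar s ''vm'' = vm"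
      "ivar s ''n1'' = Suc n" "ivar s ''r'' = r" "iarr s ''load'' = l"
      "\<And>i. i \<in> {1..n} \<Longrightarrow> rarr s ''v'' i = v i"
      "rarr s ''V'' = (\<lambda>_. 0)" "iarr s ''offer'' = (\<lambda>_. 0)"
    and q: "0 < \<eta>" "1 < q" and v: "\<And>i. i \<in> {1..n} \<Longrightarrow> 0 < v i \<and> v i \<le> vm"
    and Q: "\<And>t s'. t \<le> r * (200 * (B ^ (Suc k * Suc L)) ^ 3) \<Longrightarrow>
       offered n s' = greedy_policy n u (capped_load L n) r l \<Longrightarrow> Q t s'"
  shows "wp dp_assort Q s"
proof -
  let ?w = "class_weight \<eta> q" and ?K = "Suc k * Suc L" and ?cls = "\<lambda>i. class_of \<eta> q (v i)"
  let ?c = "code n B L ?cls l" and ?ty = "type_of L ?cls l"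
  let ?best = "best n u (capped_load L n)"
  have B0: "0 < B" using n by simp
  have cls: "?cls i < Suc k" if "i \<in> {1..n}" for i
    using class_of_mono[OF q, of "v i" vm] v[OF that] by (simp add: k_def)
  have ty: "?ty i < ?K" if "i \<in> {1..n}" for i by (rule type_of_less) (rule cls[OF that])
  have u0: "nonneg_weights n u"
    using class_weight_bounds(1)[OF q] v by (auto simp: nonneg_weights_def u_def)
  have tb: "table B L ?w ?K r' (code n B L ?cls l') = ?best r' l'" for r' l'
    by (rule table_eq_best[OF n(1) _ n(2) u0]) (use cls in \<open>auto simp: u_def\<close>)
  show ?thesis unfolding dp_assort_def wp_Seq
  proof (rule wp_build_tables[OF env(1-10) q k_def[THEN meta_eq_to_obj_eq]], goal_cases)
    case (1 t1 s1)
    note f1 = frameD[OF 1(2)]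
    have e1: "ivar s1 ''L'' = L" "ivar s1 ''L1'' = Suc L" "rvar s1 ''eta'' = \<eta>" "rvar s1 ''q'' = q"
      "ivar s1 ''n1'' = Suc n" "ivar s1 ''r'' = r" "iarr s1 ''load'' = l"
      "\<And>i. i \<in> {1..n} \<Longrightarrow> rarr s1 ''v'' i = v i"
      "rarr s1 ''V'' = (\<lambda>_. 0)" "iarr s1 ''offer'' = (\<lambda>_. 0)"
      using env by (simp_all add: f1)
    show ?case
    proof (rule wp_classify[OF 1(3) e1(5,1-4,8,7) cls refl q], goal_cases)
      case (3 t2 s2)
      note f2 = frameD[OF 3(2)]
      have r2: "tables_ready B L ?w ?K s2"
        by (rule tables_ready_frame[OF 3(2) _ 1(3)]) (simp add: table_locs_def)
      have e2: "ivar s2 ''n1'' = Suc n" "ivar s2 ''r'' = r" "rarr s2 ''V'' = (\<lambda>_. 0)" "iarr s2 ''offer'' = (\<lambda>_. 0)"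
        using e1 by (simp_all add: f2)
      show ?case
      proof (rule wp_init_table[OF B0 r2 e2(3)], goal_cases)
        case a: (1 t3 s3)
        note f3 = frameD[OF a(2)]
        have r3: "tables_ready B L ?w ?K s3"
          by (rule tables_ready_frame[OF a(2) _ r2]) (simp add: table_locs_def)
        let ?U = "B ^ ?K * (?K * (3 * B + ?K * 13 + 18) + 10) + 2"
        show ?case
        proof (rule wp_For[where N = "r - 1" and C = ?U and I = "\<lambda>j s'. rarr s' ''V'' = table B L ?w ?K j"], goal_cases)
          case (7 j s4)
          have "tables_ready B L ?w ?K s4"
            by (rule tables_ready_frame[OF 7(2) _ r3]) (simp add: table_locs_def)
          then show ?case by (rule wp_update_table[OF B0 _ 7(4)]) simp
        next
          case b: (8 t4 s4)
          note f4 = frameD[OF b(2)]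
          have r4: "tables_ready B L ?w ?K s4"
            by (rule tables_ready_frame[OF b(2) _ r3]) (simp add: table_locs_def)
          have e4: "ivar s4 ''n1'' = Suc n" "iarr s4 ''offer'' = (\<lambda>_. 0)" "ivar s4 ''code'' = ?c"
            "\<forall>i\<in>{1..n}. iarr s4 ''ty'' i = ?ty i \<and> ?ty i < ?K"
            using e2 3 ty by (simp_all add: f4 f3)
          show ?case
          proof (rule wp_save_rewards[OF r4 e4(1,4) b(4) e4(3)], goal_cases)
            case c: (1 t5 s5)
            note f5 = frameD[OF c(2)]
            have r5: "tables_ready B L ?w ?K s5"
              by (rule tables_ready_frame[OF c(2) _ r4]) (simp add: table_locs_def)
            have V5: "rarr s5 ''V'' = table B L ?w ?K (r - 1)" using b(4) by (simp add: f5)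
            show ?case
            proof (rule wp_update_table[OF B0 r5 V5], goal_cases)
              case d: (1 t6 s6)
              note f6 = frameD[OF d(2)]
              let ?s = "effect (RLoad ''x'' ''V'' ''code'') s6"
              have r6: "tables_ready B L ?w ?K s6"
                by (rule tables_ready_frame[OF d(2) _ r5]) (simp add: table_locs_def)
              have c6: "ivar s6 ''code'' = ?c" using e4 by (simp add: f6 f5)
              have "tables_ready B L ?w ?K ?s" using r6 by (simp add: tables_ready_def)
              then show ?case unfolding wp_seq_Cons seq.simps(1)
              proof (rule wp_offer_improving[where x = "?best r l" and ty = ?ty
                    and R = "\<lambda>i. ?best (r - 1) (add_choice i l)" and n = n], goal_cases)
                case 1
                then show ?case using e4 by (simp add: f6 f5)
              next
                case 2
                then show ?case using e4 by (simp add: f6 f5)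
              next
                case 3
                have "table B L ?w ?K (r - 1) (?c + code_inc B L (?ty i)) = ?best (r - 1) (add_choice i l)"
                  if "i \<in> {1..n}" for i using tb[of "r - 1" "add_choice i l"] code_add_choice[OF that B0] by simp
                then show ?case using c(3) by (simp add: f6 del: mult_Suc mult_Suc_right)
              next
                case 4
                have "table B L ?w ?K (Suc (r - 1)) ?c = ?best r l" using tb[of r l] r by simp
                then show ?case using d(3) c6 by (simp del: table.simps mult_Suc mult_Suc_right)
              next
                case 5
                then show ?case using e4 by (simp add: f6 f5)
              next
                case e: (6 t7 s7)
                have K: "?K < B ^ ?K" by (rule less_le_trans[OF less_exp power_mono]) (use n in auto)
                have K1: "1 \<le> ?K" by simp
                have BZ: "B \<le> B ^ ?K" using power_increasing[OF K1, of B] B0 by simp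
                have kL: "Suc k \<le> ?K" "Suc L \<le> ?K" by simp_all
                show ?case
                proof (rule Q)
                  show "t1 + (t2 + (t3 + (t4 + (t5 + (t6 + Suc t7))))) \<le> r * (200 * (B ^ ?K) ^ 3)"
                    by (rule dp_time_arith[where B = B and K = ?K and n = n and k = k and L = L])
                      (use K BZ kL n r 1(1) 3(1) a(1) b(1) c(1) d(1) e(1) in linarith)+
                  show "offered n s7 = greedy_policy n u (capped_load L n) r l"
                    using e(2) by (auto simp: offered_def greedy_policy_def u_def split: if_splits)
                qed
              qed
            qed
          qed
        qed (use r3 e2 r a(3) in \<open>simp_all add: tables_ready_def f3\<close>)
      qed
    qed
  qed
qed

primrec top_weight :: "(nat \<Rightarrow> real) \<Rightarrow> nat \<Rightarrow> real" where
  "top_weight v 0 = 0"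
| "top_weight v (Suc j) = (if top_weight v j < v (Suc j) then v (Suc j) else top_weight v j)"

primrec heaviest :: "(nat \<Rightarrow> real) \<Rightarrow> nat \<Rightarrow> nat" where
  "heaviest v 0 = 0"
| "heaviest v (Suc j) = (if top_weight v j < v (Suc j) then Suc j else heaviest v j)"

lemma le_top_weight: "i \<in> {1..j} \<Longrightarrow> v i \<le> top_weight v j"
  by (induction j) (auto simp: le_Suc_eq)

lemma heaviest:
  assumes "\<forall>i\<in>{1..n}. 0 < v i" "1 \<le> n"
  shows "heaviest v n \<in> {1..n}" "v (heaviest v n) = top_weight v n"
proof -
  have "heaviest v j \<in> {1..j} \<and> v (heaviest v j) = top_weight v j"
    if "\<forall>i\<in>{1..j}. 0 < v i" "1 \<le> j" for j
    using that
  proof (induction j)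
    case (Suc j)
    then show ?case by (cases "j = 0") auto
  qed simp
  from this[OF assms] show "heaviest v n \<in> {1..n}" "v (heaviest v n) = top_weight v n" by blast+
qed

definition scan_weights :: prog where
  "scan_weights = seq [IConst ''one'' 1, ROfInt ''one'' ''one'', IAdd ''n1'' ''n'' ''one'']
     (For ''i'' 1 ''n1'' (seq [RLoad ''x'' ''v'' ''i'', RAdd ''tot'' ''tot'' ''x'']
       (Branch (RLess ''vm'' ''x'') (seq [RAdd ''vm'' ''x'' ''z''] (Do (IAdd ''h'' ''i'' ''z''))) nop)))"

lemma targets_scan_weights [simp]:
  "targets scan_weights = {IV ''one'', RV ''one'', IV ''n1'', IV ''i'', RV ''x'', RV ''tot'', RV ''vm'', IV ''h'', IV ''nop''}"
  by (auto simp: scan_weights_def nop_def)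

lemma wp_scan_weights:
  assumes env: "ivar s ''n'' = n" "\<And>i. i \<in> {1..n} \<Longrightarrow> rarr s ''v'' i = v i"
      "rvar s ''tot'' = 0" "rvar s ''vm'' = 0" "ivar s ''h'' = 0" "ivar s ''z'' = 0" "rvar s ''z'' = 0"
    and Q: "\<And>t s'. t \<le> n * 7 + 5 \<Longrightarrow> frame (targets scan_weights) s s' \<Longrightarrow>
       ivar s' ''one'' = 1 \<Longrightarrow> rvar s' ''one'' = 1 \<Longrightarrow> ivar s' ''n1'' = Suc n \<Longrightarrow>
       rvar s' ''tot'' = total_weight v {1..n} \<Longrightarrow> rvar s' ''vm'' = top_weight v n \<Longrightarrow>
       ivar s' ''h'' = heaviest v n \<Longrightarrow> Q t s'"
  shows "wp scan_weights Q s"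
  unfolding scan_weights_def wp_seq_Cons seq.simps(1)
proof (rule wp_For[where N = n and C = 5 and I = "\<lambda>j s'. rvar s' ''tot'' = total_weight v {1..j} \<and>
     rvar s' ''vm'' = top_weight v j \<and> ivar s' ''h'' = heaviest v j"], goal_cases)
  case (7 j s1)
  note f1 = frameD[OF 7(2)]
  have "rarr s1 ''v'' (Suc j) = v (Suc j)" "ivar s1 ''z'' = 0" "rvar s1 ''z'' = 0"
    using env 7(1) by (simp_all add: f1 nop_def)
  then show ?case using 7(3,4) by (simp add: nop_def total_weight_def)
next
  case (8 t s')
  note f = frameD[OF 8(2)]
  have "frame (targets scan_weights) s s'"
    by (rule frame_trans[OF _ frame_mono[OF 8(2)]]) (auto simp: frame_def nop_def)
  moreover have "ivar s' ''one'' = 1" "rvar s' ''one'' = 1" "ivar s' ''n1'' = Suc n"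
    using env by (simp_all add: f nop_def)
  ultimately show ?case using 8(1,4) by (intro Q) auto
qed (use env in \<open>simp_all add: total_weight_def nop_def\<close>)

definition bit_length :: "nat \<Rightarrow> nat" where
  "bit_length n = (LEAST g. n < 2 ^ g)"

lemma less_bit_length: "n < 2 ^ bit_length n"
  unfolding bit_length_def by (rule LeastI[of _ n]) (rule less_exp)

lemma bit_length_le: "g < bit_length n \<Longrightarrow> 2 ^ g \<le> n"
  unfolding bit_length_def using not_less_Least by fastforce

text \<open>The cap is a multiple of \<open>m\<^sup>2 log n\<close>, with the integer bit length for the logarithm.\<close>
definition level_cap :: "nat \<Rightarrow> nat \<Rightarrow> nat" where
  "level_cap m n = 16 * m * m * Suc (bit_length n)"

definition compute_cap :: "nat \<Rightarrow> prog" where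
  "compute_cap m = seq [IConst ''P'' 1, IConst ''L'' (16 * m * m), IConst ''kp'' (16 * m * m)]
     (Loop (ILess ''P'' ''n1'') (seq [IAdd ''P'' ''P'' ''P''] (Do (IAdd ''L'' ''L'' ''kp''))))"

lemma targets_compute_cap [simp]: "targets (compute_cap m) = {IV ''P'', IV ''L'', IV ''kp''}"
  by (auto simp: compute_cap_def)

lemma wp_compute_cap:
  assumes n1: "ivar s ''n1'' = Suc n"
    and Q: "\<And>t s'. t \<le> bit_length n * 3 + 4 \<Longrightarrow> frame (targets (compute_cap m)) s s' \<Longrightarrow>
       ivar s' ''P'' = 2 ^ bit_length n \<Longrightarrow> ivar s' ''L'' = level_cap m n \<Longrightarrow> Q t s'"
  shows "wp (compute_cap m) Q s"
  unfolding compute_cap_def wp_seq_Cons seq.simps(1)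
proof (rule wp_Loop[where N = "bit_length n" and C = 2
      and I = "\<lambda>j s'. ivar s' ''P'' = 2 ^ j \<and> ivar s' ''L'' = 16 * m * m * Suc j"], goal_cases)
  case (2 j s1)
  show ?case using 2(3) n1 bit_length_le[OF 2(1)] by (simp add: frameD[OF 2(2)])
next
  case (3 s1)
  show ?case using 3(2) n1 less_bit_length[of n] by (simp add: frameD[OF 3(1)])
next
  case (4 t s')
  have "frame (targets (compute_cap m)) s s'"
    by (rule frame_trans[OF _ frame_mono[OF 4(2)]]) (auto simp: frame_def)
  then show ?case using 4(1,3) by (intro Q) (auto simp: level_cap_def)
qed (use n1 in simp_all)

definition offer_all :: prog where
  "offer_all = For ''i'' 1 ''n1'' (Do (IStore ''offer'' ''i'' ''one''))"

lemma wp_offer_all: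
  assumes "ivar s ''n1'' = Suc n" "ivar s ''one'' = 1"
    and Q: "\<And>t s'. t \<le> n * 3 + 2 \<Longrightarrow> offered n s' = {1..n} \<Longrightarrow> Q t s'"
  shows "wp offer_all Q s"
  unfolding offer_all_def
proof (rule wp_For[where N = n and C = 1 and I = "\<lambda>j s'. \<forall>i\<in>{1..j}. iarr s' ''offer'' i = 1"], goal_cases)
  case (7 j s1)
  have "ivar s1 ''one'' = 1" using assms by (simp add: frameD[OF 7(2)])
  then show ?case using 7(3,4) by (simp add: atLeastAtMostSuc_conv)
next
  case (8 t s')
  show ?case using 8(1,4) by (intro Q) (auto simp: offered_def)
qed (use assms in simp_all)

text \<open>Dropping products of weights up to \<open>1 / (4 m\<^sup>2 n T)\<close> loses at most \<open>1 / (4 m\<^sup>2)\<close> over all products and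
  customers.\<close>
definition mesh_start :: "nat \<Rightarrow> nat \<Rightarrow> nat \<Rightarrow> real" where
  "mesh_start m n T = 1 / (real (4 * m * m) * real n * real T)"

definition mesh_ratio :: "nat \<Rightarrow> nat \<Rightarrow> real" where
  "mesh_ratio m n = 1 + 1 / (real m * real (level_cap m n))"

definition rounded_weight :: "nat \<Rightarrow> nat \<Rightarrow> nat \<Rightarrow> (nat \<Rightarrow> real) \<Rightarrow> nat \<Rightarrow> real" where
  "rounded_weight m n T v i =
     class_weight (mesh_start m n T) (mesh_ratio m n) (class_of (mesh_start m n T) (mesh_ratio m n) (v i))"

text \<open>The first condition says that the heaviest product, offered alone to everyone, is bought at least
  \<open>level_cap m n / 4\<close> times on average; it is cleared of denominators.\<close>
definition heaviest_suffices :: "nat \<Rightarrow> nat \<Rightarrow> nat \<Rightarrow> (nat \<Rightarrow> real) \<Rightarrow> bool" where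
  "heaviest_suffices m n T v \<longleftrightarrow>
     (1 + top_weight v n) * real (level_cap m n) \<le> 4 * real T * top_weight v n \<or> real m \<le> top_weight v n"

text \<open>For a single product, offering it is optimal; separating this case keeps the running time
  bounded by a constant that is independent of \<open>m\<close>.\<close>
definition approx_policy :: "nat \<Rightarrow> nat \<Rightarrow> nat \<Rightarrow> (nat \<Rightarrow> real) \<Rightarrow> policy" where
  "approx_policy m n T v r l =
     (if n = 1 \<or> heaviest_suffices m n T v then {heaviest v n}
      else if real m * total_weight v {1..n} \<le> 1 then {1..n}
      else greedy_policy n (rounded_weight m n T v) (capped_load (level_cap m n) n) r l)"

definition choose_regime :: prog where
  "choose_regime = Branch (RLess ''a'' ''b'')
     (Branch (RLess ''vm'' ''rm'')
       (Branch (RLess ''one'' ''mt'') dp_assort offer_all)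
       (Do (IStore ''offer'' ''h'' ''one'')))
     (Do (IStore ''offer'' ''h'' ''one''))"

lemma offered_single:
  assumes "h \<in> {1..n}" "ivar s ''h'' = h" "ivar s ''one'' = 1" "iarr s ''offer'' = (\<lambda>_. 0)"
  shows "offered n (effect (IStore ''offer'' ''h'' ''one'') s) = {h}"
  using assms by (auto simp: offered_def)

definition serving_time :: "nat \<Rightarrow> nat \<Rightarrow> nat \<Rightarrow> (nat \<Rightarrow> real) \<Rightarrow> nat \<Rightarrow> nat" where
  "serving_time m n T v r =
     (if heaviest_suffices m n T v \<or> real m * total_weight v {1..n} \<le> 1 then 0
      else r * (200 * ((2 ^ bit_length n) ^
        (Suc (class_of (mesh_start m n T) (mesh_ratio m n) (top_weight v n)) * Suc (level_cap m n))) ^ 3))"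

lemma wp_choose_regime:
  assumes n: "1 < n" and T: "1 \<le> T" and m: "1 \<le> m" and r: "1 \<le> r" and v: "\<forall>i\<in>{1..n}. 0 < v i"
    and env: "ivar s ''one'' = 1" "ivar s ''z'' = 0" "ivar s ''P'' = 2 ^ bit_length n" "ivar s ''L'' = level_cap m n"
      "ivar s ''L1'' = Suc (level_cap m n)" "rvar s ''one'' = 1" "rvar s ''z'' = 0"
      "rvar s ''eta'' = mesh_start m n T" "rvar s ''q'' = mesh_ratio m n"
      "rvar s ''vm'' = top_weight v n" "ivar s ''n1'' = Suc n"
      "ivar s ''r'' = r" "iarr s ''load'' = l" "\<And>i. i \<in> {1..n} \<Longrightarrow> rarr s ''v'' i = v i"
      "rarr s ''V'' = (\<lambda>_. 0)" "iarr s ''offer'' = (\<lambda>_. 0)"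
    and cmp: "rvar s ''a'' = 4 * real T * top_weight v n" "rvar s ''b'' = (1 + top_weight v n) * real (level_cap m n)"
      "rvar s ''rm'' = real m" "rvar s ''mt'' = real m * total_weight v {1..n}" "ivar s ''h'' = heaviest v n"
    and Q: "\<And>t s'. t \<le> n * 3 + 5 + serving_time m n T v r \<Longrightarrow>
       offered n s' = approx_policy m n T v r l \<Longrightarrow> Q t s'"
  shows "wp choose_regime Q s"
proof -
  have h: "heaviest v n \<in> {1..n}" using heaviest(1)[OF v] n by simp
  note off = offered_single[OF h cmp(5) env(1,16)]
  have "0 < m" "0 < level_cap m n" using m by (simp_all add: level_cap_def)
  then have cap0: "0 < real m * real (level_cap m n)" by simp
  have q: "0 < mesh_start m n T" "1 < mesh_ratio m n"
    using m n T cap0 by (auto simp: mesh_start_def mesh_ratio_def)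
  have holds: "holds (RLess ''a'' ''b'') s \<and> holds (RLess ''vm'' ''rm'') s \<longleftrightarrow> \<not> heaviest_suffices m n T v"
    "holds (RLess ''one'' ''mt'') s \<longleftrightarrow> \<not> real m * total_weight v {1..n} \<le> 1"
    unfolding holds.simps env cmp heaviest_suffices_def by auto
  consider (heaviest) "heaviest_suffices m n T v"
    | (light) "\<not> heaviest_suffices m n T v" "real m * total_weight v {1..n} \<le> 1"
    | (dp) "\<not> heaviest_suffices m n T v" "\<not> real m * total_weight v {1..n} \<le> 1" by blast
  then show ?thesis
  proof cases
    case heaviest
    then have ap: "approx_policy m n T v r l = {heaviest v n}" by (simp add: approx_policy_def)
    have "Q t (effect (IStore ''offer'' ''h'' ''one'') s)" if "t \<le> 3" for t
      by (rule Q) (use that off ap heaviest in simp_all)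
    then show ?thesis using holds(1) heaviest unfolding choose_regime_def wp_Branch wp_Do by simp
  next
    case light
    have "wp offer_all (\<lambda>t. Q (Suc (Suc (Suc t)))) s"
      by (rule wp_offer_all[OF env(11,1)], rule Q) (use n light in \<open>simp_all add: approx_policy_def\<close>)
    then show ?thesis using holds light unfolding choose_regime_def wp_Branch by simp
  next
    case dp
    have ap: "approx_policy m n T v r l = greedy_policy n (\<lambda>i. class_weight (mesh_start m n T) (mesh_ratio m n)
        (class_of (mesh_start m n T) (mesh_ratio m n) (v i))) (capped_load (level_cap m n) n) r l"
      using n dp by (simp add: approx_policy_def rounded_weight_def[abs_def])
    have "wp dp_assort (\<lambda>t. Q (Suc (Suc (Suc t)))) s"
    proof (rule wp_dp_assort[OF less_imp_le[OF n] less_bit_length r env], goal_cases)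
      case (5 t s')
      then show ?case unfolding ap[symmetric] by (intro Q) (use dp in \<open>simp_all add: serving_time_def\<close>)
    qed (use q v le_top_weight in blast)+
    then show ?thesis using holds dp unfolding choose_regime_def wp_Branch by simp
  qed
qed

definition assort_prog :: "nat \<Rightarrow> prog" where
  "assort_prog m = Seq scan_weights (Branch (ILess ''one'' ''n'')
     (Seq (compute_cap m)
       (seq [ROfInt ''rT'' ''T'', ROfInt ''rL'' ''L'', IConst ''c'' 4, ROfInt ''a'' ''c'', RMul ''a'' ''a'' ''rT'',
             RMul ''a'' ''a'' ''vm'', RAdd ''b'' ''one'' ''vm'', RMul ''b'' ''b'' ''rL'',
             IConst ''c'' m, ROfInt ''rm'' ''c'', RMul ''mt'' ''rm'' ''tot'',
             IConst ''c'' (4 * m * m), ROfInt ''x'' ''c'', ROfInt ''y'' ''n'', RMul ''x'' ''x'' ''y'',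
             RMul ''x'' ''x'' ''rT'', RDiv ''eta'' ''one'' ''x'', RMul ''x'' ''rm'' ''rL'',
             RDiv ''x'' ''one'' ''x'', RAdd ''q'' ''one'' ''x'', IAdd ''L1'' ''L'' ''one'']
         choose_regime))
     (Do (IStore ''offer'' ''h'' ''one'')))"

theorem wp_assort_prog:
  assumes n: "1 \<le> n" and T: "1 \<le> T" and m: "1 \<le> m" and r: "1 \<le> r"
    and v: "\<forall>i\<in>{1..n}. 0 < v i"
    and env: "ivar s ''n'' = n" "ivar s ''T'' = T" "ivar s ''r'' = r" "\<And>i. i \<in> {1..n} \<Longrightarrow> rarr s ''v'' i = v i"
      "iarr s ''load'' = l" "rvar s = (\<lambda>_. 0)" "ivar s ''z'' = 0" "ivar s ''h'' = 0"
      "rarr s ''V'' = (\<lambda>_. 0)" "iarr s ''offer'' = (\<lambda>_. 0)"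
  shows "wp (assort_prog m) (\<lambda>t s'. offered n s' = approx_policy m n T v r l \<and>
      t \<le> n * 10 + 40 + (if n = 1 then 0 else bit_length n * 3 + serving_time m n T v r)) s"
  unfolding assort_prog_def wp_Seq
proof (rule wp_scan_weights[where n = n and v = v], goal_cases)
  case (8 t1 s1)
  note f1 = frameD[OF 8(2)]
  have h: "heaviest v n \<in> {1..n}" using heaviest(1)[OF v n] .
  have e1: "ivar s1 ''n'' = n" "iarr s1 ''offer'' = (\<lambda>_. 0)" "ivar s1 ''T'' = T" "ivar s1 ''z'' = 0" "rvar s1 ''z'' = 0"
    "ivar s1 ''r'' = r" "iarr s1 ''load'' = l" "rarr s1 ''V'' = (\<lambda>_. 0)" "\<And>i. i \<in> {1..n} \<Longrightarrow> rarr s1 ''v'' i = v i"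
    using env by (simp_all add: f1)
  show ?case
  proof (cases "n = 1")
    case True
    then have hold: "\<not> holds (ILess ''one'' ''n'') s1" using 8 e1 by simp
    show ?thesis unfolding wp_Branch if_not_P[OF hold] wp_Do offered_single[OF h 8(8) 8(3) e1(2)]
      using True 8(1) by (simp add: approx_policy_def)
  next
    case False
    then have n2: "1 < n" using n by simp
    then have hold: "holds (ILess ''one'' ''n'') s1" using 8 e1 by simp
    show ?thesis unfolding wp_Branch if_P[OF hold] wp_Seq
    proof (rule wp_compute_cap[where n = n], goal_cases)
      case a: (2 t2 s2)
      note f2 = frameD[OF a(2)]
      have e2: "ivar s2 ''n'' = n" "iarr s2 ''offer'' = (\<lambda>_. 0)" "ivar s2 ''T'' = T" "ivar s2 ''z'' = 0" "rvar s2 ''z'' = 0"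
        "ivar s2 ''one'' = 1" "rvar s2 ''one'' = 1" "rvar s2 ''vm'' = top_weight v n" "rvar s2 ''tot'' = total_weight v {1..n}"
        "ivar s2 ''h'' = heaviest v n" "ivar s2 ''n1'' = Suc n" "ivar s2 ''r'' = r" "iarr s2 ''load'' = l"
        "rarr s2 ''V'' = (\<lambda>_. 0)" "\<And>i. i \<in> {1..n} \<Longrightarrow> rarr s2 ''v'' i = v i"
        using 8 e1 by (simp_all add: f2)
      show ?case unfolding wp_seq_Cons seq.simps(1)
      proof (rule wp_choose_regime[OF n2 T m r v, where l = l], goal_cases)
        case b: (22 t3 s3)
        show ?case unfolding if_not_P[OF False]
          by (intro conjI, rule b(2)) (use b(1) 8(1) a(1) in linarith)
      qed (use e2 a(3,4) in \<open>simp_all add: mesh_start_def mesh_ratio_def\<close>)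
    qed (use 8 in simp)
  qed
qed (use env in simp_all)

section \<open>Size of the parameters\<close>

lemma two_pow_bit_length_le: "1 \<le> n \<Longrightarrow> 2 ^ bit_length n \<le> 2 * n"
  using bit_length_le[of "bit_length n - 1" n] less_bit_length[of n]
  by (cases "bit_length n") auto

lemma bit_length_le_self: "bit_length n \<le> n"
  using bit_length_le[of n n] less_exp[of n] by (meson not_le)

lemma Suc_bit_length_le_ln:
  assumes n: "2 \<le> n"
  shows "real (Suc (bit_length n)) \<le> 5 * ln (real n)"
proof -
  have l2: "2 / 3 \<le> ln (2::real)" using ln2_ge_two_thirds .
  have "ln (2::real) \<le> ln (real n)" using n by simp
  have "(2::nat) ^ bit_length n \<le> n * n"
    using two_pow_bit_length_le[of n] n by (meson le_trans mult_le_mono1 one_le_numeral order_trans)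
  then have "(2::real) ^ bit_length n \<le> real n * real n"
    by (metis of_nat_le_iff of_nat_mult of_nat_numeral of_nat_power)
  then have "ln ((2::real) ^ bit_length n) \<le> ln (real n * real n)" using n by (subst ln_le_cancel_iff) auto
  then have "real (bit_length n) * ln 2 \<le> 2 * ln (real n)" using n by (simp add: ln_realpow ln_mult)
  moreover have "real (bit_length n) * (2 / 3) \<le> real (bit_length n) * ln 2" using l2 by (intro mult_left_mono) auto
  ultimately show ?thesis using l2 \<open>ln (2::real) \<le> ln (real n)\<close> by simp
qed

locale instance_bounds =
  fixes m n T :: nat and v :: "nat \<Rightarrow> real"
  assumes m: "2 \<le> m" and n: "1 \<le> n" and T: "1 \<le> T" and v: "\<forall>i\<in>{1..n}. 0 < v i"
begin

abbreviation "L \<equiv> level_cap m n"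
abbreviation "vm \<equiv> top_weight v n"
abbreviation "a \<equiv> m * m * Suc (bit_length n)"

lemma vm: "0 < vm" "\<And>i. i \<in> {1..n} \<Longrightarrow> v i \<le> vm"
  using heaviest[OF v n] v le_top_weight by force+

lemma nonneg: "nonneg_weights n v"
  using v by (auto simp: nonneg_weights_def less_imp_le)

lemma L_eq: "L = 16 * a"
  by (simp add: level_cap_def)

text \<open>The parameters are compared through powers of 2 whose exponents are multiples of \<open>a\<close>, a
  sixteenth of the cap.\<close>
lemma a_bounds: "4 \<le> a" "m \<le> 2 ^ a" "n \<le> 2 ^ a" "bit_length n \<le> a"
proof -
  have mm: "4 \<le> m * m" using mult_le_mono[OF m m] by simp
  have "4 * 1 \<le> m * m * Suc (bit_length n)" using mm by (intro mult_le_mono) auto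
  then show "4 \<le> a" by simp
  have "m * 1 \<le> m * (m * Suc (bit_length n))" using m by (intro mult_le_mono) auto
  then have "m \<le> a" by (simp only: mult_1_right mult.assoc)
  then show "m \<le> 2 ^ a" using less_exp[of a] by linarith
  have "1 * Suc (bit_length n) \<le> m * m * Suc (bit_length n)" using mm by (intro mult_le_mono1) linarith
  then show b: "bit_length n \<le> a" by simp
  have "n \<le> 2 ^ bit_length n" using less_bit_length[of n] by simp
  also have "\<dots> \<le> 2 ^ a" using b by (rule power_increasing) simp
  finally show "n \<le> 2 ^ a" .
qed

lemma L_pos: "1 \<le> L"
  using a_bounds(1) unfolding L_eq by linarith

end

locale dp_instance = instance_bounds +
  assumes short: "\<not> heaviest_suffices m n T v" and heavy: "\<not> real m * total_weight v {1..n} \<le> 1"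
begin

lemma heaviest_insufficient: "4 * real T * vm < (1 + vm) * real L" "vm < real m"
  using short by (auto simp: heaviest_suffices_def)

text \<open>The total weight exceeds \<open>1 / m\<close> and is at most \<open>n vm\<close>, so \<open>1 / vm < m n\<close>, while \<open>T\<close> is below
  \<open>(1 + 1 / vm) L / 4\<close>.\<close>
lemma T_le: "T \<le> L * m * n"
proof -
  have "total_weight v {1..n} \<le> (\<Sum>i\<in>{1..n}. vm)"
    unfolding total_weight_def using vm by (intro sum_mono) auto
  then have "real m * total_weight v {1..n} \<le> real m * (real n * vm)" by (intro mult_left_mono) auto
  then have "1 < real m * (real n * vm)" using heavy by linarith
  then have "(1 + vm) * real L \<le> (real m * (real n * vm) + vm) * real L" by (intro mult_right_mono) auto
  then have "4 * real T * vm < (real m * (real n * vm) + vm) * real L" using heaviest_insufficient(1) by linarith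
  also have "\<dots> = (real m * real n + 1) * real L * vm" by (simp add: algebra_simps)
  finally have 1: "4 * real T < (real m * real n + 1) * real L" using vm(1) by simp
  have "1 * 1 \<le> real m * real n" using m n by (intro mult_mono) auto
  then have "(real m * real n + 1) * real L \<le> (2 * (real m * real n)) * real L" by (intro mult_right_mono) auto
  then have "4 * real T < 2 * (real m * real n * real L)" using 1 by simp
  then have "real T \<le> real (L * m * n)" by (simp add: mult_ac)
  then show ?thesis by (simp only: of_nat_le_iff)
qed

lemma T_le_power: "T \<le> 2 ^ (4 * a)"
proof -
  have "a \<le> 2 ^ a" using less_exp[of a] by linarith
  moreover have "(2::nat) ^ 4 \<le> 2 ^ a" using a_bounds(1) by (rule power_increasing) simp
  ultimately have "L \<le> 2 ^ a * 2 ^ a" unfolding L_eq by (intro mult_le_mono) auto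
  then have "L * m * n \<le> 2 ^ a * 2 ^ a * 2 ^ a * 2 ^ a" using a_bounds by (intro mult_le_mono) auto
  also have "\<dots> = 2 ^ (4 * a)" by (simp add: power_add[symmetric])
  finally show ?thesis using T_le by linarith
qed

lemma harm_T_le: "harm T \<le> real L"
proof -
  have "harm T - ln (real T) \<le> (harm 1 - ln (of_nat 1) :: real)"
    using euler_mascheroni_sequence_decreasing[of 1 T] T by simp
  then have "harm T \<le> 1 + ln (real T)" by (simp add: harm_def)
  moreover have "ln (real T) \<le> ln ((2::real) ^ (4 * a))"
    using T T_le_power by (subst ln_le_cancel_iff) (auto simp flip: of_nat_le_iff)
  moreover have "ln ((2::real) ^ (4 * a)) = real (4 * a) * ln 2" by (simp add: ln_realpow)
  moreover have "real (4 * a) * ln 2 \<le> real (4 * a) * 1"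
    using ln_2_less_1 by (intro mult_left_mono) auto
  moreover have "1 + real (4 * a) \<le> real L" unfolding L_eq using a_bounds(1) by linarith
  ultimately show ?thesis by linarith
qed

text \<open>By Bernoulli's inequality \<open>m L\<close> classes at least double the weight, and the ratio of the largest weight to
  the smallest class boundary is at most \<open>2\<^sup>L\<close>.\<close>
lemma class_le: "class_of (mesh_start m n T) (mesh_ratio m n) vm \<le> m * L * L"
proof (rule class_of_le)
  have D: "0 < real (4 * m * m) * real n * real T" using m n T by simp
  have "(4 * m * m) * n * T * m \<le> (2 ^ a * 2 ^ a * 2 ^ a) * 2 ^ a * 2 ^ (4 * a) * 2 ^ a"
    using a_bounds T_le_power power_increasing[OF a_bounds(1), of "2::nat"] by (intro mult_le_mono) auto
  also have "\<dots> = 2 ^ (9 * a)" by (simp add: power_add[symmetric])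
  also have "\<dots> \<le> 2 ^ L" unfolding L_eq by (intro power_increasing) auto
  finally have "real ((4 * m * m) * n * T * m) \<le> real (2 ^ L)" by (simp only: of_nat_le_iff)
  then have 1: "real m * (real (4 * m * m) * real n * real T) \<le> 2 ^ L" by (simp add: mult_ac)
  have N: "0 < m * L" using m L_pos by simp
  have "1 + real (m * L) * (1 / (real m * real L)) \<le> (1 + 1 / (real m * real L)) ^ (m * L)"
    by (rule Bernoulli_inequality) (smt (verit) divide_nonneg_nonneg mult_nonneg_nonneg of_nat_0_le_iff)
  then have "2 \<le> mesh_ratio m n ^ (m * L)" using N by (simp add: mesh_ratio_def)
  then have "2 ^ L \<le> (mesh_ratio m n ^ (m * L)) ^ L" by (rule power_mono) simp
  also have "\<dots> = mesh_ratio m n ^ (m * L * L)" by (simp add: power_mult)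
  finally have 2: "2 ^ L \<le> mesh_ratio m n ^ (m * L * L)" .
  have "vm * (real (4 * m * m) * real n * real T) \<le> real m * (real (4 * m * m) * real n * real T)"
    using heaviest_insufficient(2) D by (intro mult_right_mono) auto
  then have "vm * (real (4 * m * m) * real n * real T) \<le> mesh_ratio m n ^ (m * L * L)" using 1 2 by linarith
  then show "vm \<le> mesh_start m n T * mesh_ratio m n ^ (m * L * L)"
    using D by (simp add: mesh_start_def pos_le_divide_eq del: of_nat_mult)
qed

text \<open>The expected load \<open>T p\<close> of the heaviest product offered alone is below \<open>L / 4\<close>, and the moment of base 2 grows only like
  \<open>exp (T p)\<close>, which leaves room for the polynomial factors.\<close>
lemma cap_suffices: "(1 + vm / (1 + vm)) ^ T * real n * (4 * real m ^ 2) \<le> 2 ^ L"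
proof -
  have p: "0 \<le> vm / (1 + vm)" using vm(1) by simp
  have "4 * (real T * (vm / (1 + vm))) \<le> real L"
    using heaviest_insufficient(1) vm(1) by (simp add: field_simps)
  then have Tp: "real T * (vm / (1 + vm)) \<le> real (4 * a)" by (simp add: L_eq)
  have "(1 + vm / (1 + vm)) ^ T \<le> exp (vm / (1 + vm)) ^ T" using p by (intro power_mono) auto
  also have "\<dots> = exp (real T * (vm / (1 + vm)))" by (simp only: exp_of_nat_mult)
  also have "\<dots> \<le> exp (real (4 * a))" using Tp by simp
  also have "\<dots> = (exp 1 ^ 4) ^ a" by (metis exp_of_nat_mult mult.right_neutral power_mult)
  also have "\<dots> \<le> (3 ^ 4) ^ a" using exp_le by (intro power_mono) auto
  also have "\<dots> \<le> (2 ^ 7) ^ a" by (intro power_mono) auto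
  finally have 1: "(1 + vm / (1 + vm)) ^ T \<le> 2 ^ (7 * a)" unfolding power_mult .
  have 2: "real n \<le> 2 ^ a" using a_bounds(3) by (metis of_nat_le_iff of_nat_numeral of_nat_power)
  have "4 * m\<^sup>2 \<le> 2 ^ a * (2 ^ a * 2 ^ a)" unfolding power2_eq_square
    using a_bounds power_increasing[OF a_bounds(1), of "2::nat"] by (intro mult_le_mono) auto
  then have "real (4 * m\<^sup>2) \<le> real (2 ^ a * (2 ^ a * 2 ^ a))" by (simp only: of_nat_le_iff)
  then have 3: "4 * real m ^ 2 \<le> 2 ^ a * (2 ^ a * 2 ^ a)" by simp
  have "(1 + vm / (1 + vm)) ^ T * real n * (4 * real m ^ 2) \<le> 2 ^ (7 * a) * 2 ^ a * (2 ^ a * (2 ^ a * 2 ^ a))"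
    by (rule mult_mono[OF mult_mono[OF 1 2] 3]) (use p in auto)
  also have "\<dots> = 2 ^ (11 * a)" by (simp add: power_add[symmetric])
  also have "\<dots> \<le> 2 ^ L" unfolding L_eq by (intro power_increasing) auto
  finally show ?thesis .
qed

lemma dp_guarantee:
  "(1 - 3 / real m) * best n v (peak n) T (\<lambda>_. 0)
    \<le> policy_value v (greedy_policy n (rounded_weight m n T v) (capped_load L n)) (peak n) T (\<lambda>_. 0)"
proof -
  define d where "d = 1 / (real m * real L)"
  have L0: "0 < real L" using L_pos by simp
  have d0: "0 < d" using L0 m by (simp add: d_def)
  have q: "mesh_ratio m n = 1 + d" "1 < mesh_ratio m n" using d0 by (simp_all add: mesh_ratio_def d_def)
  have \<eta>: "0 < mesh_start m n T" using m n T by (simp add: mesh_start_def)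
  note cw = class_weight_bounds[OF \<eta> q(2)]
  have pos: "0 < v i" if "i \<in> {1..n}" for i using v that by blast
  show ?thesis
  proof (rule rounded_greedy_policy[OF n T m nonneg, where w = vm and d = d and \<eta> = "mesh_start m n T"])
    show "nonneg_weights n (rounded_weight m n T v)"
      using cw(1)[OF pos] by (auto simp: nonneg_weights_def rounded_weight_def)
    show "rounded_weight m n T v i \<le> v i" if "i \<in> {1..n}" for i
      using cw(2)[OF pos[OF that]] by (simp add: rounded_weight_def)
    show "if 0 < rounded_weight m n T v i then v i \<le> (1 + d) * rounded_weight m n T v i else v i \<le> mesh_start m n T"
      if "i \<in> {1..n}" for i
      using cw(3)[OF pos[OF that]] by (simp only: rounded_weight_def q(1)[symmetric])
    have "d * harm T \<le> d * real L" using harm_T_le d0 by (intro mult_left_mono) auto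
    then show "d * harm T \<le> 1 / real m" using L0 by (simp add: d_def)
    show "mesh_start m n T * (4 * real m ^ 2 * real n * real T) \<le> 1"
      using m n T by (simp add: mesh_start_def power2_eq_square)
  qed (use vm heavy d0 \<eta> cap_suffices in auto)
qed

lemma dp_time:
  assumes n2: "2 \<le> n" and r: "r \<le> T"
  defines "k \<equiv> class_of (mesh_start m n T) (mesh_ratio m n) vm"
  shows "r * (200 * ((2 ^ bit_length n) ^ (Suc k * Suc L)) ^ 3) \<le> 200 * n ^ (32 * m * L ^ 3)"
proof -
  let ?K = "Suc k * Suc L" and ?Z = "(2 ^ bit_length n) ^ (Suc k * Suc L) :: nat"
  note L0 = L_pos
  have b0: "1 \<le> bit_length n" using less_bit_length[of n] n by (cases "bit_length n") auto
  have "4 * a \<le> Suc L" by (simp add: L_eq)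
  also have "\<dots> \<le> ?K" by simp
  also have "\<dots> \<le> bit_length n * ?K" using mult_le_mono1[OF b0, of ?K] by (simp only: mult_1)
  finally have "(2::nat) ^ (4 * a) \<le> 2 ^ (bit_length n * ?K)" by (rule power_increasing) simp
  then have r: "r \<le> ?Z" using r T_le_power unfolding power_mult[symmetric] by linarith
  have K: "?K \<le> 4 * m * L ^ 3"
  proof -
    have "1 \<le> m * L * L" using m L0 by simp
    then have "Suc k \<le> 2 * (m * L * L)" using class_le unfolding k_def by linarith
    then have "?K \<le> 2 * (m * L * L) * (2 * L)" using L0 by (intro mult_le_mono) auto
    also have "\<dots> = 4 * m * L ^ 3" by (simp add: power3_eq_cube)
    finally show ?thesis .
  qed
  have "(2::nat) ^ bit_length n \<le> n ^ 2"
    unfolding power2_eq_square using two_pow_bit_length_le[OF n] mult_le_mono1[OF n2, of n] by linarith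
  then have "?Z \<le> (n ^ 2) ^ ?K" by (rule power_mono) simp
  also have "\<dots> \<le> (n ^ 2) ^ (4 * m * L ^ 3)" using K n by (intro power_increasing) auto
  also have "\<dots> = n ^ (8 * m * L ^ 3)" unfolding power_mult[symmetric] by (simp add: mult_ac)
  finally have Z: "?Z \<le> n ^ (8 * m * L ^ 3)" .
  have "r * (200 * ?Z ^ 3) \<le> ?Z * (200 * ?Z ^ 3)" using r by (rule mult_le_mono1)
  also have "\<dots> = 200 * ?Z ^ 4" by (simp add: numeral_eq_Suc del: mult_Suc mult_Suc_right)
  also have "\<dots> \<le> 200 * (n ^ (8 * m * L ^ 3)) ^ 4" using Z by (intro mult_le_mono2 power_mono) auto
  also have "(n ^ (8 * m * L ^ 3)) ^ 4 = n ^ (32 * m * L ^ 3)" unfolding power_mult[symmetric] by (simp add: mult_ac)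
  finally show ?thesis .
qed

end

section \<open>Approximation guarantee and running time\<close>

lemma (in instance_bounds) approx_policy_in_policies: "approx_policy m n T v \<in> policies n"
  using heaviest(1)[OF v n] by (auto simp: policies_def approx_policy_def greedy_policy_def)

theorem (in instance_bounds) approx_policy_guarantee:
  "(1 - 3 / real m) * opt_dp n T v \<le> expected_max_load n T v (approx_policy m n T v)"
proof -
  let ?f = "peak n" and ?z = "\<lambda>_::nat. 0::nat"
  obtain A where A: "A \<in> policies n" and OA: "expected_max_load n T v A = opt_dp n T v"
    using opt_dp_attained(1)[OF v] by blast
  have O: "opt_dp n T v = policy_value v A ?f T ?z"
    using OA expected_max_load_eq[OF A v] by simp
  have O0: "0 \<le> opt_dp n T v"
    unfolding O using policy_value_mono[OF nonneg A, of "\<lambda>_. 0" ?f T ?z]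
    by (simp add: policy_value_const[OF nonneg A])
  have E: "expected_max_load n T v (approx_policy m n T v) = policy_value v (approx_policy m n T v) ?f T ?z"
    by (rule expected_max_load_eq[OF approx_policy_in_policies v])
  have mr: "2 \<le> real m" using m by simp
  have weaken: "(1 - 3 / real m) * opt_dp n T v \<le> (1 - c / real m) * opt_dp n T v" if "c \<le> 3" for c
    using O0 that mr by (intro mult_right_mono diff_left_mono divide_right_mono) auto
  note h = heaviest[OF v n]
  consider (single) "n = 1 \<or> (1 + vm) * real L \<le> 4 * real T * vm"
    | (dominant) "n \<noteq> 1" "\<not> (1 + vm) * real L \<le> 4 * real T * vm" "real m \<le> vm"
    | (light) "n \<noteq> 1" "\<not> heaviest_suffices m n T v" "real m * total_weight v {1..n} \<le> 1"
    | (dp) "n \<noteq> 1" "\<not> heaviest_suffices m n T v" "\<not> real m * total_weight v {1..n} \<le> 1"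
    by (auto simp: heaviest_suffices_def)
  then show ?thesis
  proof cases
    case single
    then have ap: "approx_policy m n T v = (\<lambda>_ _. {heaviest v n})"
      by (auto simp: approx_policy_def heaviest_suffices_def fun_eq_iff)
    have p0: "0 \<le> real T * (vm / (1 + vm))" using vm(1) by simp
    have "ln (real n) \<le> (1 / real m)\<^sup>2 * (real T * (vm / (1 + vm)))"
    proof (cases "n = 1")
      case True
      then show ?thesis using p0 by simp
    next
      case False
      then have "real L \<le> 4 * (real T * (vm / (1 + vm)))"
        using single vm(1) by (simp add: field_simps)
      then have 1: "4 * real a \<le> real T * (vm / (1 + vm))" by (simp add: L_eq)
      have "ln (real n) \<le> ln (2 ^ bit_length n)"
        using n less_bit_length[of n] by (subst ln_le_cancel_iff) (auto simp flip: of_nat_less_iff)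
      also have "\<dots> = real (bit_length n) * ln 2" by (simp add: ln_realpow)
      also have "\<dots> \<le> real (bit_length n) * 1" using ln_2_less_1 by (intro mult_left_mono) auto
      finally have "real m ^ 2 * ln (real n) \<le> real m ^ 2 * real (Suc (bit_length n))" by (intro mult_left_mono) auto
      also have "\<dots> = real a" by (simp only: power2_eq_square of_nat_mult)
      finally have "real m ^ 2 * ln (real n) \<le> real T * (vm / (1 + vm))" using 1 by linarith
      then have "(1 / real m)\<^sup>2 * (real m ^ 2 * ln (real n)) \<le> (1 / real m)\<^sup>2 * (real T * (vm / (1 + vm)))"
        by (rule mult_left_mono) simp
      moreover have "(1 / real m)\<^sup>2 * (real m ^ 2 * ln (real n)) = ln (real n)"
        using mr by (simp add: power_divide)
      ultimately show ?thesis by simp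
    qed
    then have "(1 - 2 * (1 / real m)) * policy_value v A ?f T ?z \<le> policy_value v (\<lambda>_ _. {heaviest v n}) ?f T ?z"
      using h vm(2) mr by (intro offer_heaviest[OF n nonneg A]) auto
    then show ?thesis unfolding E unfolding ap using weaken[of 2] by (simp add: O)
  next
    case dominant
    then have ap: "approx_policy m n T v = (\<lambda>_ _. {heaviest v n})"
      by (auto simp: approx_policy_def heaviest_suffices_def fun_eq_iff)
    have "max_load n ?z = 0" using max_load_attained[OF n, of ?z] by auto
    then have "opt_dp n T v \<le> real T" unfolding O using policy_value_le_horizon[OF n nonneg A, of T ?z] by simp
    then have "(1 - 1 / real m) * opt_dp n T v \<le> (1 - 1 / real m) * real T" using mr by (intro mult_left_mono) auto
    also have "\<dots> \<le> vm / (1 + vm) * real T"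
    proof (rule mult_right_mono)
      have "1 / (1 + vm) \<le> 1 / real m" using dominant mr by (intro divide_left_mono) auto
      moreover have "vm / (1 + vm) = 1 - 1 / (1 + vm)" using vm(1) by (simp add: field_simps)
      ultimately show "1 - 1 / real m \<le> vm / (1 + vm)" by linarith
    qed simp
    also have "\<dots> \<le> policy_value v (\<lambda>_ _. {heaviest v n}) ?f T ?z"
      using policy_value_single[OF n nonneg h(1), of T] by (simp add: h(2) mult.commute)
    finally show ?thesis unfolding E unfolding ap using weaken[of 1] by simp
  next
    case light
    then have ap: "approx_policy m n T v = (\<lambda>_ _. {1..n})"
      by (auto simp: approx_policy_def fun_eq_iff)
    have tot: "total_weight v {1..n} \<le> 1 / real m" using light(3) mr by (simp add: field_simps)
    have "(1 - 1 / real m) * (1 + total_weight v {1..n}) \<le> (1 - 1 / real m) * (1 + 1 / real m)"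
      using tot mr by (intro mult_left_mono) auto
    also have "\<dots> \<le> 1" by (simp add: algebra_simps)
    finally have "(1 - 1 / real m) * policy_value v A ?f T ?z \<le> policy_value v (\<lambda>_ _. {1..n}) ?f T ?z"
      using offer_everything[OF n nonneg A, of "1 / real m" T ?z ?z] mr by simp
    then show ?thesis unfolding E unfolding ap using weaken[of 1] by (simp add: O)
  next
    case dp
    interpret dp_instance m n T v by unfold_locales (use dp in auto)
    have ap: "approx_policy m n T v = greedy_policy n (rounded_weight m n T v) (capped_load L n)"
      using dp by (auto simp: approx_policy_def fun_eq_iff)
    have "opt_dp n T v \<le> best n v ?f T ?z" unfolding O by (rule policy_value_le_best[OF nonneg A])
    moreover have "0 \<le> 1 - 3 / real m \<or> 1 - 3 / real m \<le> 0" by linarith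
    ultimately show ?thesis
    proof (elim disjE)
      assume *: "opt_dp n T v \<le> best n v ?f T ?z" "0 \<le> 1 - 3 / real m"
      then have "(1 - 3 / real m) * opt_dp n T v \<le> (1 - 3 / real m) * best n v ?f T ?z" by (intro mult_left_mono)
      then show ?thesis unfolding E unfolding ap using dp_guarantee by linarith
    next
      assume "1 - 3 / real m \<le> 0"
      then have "(1 - 3 / real m) * opt_dp n T v \<le> 0" using O0 by (simp add: mult_nonpos_nonneg)
      also have "0 \<le> policy_value v (approx_policy m n T v) ?f T ?z"
        using policy_value_mono[OF nonneg approx_policy_in_policies, of "\<lambda>_. 0" ?f T ?z]
        by (simp add: policy_value_const[OF nonneg approx_policy_in_policies])
      finally show ?thesis unfolding E .
    qed
  qed
qed

text \<open>The constant collects \<open>32 m L\<^sup>3\<close> with \<open>L \<le> 80 m\<^sup>2 ln n\<close>, and \<open>m \<le> 3 + 3 / \<epsilon>\<close>.\<close>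
definition time_exponent :: "real poly" where
  "time_exponent = smult 16384000 ([:3, 3:] ^ 7)"

theorem (in instance_bounds) approx_policy_time:
  assumes r: "r \<le> T" and x: "0 \<le> x" "real m \<le> 3 + 3 * x"
    and t: "t \<le> n * 10 + 40 + (if n = 1 then 0 else bit_length n * 3 + serving_time m n T v r)"
  shows "real t \<le> 300 * real n powr (poly time_exponent x * ln (real n) ^ 3)"
proof (cases "n = 1")
  case True
  then show ?thesis using t by simp
next
  case False
  then have n2: "2 \<le> n" using n by simp
  let ?E = "32 * m * L ^ 3"
  note L0 = L_pos
  have "t \<le> 53 * n + 200 * n ^ ?E"
  proof (cases "heaviest_suffices m n T v \<or> real m * total_weight v {1..n} \<le> 1")
    case True
    then have "t \<le> n * 10 + 40 + bit_length n * 3" using t False by (simp add: serving_time_def)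
    then show ?thesis using bit_length_le_self[of n] n2 by linarith
  next
    case reg: False
    interpret dp_instance m n T v by unfold_locales (use reg in auto)
    have "t \<le> n * 10 + 40 + (bit_length n * 3 + 200 * n ^ ?E)"
      using t dp_time[OF n2 r] False reg by (simp add: serving_time_def)
    then show ?thesis using bit_length_le_self[of n] n2 by linarith
  qed
  also have "\<dots> \<le> 300 * n ^ ?E"
  proof -
    have "1 \<le> ?E" using m L0 by simp
    then have "n ^ 1 \<le> n ^ ?E" using n by (intro power_increasing) auto
    then show ?thesis by simp
  qed
  finally have "real t \<le> real (300 * n ^ ?E)" by (simp only: of_nat_le_iff)
  also have "\<dots> = 300 * real n powr real ?E"
    using n powr_realpow[of "real n" ?E] by (simp only: of_nat_mult of_nat_power of_nat_numeral)
  also have "\<dots> \<le> 300 * real n powr (poly time_exponent x * ln (real n) ^ 3)"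
  proof (intro mult_left_mono powr_mono)
    have ln0: "0 \<le> ln (real n)" using n by simp
    have "real L = 16 * real m * real m * real (Suc (bit_length n))"
      by (simp only: level_cap_def of_nat_mult of_nat_numeral)
    also have "\<dots> \<le> 16 * real m * real m * (5 * ln (real n))"
      using Suc_bit_length_le_ln[OF n2] by (intro mult_left_mono) auto
    finally have "real L ^ 3 \<le> (80 * real m ^ 2 * ln (real n)) ^ 3"
      by (intro power_mono) (auto simp: power2_eq_square)
    also have "\<dots> = 512000 * real m ^ 6 * ln (real n) ^ 3" by (simp add: power_mult_distrib)
    finally have "32 * real m * real L ^ 3 \<le> 32 * real m * (512000 * real m ^ 6 * ln (real n) ^ 3)"
      by (rule mult_left_mono) simp
    also have "\<dots> = 16384000 * real m ^ 7 * ln (real n) ^ 3" by (simp add: eval_nat_numeral)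
    also have "\<dots> \<le> 16384000 * (3 + 3 * x) ^ 7 * ln (real n) ^ 3"
      using x ln0 by (intro mult_right_mono mult_left_mono power_mono) auto
    also have "\<dots> = poly time_exponent x * ln (real n) ^ 3" by (simp add: time_exponent_def mult_ac)
    finally show "real ?E \<le> poly time_exponent x * ln (real n) ^ 3" by simp
  qed (use n in auto)
  finally show ?thesis .
qed

theorem theorem5p1:
  "\<exists>(C::real) (p::real poly). \<forall>\<epsilon>::real. \<epsilon> > 0 \<longrightarrow>
     (\<exists>alg::policy_algorithm. \<forall>(n::nat) (T::nat) (v::nat \<Rightarrow> real).
        n \<ge> 1 \<longrightarrow> T \<ge> 1 \<longrightarrow> (\<forall>i\<in>{1..n}. v i > 0) \<longrightarrow>
        (\<exists>A\<in>policies n.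
           implements_within alg n T v A (C * real n powr (poly p (1 / \<epsilon>) * ln (real n) ^ 3)) \<and>
           expected_max_load n T v A \<ge> (1 - \<epsilon>) * opt_dp n T v))"
proof (intro exI[of _ "300::real"] exI[of _ time_exponent] allI impI)
  fix \<epsilon> :: real assume \<epsilon>: "\<epsilon> > 0"
  define m where "m = nat \<lceil>3 / \<epsilon>\<rceil> + 2"
  have e0: "0 \<le> 3 / \<epsilon>" using \<epsilon> by simp
  then have mm: "2 \<le> m" "3 / \<epsilon> \<le> real m" "real m \<le> 3 + 3 * (1 / \<epsilon>)"
    unfolding m_def by linarith+
  show "\<exists>alg. \<forall>n T v. n \<ge> 1 \<longrightarrow> T \<ge> 1 \<longrightarrow> (\<forall>i\<in>{1..n}. v i > 0) \<longrightarrow>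
        (\<exists>A\<in>policies n.
           implements_within alg n T v A (300 * real n powr (poly time_exponent (1 / \<epsilon>) * ln (real n) ^ 3)) \<and>
           expected_max_load n T v A \<ge> (1 - \<epsilon>) * opt_dp n T v)"
  proof (intro exI[of _ "Policy_Algorithm (Do (IConst ''z'' 0)) (assort_prog m)"] allI impI)
    fix n T :: nat and v :: "nat \<Rightarrow> real"
    assume n: "n \<ge> 1" and T: "T \<ge> 1" and v: "\<forall>i\<in>{1..n}. v i > 0"
    interpret instance_bounds m n T v by unfold_locales (use mm n T v in auto)
    let ?A = "approx_policy m n T v"
    let ?B = "300 * real n powr (poly time_exponent (1 / \<epsilon>) * ln (real n) ^ 3)"
    have x: "0 \<le> 1 / \<epsilon>" using \<epsilon> by simp
    let ?s = "effect (IConst ''z'' 0) (instance_mem n T v)"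
    have pre: "runs (Do (IConst ''z'' 0)) (instance_mem n T v) 1 ?s" by (rule runs.Do)
    have B1: "real 1 \<le> ?B" by (rule approx_policy_time[OF order_refl x mm(3)]) simp
    have serve: "\<exists>t' s'. runs (assort_prog m) (enter_state r l ?s) t' s' \<and> real t' \<le> ?B \<and> offered n s' = ?A r l"
      if "(r, l) \<in> customer_states n T" for r l
    proof -
      have r: "1 \<le> r" "r \<le> T" using that by (auto simp: customer_states_def)
      have "wp (assort_prog m) (\<lambda>t s'. offered n s' = ?A r l \<and>
        t \<le> n * 10 + 40 + (if n = 1 then 0 else bit_length n * 3 + serving_time m n T v r)) (enter_state r l ?s)"
        by (rule wp_assort_prog) (use n T m r v in \<open>auto simp: enter_state_def instance_mem_def\<close>)
      then show ?thesis unfolding wp_def using approx_policy_time[OF r(2) x mm(3)] by blast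
    qed
    have "implements_within (Policy_Algorithm (Do (IConst ''z'' 0)) (assort_prog m)) n T v ?A ?B"
      unfolding implements_within_def policy_algorithm.sel
      by (rule exI[of _ 1], rule exI[of _ ?s]) (use pre B1 serve in blast)
    moreover have "(1 - \<epsilon>) * opt_dp n T v \<le> expected_max_load n T v ?A"
    proof -
      have "0 \<le> expected_max_load n T v (\<lambda>_ _. {})" by (simp add: expected_max_load_def)
      then have O0: "0 \<le> opt_dp n T v"
        using opt_dp_attained(2)[OF v, of "\<lambda>_ _. {}" T] by (simp add: policies_def)
      have "3 / real m \<le> \<epsilon>" using mm(1,2) \<epsilon> by (simp add: field_simps)
      then have "(1 - \<epsilon>) * opt_dp n T v \<le> (1 - 3 / real m) * opt_dp n T v" using O0 by (intro mult_right_mono) auto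
      then show ?thesis using approx_policy_guarantee by linarith
    qed
    ultimately show "\<exists>A\<in>policies n. implements_within (Policy_Algorithm (Do (IConst ''z'' 0)) (assort_prog m)) n T v A ?B \<and>
        (1 - \<epsilon>) * opt_dp n T v \<le> expected_max_load n T v A"
      using approx_policy_in_policies by blast
  qed
qed

end
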